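(* Let $\alpha,\beta\in\mathbb{T}=\mathbb{R}/\mathbb{Z}$ be irrational and let $T,R\colon\mathbb{T}\to\mathbb{T}$, $T(x)=x+\alpha$, $R(x)=x+\beta$. Let $f,g\colon\mathbb{T}\to\mathbb{R}_+$ be (strictly positive) roof functions with $\int_{\mathbb{T}} f(x)\,dx=\int_{\mathbb{T}} g(x)\,dx=1$ of the form $$f(x)=A_f\{x\}+f_{ac}(x),\qquad g(x)=A_g\{x\}+g_{ac}(x),$$ where $A_f,A_g\in\mathbb{R}\setminus\{0\}$ and $f_{ac},g_{ac}\in C^1(\mathbb{T})$. Let $\mathcal{T}=(T^f_t)_{t\in\mathbb{R}}$ be the special flow over $T$ under $f$, and let $\mathcal{R}=(R^g_t)_{t\in\mathbb{R}}$ be the special flow over $R$ under $g$. If $|A_f|\neq|A_g|$, then the flows $\mathcal{T}$ and $\mathcal{R}$ are not isomorphic.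
   Context: $\mathbb{T}=\mathbb{R}/\mathbb{Z}$ is identified with $[0,1)$, $\{x\}$ is the fractional part of $x$, $\mu$ is Lebesgue measure on $\mathbb{T}$ and $\lambda$ is Lebesgue measure on $\mathbb{R}$. Special flow: for an ergodic automorphism $T$ of $(X,\mathcal{B},\mu)$ and a strictly positive $f\in L^1(X,\mu)$ put $f^{(n)}(x)=f(x)+f(Tx)+\dots+f(T^{n-1}x)$ for $n>0$, $f^{(0)}(x)=0$, and $f^{(n)}(x)=-(f(T^nx)+\dots+f(T^{-1}x))$ for $n<0$. The special flow $(T^f_t)_{t\in\mathbb{R}}$ over $T$ under the roof function $f$ acts on $X^f=\{(x,s)\in X\times\mathbb{R}: 0\le s<f(x)\}$, equipped with the restriction $\mu^f$ of $\mu\otimes\lambda$, by $T^f_t(x,s)=(T^nx,\,s+t-f^{(n)}(x))$, where $n\in\mathbb{Z}$ is the unique integer with $f^{(n)}(x)\le s+t<f^{(n+1)}(x)$. Here $\mu^f$ and $\mu^g$ are probability measures because the roof functions have integral $1$. Two probability preserving flows $(T_t)_{t\in\mathbb{R}}$ on $(X,\mu)$ and $(R_t)_{t\in\mathbb{R}}$ on $(Y,\nu)$ are isomorphic if there is an invertible measure preserving transformation $S\colon X\to Y$ such that $S\circ T_t=R_t\circ S$ for every $t\in\mathbb{R}$ (as usual in ergodic theory, understood modulo null sets). *)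

theory Defs
  imports "HOL-Analysis.Analysis"
begin

section \<open>The circle\<close>

text \<open>The circle \<open>\<real>/\<int>\<close> is represented by its fundamental domain \<open>[0,1)\<close>.\<close>

abbreviation circle :: "real set" where
  "circle \<equiv> {0..<1}"

definition circle_measure :: "real measure" where
  "circle_measure = restrict_space lborel circle"

definition rotation :: "real \<Rightarrow> real \<Rightarrow> real" where
  "rotation \<alpha> x = frac (x + \<alpha>)"

text \<open>
  Smoothness on the circle is smoothness of the 1-periodic lift to the line, so it includes
  the matching of values and derivatives at the endpoints of \<open>[0,1)\<close>.
\<close>

definition C1_circle :: "(real \<Rightarrow> real) \<Rightarrow> bool" where
  "C1_circle h \<longleftrightarrow> (\<lambda>x. h (frac x)) C1_differentiable_on UNIV"

section \<open>Special flows\<close>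

text \<open>
  The base map is a bijection \<open>T\<close> of the set \<open>X\<close>, which need not be all of the type; hence
  the inverse is taken relative to \<open>X\<close>.
\<close>

definition int_iterate :: "'a set \<Rightarrow> ('a \<Rightarrow> 'a) \<Rightarrow> int \<Rightarrow> 'a \<Rightarrow> 'a" where
  "int_iterate X T n = (if n \<ge> 0 then T ^^ nat n else inv_into X T ^^ nat (- n))"

definition birkhoff_sum ::
    "'a set \<Rightarrow> ('a \<Rightarrow> 'a) \<Rightarrow> ('a \<Rightarrow> real) \<Rightarrow> int \<Rightarrow> 'a \<Rightarrow> real" where
  "birkhoff_sum X T f n x =
     (if n \<ge> 0 then (\<Sum>k\<in>{0..<n}. f (int_iterate X T k x))
      else - (\<Sum>k\<in>{n..<0}. f (int_iterate X T k x)))"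

definition special_flow ::
    "'a set \<Rightarrow> ('a \<Rightarrow> 'a) \<Rightarrow> ('a \<Rightarrow> real) \<Rightarrow> real \<Rightarrow> 'a \<times> real \<Rightarrow> 'a \<times> real" where
  "special_flow X T f t = (\<lambda>(x, s).
     let n = (THE n. birkhoff_sum X T f n x \<le> s + t \<and> s + t < birkhoff_sum X T f (n + 1) x)
     in (int_iterate X T n x, s + t - birkhoff_sum X T f n x))"

definition special_measure :: "'a measure \<Rightarrow> ('a \<Rightarrow> real) \<Rightarrow> ('a \<times> real) measure" where
  "special_measure M f =
     restrict_space (M \<Otimes>\<^sub>M lborel) {(x, s). x \<in> space M \<and> 0 \<le> s \<and> s < f x}"

section \<open>Isomorphism of flows\<close>

text \<open>
  Isomorphism modulo null sets: \<open>S\<close> is invertible up to null sets, with almost everywhere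
  inverse \<open>S'\<close>, and the exceptional null set in the intertwining relation may depend on \<open>t\<close>.
\<close>

definition flows_isomorphic ::
    "'a measure \<Rightarrow> (real \<Rightarrow> 'a \<Rightarrow> 'a) \<Rightarrow> 'b measure \<Rightarrow> (real \<Rightarrow> 'b \<Rightarrow> 'b) \<Rightarrow> bool" where
  "flows_isomorphic M \<phi> N \<psi> \<longleftrightarrow>
     (\<exists>S S'. S \<in> measurable M N \<and> distr M N S = N \<and>
             S' \<in> measurable N M \<and> distr N M S' = M \<and>
             (AE x in M. S' (S x) = x) \<and> (AE y in N. S (S' y) = y) \<and>
             (\<forall>t. AE x in M. S (\<phi> t x) = \<psi> t (S x)))"

end

theory Submission
  imports Defs
begin

text \<open>
  Write \<open>T\<close> and \<open>R\<close> for the two special flows.  The proof looks at the flows at a rigidity time of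
  the first rotation, that is, at a denominator \<open>q\<close> with \<open>\<bar>q \<alpha> - p\<bar> \<le> 1/(2q)\<close>.  After \<open>q\<close> steps
  the rotation by \<open>\<alpha>\<close> is back close to the identity, so \<open>T\<close> at time \<open>q\<close> moves the point \<open>(x, s)\<close>
  approximately along its own orbit, by the displacement \<open>- \<tau> x\<close> with \<open>\<tau> x = f\<^sup>(\<^sup>q\<^sup>)(x) - q\<close>, which is
  bounded independently of \<open>q\<close>.  An isomorphism \<open>S\<close> carries this over to the second flow: with
  \<open>\<sigma> = \<tau> \<circ> S\<^sup>-\<^sup>1\<close>, the flow \<open>R\<close> brings most points \<open>y\<close> back close to themselves in the time \<open>q + \<sigma> y\<close>.

  For the second flow such a near return is very restrictive.  Move \<open>y\<close> horizontally by
  \<open>1/(2q)\<close>.  The derivative of the roof \<open>g\<close> away from its jump has mean \<open>A\<^sub>g\<close>, so during the time \<open>q\<close>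
  the two orbits drift apart in the direction of the flow by \<open>A\<^sub>g/2\<close>, up to an integer multiple
  of \<open>A\<^sub>g\<close> that counts the passages of the discontinuity between them.  Since the rotation by \<open>\<beta>\<close> is
  free, this forces \<open>\<sigma>\<close> to change by \<open>A\<^sub>g/2\<close> modulo \<open>A\<^sub>g\<close>.  A translation by \<open>1/(2q)\<close> almost preserves
  the measure, and therefore the Fourier coefficient of \<open>\<sigma>\<close> at the frequency \<open>1/A\<^sub>g\<close> tends to zero as
  \<open>q\<close> grows (\<open>nearly_returning_cancellation\<close>).

  On the other hand \<open>\<sigma>\<close> and \<open>\<tau>\<close> have the same distribution, and \<open>\<tau>\<close> can be computed.  The regular part
  of \<open>f\<close> contributes an error that tends to zero (\<open>orbit_sum_C1_close_fraction\<close>), and the linear part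
  contributes a sawtooth of height \<open>A\<^sub>f\<close> on each interval of length \<open>1/q\<close>
  (\<open>orbit_sum_frac_block\<close>).  If \<open>\<bar>A\<^sub>f\<bar> < \<bar>A\<^sub>g\<bar>\<close>, the values of a sawtooth of height \<open>A\<^sub>f\<close> do not fill
  the circle of length \<open>A\<^sub>g\<close> evenly, and the Fourier coefficient of \<open>\<tau>\<close> at the frequency \<open>1/A\<^sub>g\<close> stays away
  from zero (\<open>rigidity_time_fourier_coefficient\<close>).  This contradiction settles the case
  \<open>\<bar>A\<^sub>f\<bar> < \<bar>A\<^sub>g\<bar>\<close>; in the other case the two flows exchange their roles.
\<close>

section \<open>Rational approximation of an irrational number\<close>

text \<open>
  The constant \<open>1/2\<close> matters: with \<open>\<theta> = q (q \<alpha> - p)\<close>, the points \<open>k \<alpha>\<close>, \<open>k < q\<close>, differ from the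
  points \<open>k p / q\<close> by \<open>(k / q) (\<theta> / q)\<close>, less than half of the spacing \<open>1/q\<close>.  It is also what keeps
  the phases in the Fourier coefficient computed below within a quarter turn.
\<close>

definition close_fraction :: "real \<Rightarrow> int \<Rightarrow> nat \<Rightarrow> bool" where
  "close_fraction \<alpha> p q \<longleftrightarrow> q > 0 \<and> coprime p (int q) \<and> \<bar>real q * \<alpha> - real_of_int p\<bar> \<le> 1 / (2 * real q)"

lemma of_int_mult_irrational:
  fixes \<alpha> :: real and k l :: int
  assumes "\<alpha> \<notin> \<rat>" "k \<noteq> 0"
  shows "k * \<alpha> \<noteq> l"
proof
  assume "k * \<alpha> = l"
  then have "\<alpha> = l / k" using assms(2) by (simp add: field_simps)
  then show False using assms(1) by (metis Rats_divide Rats_of_int)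
qed

text \<open>
  Freeness of the rotation in quantitative form: a point that comes back too close to itself within
  \<open>N\<close> steps has made no step.
\<close>

lemma multiples_away_from_integers:
  fixes \<alpha> :: real and N :: nat
  assumes "\<alpha> \<notin> \<rat>"
  shows "\<exists>\<epsilon>>0. \<forall>(k::int) (l::int). k \<noteq> 0 \<longrightarrow> \<bar>k\<bar> \<le> int N \<longrightarrow> \<bar>real_of_int k * \<alpha> - real_of_int l\<bar> \<ge> \<epsilon>"
proof -
  define D where "D = (\<lambda>k::int. min (frac (k * \<alpha>)) (1 - frac (k * \<alpha>)))"
  have D: "\<bar>k * \<alpha> - l\<bar> \<ge> D k" for k l :: int
  proof (cases "l \<le> \<lfloor>k * \<alpha>\<rfloor>")
    case True
    then have "real_of_int l \<le> \<lfloor>k * \<alpha>\<rfloor>" by simp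
    then show ?thesis unfolding D_def frac_def by linarith
  next
    case False
    then have "real_of_int l \<ge> \<lfloor>k * \<alpha>\<rfloor> + 1" by linarith
    then show ?thesis unfolding D_def frac_def by linarith
  qed
  have pos: "D k > 0" if "k \<noteq> 0" for k
  proof -
    have "frac (k * \<alpha>) \<noteq> 0"
      using of_int_mult_irrational[OF assms that, of "\<lfloor>k * \<alpha>\<rfloor>"] by (simp add: frac_def)
    then show ?thesis unfolding D_def using frac_ge_0[of "k*\<alpha>"] frac_lt_1[of "k*\<alpha>"] by linarith
  qed
  define K where "K = {k::int. k \<noteq> 0 \<and> \<bar>k\<bar> \<le> int N}"
  have "finite K" by (rule finite_subset[of _ "{- int N..int N}"]) (auto simp: K_def)
  define e where "e = Min (insert 1 (D ` K))"
  have "e > 0" unfolding e_def using \<open>finite K\<close> pos by (subst Min_gr_iff) (auto simp: K_def)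
  moreover have "\<bar>k * \<alpha> - l\<bar> \<ge> e" if "k \<noteq> 0" "\<bar>k\<bar> \<le> N" for k l :: int
  proof -
    have "e \<le> D k" unfolding e_def using that \<open>finite K\<close> by (intro Min_le) (auto simp: K_def)
    then show ?thesis using D[of k l] by simp
  qed
  ultimately show ?thesis by blast
qed

text \<open>
  One step of the Stern-Brocot descent replaces one of the two neighbours by their mediant, which
  keeps the determinant and increases the sum of the denominators.
\<close>

lemma farey_neighbours:
  fixes \<alpha> :: real
  assumes "\<alpha> \<notin> \<rat>"
  shows "\<exists>(a::int) (b::int) (c::int) (d::int). b > 0 \<and> d > 0 \<and> b * c - a * d = 1 \<and> real_of_int a < real_of_int b * \<alpha> \<and> real_of_int d * \<alpha> < real_of_int c \<and> b + d \<ge> int n"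
proof (induction n)
  case 0
  have "\<lfloor>\<alpha>\<rfloor> \<noteq> \<alpha>" using of_int_mult_irrational[OF assms, of 1 "\<lfloor>\<alpha>\<rfloor>"] by auto
  then have "\<lfloor>\<alpha>\<rfloor> < \<alpha>" "\<alpha> < \<lfloor>\<alpha>\<rfloor> + 1" by linarith+
  then show ?case by (intro exI[of _ "\<lfloor>\<alpha>\<rfloor>"] exI[of _ 1] exI[of _ "\<lfloor>\<alpha>\<rfloor> + 1"]) auto
next
  case (Suc n)
  then obtain a b c d :: int where *: "b > 0" "d > 0" "b * c - a * d = 1" "real_of_int a < real_of_int b * \<alpha>"
      "real_of_int d * \<alpha> < real_of_int c" "b + d \<ge> int n"
    by blast
  have "(b + d) * \<alpha> \<noteq> (a + c)" using of_int_mult_irrational[OF assms, of "b+d" "a+c"] * by auto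
  then consider "(b + d) * \<alpha> < (a + c)" | "(a + c) < (b + d) * \<alpha>" by linarith
  then show ?case
  proof cases
    case 1
    then show ?thesis using *
      by (intro exI[of _ a] exI[of _ b] exI[of _ "a+c"] exI[of _ "b+d"]) (auto simp: algebra_simps)
  next
    case 2
    then show ?thesis using *
      by (intro exI[of _ "a+c"] exI[of _ "b+d"] exI[of _ c] exI[of _ d]) (auto simp: algebra_simps)
  qed
qed

text \<open>
  For Farey neighbours \<open>a/b < \<alpha> < c/d\<close> the two errors add up to \<open>1/(bd) \<le> (1/b\<^sup>2 + 1/d\<^sup>2)/2\<close>,
  so one of the two fractions has error at most half the inverse square of its denominator.  The
  denominators are large because \<open>d (b \<alpha> - a) + b (c - d \<alpha>) = 1\<close>, whereas a denominator
  below \<open>N\<close> would leave an error that is bounded away from zero.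
\<close>

lemma close_fraction_unbounded:
  fixes \<alpha> :: real
  assumes "\<alpha> \<notin> \<rat>"
  shows "\<exists>p q. close_fraction \<alpha> p q \<and> q \<ge> N"
proof -
  obtain e where e: "e > 0" "\<And>(k::int) (l::int). k \<noteq> 0 \<Longrightarrow> \<bar>k\<bar> \<le> int N \<Longrightarrow> \<bar>real_of_int k * \<alpha> - real_of_int l\<bar> \<ge> e"
    using multiples_away_from_integers[OF assms, of N] by blast
  obtain a b c d :: int where *: "b > 0" "d > 0" "b * c - a * d = 1" "real_of_int a < real_of_int b * \<alpha>"
      "real_of_int d * \<alpha> < real_of_int c" "b + d \<ge> int (N + nat \<lceil>1 / e\<rceil> + 1)"
    using farey_neighbours[OF assms] by blast
  have large: "x > 1 / e" if "y < N" "x + y \<ge> int (N + nat \<lceil>1 / e\<rceil> + 1)" for x y :: int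
    using that e(1) by linarith
  define u where "u = b * \<alpha> - a"
  define v where "v = c - d * \<alpha>"
  have uv: "u > 0" "v > 0" using * by (auto simp: u_def v_def)
  have "d * u + b * v = of_int (b * c - a * d)" by (simp add: u_def v_def algebra_simps)
  then have sum: "d * u + b * v = 1" using *(3) by simp
  have db: "real_of_int b > 0" "real_of_int d > 0" using * by auto
  have bN: "b \<ge> N"
  proof (rule ccontr)
    assume "\<not> b \<ge> N"
    then have "d > 1 / e" using large[of b d] *(6) by (simp add: algebra_simps)
    moreover have "u \<ge> e" using e(2)[of b a] * \<open>\<not> b \<ge> N\<close> uv by (simp add: u_def)
    ultimately have "d * u > 1"
      using e(1) by (smt (verit) divide_less_eq mult.commute mult_left_mono db)
    then show False using sum uv db by (smt (verit) mult_pos_pos)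
  qed
  have dN: "d \<ge> N"
  proof (rule ccontr)
    assume "\<not> d \<ge> N"
    then have "b > 1 / e" using large[of d b] *(6) by (simp add: algebra_simps)
    moreover have "v \<ge> e" using e(2)[of d c] * \<open>\<not> d \<ge> N\<close> uv by (simp add: v_def)
    ultimately have "b * v > 1"
      using e(1) by (smt (verit) divide_less_eq mult.commute mult_left_mono db)
    then show False using sum uv db by (smt (verit) mult_pos_pos)
  qed
  have "u \<le> 1 / (2 * b) \<or> v \<le> 1 / (2 * d)"
  proof (rule ccontr)
    assume "\<not> ?thesis"
    then have "1 / (2 * b) < u" "1 / (2 * d) < v" by auto
    then have "d * (1 / (2 * b)) + b * (1 / (2 * d)) < 1"
      using sum db by (smt (verit) mult_strict_left_mono)
    then have "real_of_int d * real_of_int d + real_of_int b * real_of_int b < 2 * (real_of_int b * real_of_int d)" using db by (simp add: field_simps)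
    moreover have "0 \<le> (real_of_int d - real_of_int b) * (real_of_int d - real_of_int b)" by simp
    ultimately show False by (simp add: algebra_simps)
  qed
  then show ?thesis
  proof
    assume "u \<le> 1 / (2 * b)"
    moreover have "coprime a b"
      by (rule coprimeI) (metis *(3) dvd_diff dvd_mult dvd_mult2 mult.commute)
    ultimately have "close_fraction \<alpha> a (nat b)" using * uv by (auto simp: close_fraction_def u_def)
    then show ?thesis using bN by (intro exI[of _ a] exI[of _ "nat b"]) auto
  next
    assume "v \<le> 1 / (2 * d)"
    moreover have "coprime c d"
      by (rule coprimeI) (metis *(3) dvd_diff dvd_mult dvd_mult2 mult.commute)
    ultimately have "close_fraction \<alpha> c (nat d)" using * uv by (auto simp: close_fraction_def v_def)
    then show ?thesis using dN by (intro exI[of _ c] exI[of _ "nat d"]) auto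
  qed
qed

lemma close_fraction_residue:
  assumes "close_fraction \<alpha> p q"
  shows "\<exists>j<q. \<exists>l. int j * p = i + int q * l"
proof -
  have q: "q > 0" and c: "coprime p (int q)" using assms by (auto simp: close_fraction_def)
  obtain u v where uv: "u * p + v * int q = 1"
    using bezout_int[of p "int q"] c by (auto simp: coprime_iff_gcd_eq_1)
  define j where "j = (u * i) mod int q"
  have j: "0 \<le> j" "j < int q" using q by (auto simp: j_def)
  have "(u * i) = j + int q * ((u * i) div int q)" by (simp add: j_def)
  then have "j = u * i - int q * ((u * i) div int q)" by simp
  then have "j * p = u * p * i - int q * ((u * i) div int q) * p" by (metis (no_types, opaque_lifting) left_diff_distrib mult.assoc mult.commute)
  also have "u * p = 1 - v * int q" using uv by simp
  finally have "j * p = i + int q * (- v * i - ((u * i) div int q) * p)" by (simp add: algebra_simps)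
  then show ?thesis using j by (intro exI[of _ "nat j"]) auto
qed

lemma rotation_orbit_dense:
  assumes "close_fraction \<alpha> p q"
  shows "\<exists>j<q. \<exists>l. \<bar>x + real j * \<alpha> - real_of_int l - y\<bar> \<le> 2 / real q"
proof -
  have q: "real q > 0" and a: "\<bar>real q * \<alpha> - real_of_int p\<bar> \<le> 1 / (2 * real q)" using assms by (auto simp: close_fraction_def)
  define i where "i = \<lfloor>real q * (y - x)\<rfloor>"
  obtain j l where j: "j < q" "int j * p = i + int q * l" using close_fraction_residue[OF assms] by blast
  have e1: "\<bar>real q * (y - x) - real_of_int i\<bar> \<le> 1" unfolding i_def by linarith
  have "real_of_int (int j * p) = real_of_int (i + int q * l)" using j by simp
  then have jp: "real j * real_of_int p = real_of_int i + real q * real_of_int l" by simp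
  have "real q * (x + real j * \<alpha> - real_of_int l - y) = real j * (real q * \<alpha> - p) + (real j * real_of_int p - real q * real_of_int l - real q * (y - x))"
    by (simp add: algebra_simps)
  also have "\<dots> = real j * (real q * \<alpha> - p) + (i - real q * (y - x))" using jp by simp
  finally have e: "real q * (x + real j * \<alpha> - real_of_int l - y) = real j * (real q * \<alpha> - p) + (i - real q * (y - x))" .
  have "\<bar>real j * (real q * \<alpha> - p)\<bar> \<le> real q * (1 / (2 * real q))"
    unfolding abs_mult using a j by (intro mult_mono) auto
  then have "\<bar>real j * (real q * \<alpha> - p)\<bar> \<le> 1" using q by simp
  then have "\<bar>real q * (x + real j * \<alpha> - real_of_int l - y)\<bar> \<le> 2" unfolding e using e1 by linarith
  then have "real q * \<bar>x + real j * \<alpha> - real_of_int l - y\<bar> \<le> 2" by (simp add: abs_mult)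
  then show ?thesis using j q by (intro exI[of _ j]) (auto simp: field_simps intro!: exI[of _ l])
qed

section \<open>Birkhoff sums over a rotation\<close>

text \<open>
  Here \<open>h\<close> is the 1-periodic lift of a function on the circle; on the line no reduction modulo 1 is
  needed between the steps, and the sums can be differentiated in \<open>x\<close>.
\<close>

definition orbit_sum :: "real \<Rightarrow> (real \<Rightarrow> real) \<Rightarrow> nat \<Rightarrow> real \<Rightarrow> real" where
  "orbit_sum \<alpha> h n x = (\<Sum>k<n. h (x + real k * \<alpha>))"

lemma orbit_sum_0 [simp]: "orbit_sum \<alpha> h 0 x = 0"
  by (simp add: orbit_sum_def)

lemma orbit_sum_Suc: "orbit_sum \<alpha> h (Suc n) x = orbit_sum \<alpha> h n x + h (x + real n * \<alpha>)"
  by (simp add: orbit_sum_def)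

lemma orbit_sum_add: "orbit_sum \<alpha> h (m + n) x = orbit_sum \<alpha> h m x + orbit_sum \<alpha> h n (x + real m * \<alpha>)"
  by (induction n) (auto simp: orbit_sum_Suc algebra_simps)

lemma orbit_sum_plus: "orbit_sum \<alpha> (\<lambda>x. u x + v x) n x = orbit_sum \<alpha> u n x + orbit_sum \<alpha> v n x"
  by (simp add: orbit_sum_def sum.distrib)

lemma orbit_sum_scale: "orbit_sum \<alpha> (\<lambda>x. c * u x) n x = c * orbit_sum \<alpha> u n x"
  by (simp add: orbit_sum_def sum_distrib_left)

text \<open>
  A sum over \<open>q + j\<close> steps can be split after \<open>q\<close> or after \<open>j\<close> steps.  The identity turns the comparison of
  long sums at distant points of an orbit into the comparison of short sums at two points whose
  distance is that of \<open>q \<alpha>\<close> to the integers.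
\<close>

lemma orbit_sum_cocycle:
  "orbit_sum \<alpha> h q (x + real j * \<alpha>) - orbit_sum \<alpha> h q x = orbit_sum \<alpha> h j (x + real q * \<alpha>) - orbit_sum \<alpha> h j x"
  using orbit_sum_add[of \<alpha> h j q x] orbit_sum_add[of \<alpha> h q j x] by (simp add: add.commute)

lemma periodic_int:
  fixes h :: "real \<Rightarrow> real"
  assumes "\<And>x. h (x + 1) = h x"
  shows "h (x + of_int l) = h x"
proof (induction l rule: int_induct[where k=0])
  case (step1 i) then show ?case using assms[of "x + of_int i"] by (simp add: algebra_simps)
next
  case (step2 i) then show ?case using assms[of "x + of_int (i - 1)"] by (simp add: algebra_simps)
qed auto

lemma orbit_sum_periodic:
  assumes "\<And>x. h (x + 1) = h x"
  shows "orbit_sum \<alpha> h n (x + of_int l) = orbit_sum \<alpha> h n x"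
  unfolding orbit_sum_def
proof (rule sum.cong)
  fix k
  show "h (x + of_int l + k * \<alpha>) = h (x + real k * \<alpha>)"
    using periodic_int[of h "x + k * \<alpha>" l] assms by (simp add: algebra_simps)
qed simp

lemma periodic_bounded:
  fixes h :: "real \<Rightarrow> real"
  assumes "\<And>x. h (x + 1) = h x" "continuous_on UNIV h"
  obtains B where "B > 0" "\<And>x. \<bar>h x\<bar> \<le> B"
proof -
  have "compact (h ` {0..1})" using assms(2) by (intro compact_continuous_image) (auto intro: continuous_on_subset)
  then have "bounded (h ` {0..1})" by (rule compact_imp_bounded)
  then obtain B where B: "B > 0" "\<And>x. x \<in> {0..1} \<Longrightarrow> \<bar>h x\<bar> \<le> B" by (auto simp: bounded_pos)
  have "\<bar>h x\<bar> \<le> B" for x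
    using B(2)[of "frac x"] periodic_int[of h "frac x" "\<lfloor>x\<rfloor>"] assms(1) frac_lt_1[of x]
    by (simp add: frac_def less_imp_le)
  then show thesis using that B by blast
qed

lemma periodic_uniformly_continuous:
  fixes h :: "real \<Rightarrow> real"
  assumes "\<And>x. h (x + 1) = h x" "continuous_on UNIV h" "\<epsilon> > 0"
  shows "\<exists>\<delta>>0. \<forall>x y. \<bar>x - y\<bar> \<le> \<delta> \<longrightarrow> \<bar>h x - h y\<bar> \<le> \<epsilon>"
proof -
  have "uniformly_continuous_on {-1..2} h"
    using assms(2) by (intro compact_uniformly_continuous) (auto intro: continuous_on_subset)
  then obtain d where d: "d > 0" "\<And>x y. x \<in> {-1..2} \<Longrightarrow> y \<in> {-1..2} \<Longrightarrow> dist y x < d \<Longrightarrow> dist (h y) (h x) < \<epsilon>"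
    unfolding uniformly_continuous_on_def using assms(3) by metis
  have "\<bar>h x - h y\<bar> \<le> \<epsilon>" if "\<bar>x - y\<bar> \<le> min (d/2) 1" for x y
  proof -
    have e: "h x = h (frac x)" "h y = h (y - of_int \<lfloor>x\<rfloor>)"
      using periodic_int[of h "frac x" "\<lfloor>x\<rfloor>"] periodic_int[of h "y - of_int \<lfloor>x\<rfloor>" "\<lfloor>x\<rfloor>"] assms(1)
      by (simp_all add: frac_def)
    have b: "frac x \<ge> 0" "frac x < 1" "\<bar>frac x - (y - of_int \<lfloor>x\<rfloor>)\<bar> \<le> d/2" "\<bar>frac x - (y - of_int \<lfloor>x\<rfloor>)\<bar> \<le> 1"
      using that by (auto simp: frac_lt_1) (auto simp: frac_def)
    have "dist (h (y - of_int \<lfloor>x\<rfloor>)) (h (frac x)) < \<epsilon>"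
    proof (rule d(2))
      show "frac x \<in> {-1..2}" "y - of_int \<lfloor>x\<rfloor> \<in> {-1..2}" using b by (simp_all, linarith+)
      show "dist (y - of_int \<lfloor>x\<rfloor>) (frac x) < d" using b d(1) unfolding dist_real_def by linarith
    qed
    then show ?thesis unfolding e dist_real_def by (simp add: abs_minus_commute)
  qed
  then show ?thesis using d(1) by (intro exI[of _ "min (d/2) 1"]) auto
qed

text \<open>
  The primitive of \<open>h - m\<close> is periodic; its Birkhoff sum is a differentiable periodic function whose
  derivative, the Birkhoff sum of \<open>h - m\<close>, has a zero by Rolle's theorem.
\<close>

text \<open>
  The primitive of \<open>h - m\<close> is periodic; its Birkhoff sum is a differentiable periodic function whose
  derivative, the Birkhoff sum of \<open>h - m\<close>, has a zero by Rolle's theorem.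
\<close>

lemma orbit_sum_attains_mean:
  fixes h :: "real \<Rightarrow> real"
  assumes per: "\<And>x. h (x + 1) = h x" and cont: "continuous_on UNIV h" and int: "(h has_integral m) {0..1}"
  shows "\<exists>x. orbit_sum \<alpha> h n x = real n * m"
proof -
  obtain P where P: "\<And>x. (P has_real_derivative h x) (at x)"
  proof -
    have c: "isCont h x" for x using cont by (simp add: continuous_on_eq_continuous_at)
    have "\<exists>g. \<forall>x::real. (g has_vector_derivative h x) (at x)"
    proof -
      define g where "g = (\<lambda>x. if x \<ge> 0 then integral {0..x} h else - integral {x..0} h)"
      \<comment> \<open>near any given point \<open>g\<close> agrees with some \<open>G N\<close>, which integrates from a fixed lower limit and is
        therefore differentiable by the fundamental theorem of calculus\<close>
      define G where "G = (\<lambda>N::nat. \<lambda>x. integral {-real N..x} h - integral {-real N..0} h)"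
      have gG: "g x = G N x" if "\<bar>x\<bar> \<le> N" for x N
      proof -
        have i: "h integrable_on {a..b}" for a b using cont by (intro integrable_continuous_interval) (auto intro: continuous_on_subset)
        show ?thesis
        proof (cases "x \<ge> 0")
          case True
          have "integral {-real N..0} h + integral {0..x} h = integral {-real N..x} h"
            using True that by (intro Henstock_Kurzweil_Integration.integral_combine i) auto
          then show ?thesis using True by (simp add: g_def G_def)
        next
          case False
          have "integral {-real N..x} h + integral {x..0} h = integral {-real N..0} h"
            using False that by (intro Henstock_Kurzweil_Integration.integral_combine i) auto
          then show ?thesis using False by (simp add: g_def G_def)
        qed
      qed
      have "(g has_vector_derivative h x) (at x)" for x
      proof -
        define N where "N = nat \<lceil>\<bar>x\<bar> + 1\<rceil>"
        have N: "\<bar>x\<bar> < real N" unfolding N_def by linarith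
        have "((\<lambda>u. integral {-real N..u} h) has_vector_derivative h x) (at x within {-real N..real N})"
          using N by (intro integral_has_vector_derivative) (auto intro: continuous_on_subset[OF cont])
        moreover have "at x within {-real N..real N} = at x"
          using N by (intro at_within_interior) (auto simp: abs_less_iff)
        ultimately have "(G N has_vector_derivative h x) (at x)"
          unfolding G_def by (auto intro!: derivative_eq_intros)
        then show ?thesis
        proof (rule has_vector_derivative_transform_within_open)
          show "open {-real N<..<real N}" "x \<in> {-real N<..<real N}" using N by auto
          show "G N u = g u" if "u \<in> {-real N<..<real N}" for u
            using gG[of u N] that by (simp add: abs_le_iff)
        qed
      qed
      then show ?thesis by blast
    qed
    then show thesis using that by (auto simp: has_real_derivative_iff_has_vector_derivative)
  qed
  define Q where "Q = (\<lambda>x. P x - m * x)"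
  have Qd: "(Q has_real_derivative h x - m) (at x)" for x
    unfolding Q_def by (auto intro!: derivative_eq_intros P)
  have "(h has_integral P 1 - P 0) {0..1}"
    using P by (intro fundamental_theorem_of_calculus)
      (auto simp: has_real_derivative_iff_has_vector_derivative[symmetric] intro: has_field_derivative_at_within)
  then have Q1: "Q 1 = Q 0" using int by (auto simp: Q_def dest: has_integral_unique)
  have Qp: "Q (x + 1) = Q x" for x
  proof -
    have "((\<lambda>x. Q (x + 1) - Q x) has_real_derivative 0) (at x)" for x
    proof -
      have "((\<lambda>x. Q (x + 1)) has_real_derivative h (x + 1) - m) (at x)"
        using Qd[of "x+1"] by (simp add: DERIV_shift)
      then show ?thesis using Qd[of x] per[of x] by (auto intro!: derivative_eq_intros)
    qed
    then have "Q (x + 1) - Q x = Q (0 + 1) - Q 0" by (intro DERIV_isconst_all[of  "\<lambda>x. Q (x + 1) - Q x"] allI)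
    then show ?thesis using Q1 by simp
  qed
  have Sd: "(orbit_sum \<alpha> Q n has_real_derivative orbit_sum \<alpha> h n x - real n * m) (at x)" for x
  proof -
    have "((\<lambda>x. \<Sum>k<n. Q (x + real k * \<alpha>)) has_real_derivative (\<Sum>k<n. h (x + real k * \<alpha>) - m)) (at x)"
      by (intro DERIV_sum DERIV_shift[THEN iffD1] Qd)
    then show ?thesis by (simp add: orbit_sum_def[abs_def] sum_subtractf)
  qed
  have "orbit_sum \<alpha> Q n 0 = orbit_sum \<alpha> Q n 1" using orbit_sum_periodic[of Q \<alpha> n 0 1] Qp by simp
  moreover have "continuous_on {0..1} (orbit_sum \<alpha> Q n)"
    using Sd by (intro continuous_at_imp_continuous_on) (auto intro: DERIV_isCont)
  ultimately obtain z where "(orbit_sum \<alpha> Q n has_real_derivative 0) (at z)"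
    using Rolle[of 0 1 "orbit_sum \<alpha> Q n"] Sd by (auto simp: real_differentiable_def)
  then have "orbit_sum \<alpha> h n z - n * m = 0" using DERIV_unique Sd by blast
  then show ?thesis by auto
qed

text \<open>
  The sum equals \<open>q m\<close> at some point \<open>x0\<close>.  Some \<open>x + j \<alpha>\<close> with \<open>j < q\<close> is within \<open>2/q\<close> of \<open>x0\<close>
  modulo 1, and passing from \<open>x\<close> to \<open>x + j \<alpha>\<close> changes the sum only by an increment of a shorter sum,
  by the cocycle identity.  So a bound on the increments of orbit sums over distances of order
  \<open>1/q\<close> bounds the deviation from the mean.
\<close>

lemma orbit_sum_near_mean:
  fixes h :: "real \<Rightarrow> real"
  assumes per: "\<And>x. h (x + 1) = h x" and cont: "continuous_on UNIV h" and int: "(h has_integral m) {0..1}"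
    and cf: "close_fraction \<alpha> p q"
    and inc: "\<And>j d x. j \<le> q \<Longrightarrow> \<bar>d\<bar> \<le> 2 / real q \<Longrightarrow> \<bar>orbit_sum \<alpha> h j (x + d) - orbit_sum \<alpha> h j x\<bar> \<le> \<epsilon>"
  shows "\<bar>orbit_sum \<alpha> h q x - real q * m\<bar> \<le> 2 * \<epsilon>"
proof -
  have q: "real q > 0" and a: "\<bar>real q * \<alpha> - real_of_int p\<bar> \<le> 1 / (2 * real q)"
    using cf by (auto simp: close_fraction_def)
  obtain x0 where x0: "orbit_sum \<alpha> h q x0 = real q * m" using orbit_sum_attains_mean[of h m \<alpha> q] per cont int by blast
  obtain j l where j: "j < q" "\<bar>x + real j * \<alpha> - real_of_int l - x0\<bar> \<le> 2 / real q"
    using rotation_orbit_dense[OF cf] by blast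
  define d where "d = x + real j * \<alpha> - real_of_int l - x0"
  have "x0 + d + real_of_int l = x + real j * \<alpha>" by (simp add: d_def)
  then have "orbit_sum \<alpha> h q (x + real j * \<alpha>) = orbit_sum \<alpha> h q (x0 + d)"
    using orbit_sum_periodic[of h \<alpha> q "x0 + d" l] per by simp
  then have 1: "\<bar>orbit_sum \<alpha> h q (x + real j * \<alpha>) - real q * m\<bar> \<le> \<epsilon>"
    using inc[of q d x0] j x0 by (simp add: d_def)
  have "x + (real q * \<alpha> - real_of_int p) + real_of_int p = x + real q * \<alpha>" by simp
  then have "orbit_sum \<alpha> h j (x + real q * \<alpha>) = orbit_sum \<alpha> h j (x + (real q * \<alpha> - real_of_int p))"
    using orbit_sum_periodic[of h \<alpha> j "x + (real q * \<alpha> - real_of_int p)" p] per by simp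
  moreover have "1 / (2 * real q) \<le> 2 / real q" using q by (simp add: field_simps)
  ultimately have "\<bar>orbit_sum \<alpha> h q (x + real j * \<alpha>) - orbit_sum \<alpha> h q x\<bar> \<le> \<epsilon>"
    using inc[of j "real q * \<alpha> - real_of_int p" x] a j by (simp add: orbit_sum_cocycle)
  with 1 show ?thesis by linarith
qed

text \<open>
  Cutting \<open>n\<close> steps into blocks of length \<open>q\<close> propagates a bound at one time \<open>q\<close> to all times.
\<close>

lemma orbit_sum_linear_bound:
  assumes "q > 0" "\<And>x. \<bar>orbit_sum \<alpha> h q x - real q * m\<bar> \<le> \<epsilon> * real q" "\<And>x. \<bar>h x - m\<bar> \<le> B" "\<epsilon> \<ge> 0"
  shows "\<bar>orbit_sum \<alpha> h n x - real n * m\<bar> \<le> \<epsilon> * real n + real q * B"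
proof (induction n arbitrary: x rule: less_induct)
  case (less n)
  have B: "B \<ge> 0" using assms(3)[of 0] by linarith
  show ?case
  proof (cases "n < q")
    case True
    have "\<bar>orbit_sum \<alpha> h n x - real n * m\<bar> = \<bar>\<Sum>k<n. h (x + real k * \<alpha>) - m\<bar>"
      by (simp add: orbit_sum_def sum_subtractf)
    also have "\<dots> \<le> (\<Sum>k<n. B)" by (rule order_trans[OF sum_abs]) (intro sum_mono assms(3))
    also have "\<dots> \<le> real q * B" using True B by (simp add: mult_right_mono)
    finally show ?thesis using assms(4) by (smt (verit) mult_nonneg_nonneg of_nat_0_le_iff)
  next
    case False
    then have n: "n = q + (n - q)" "n - q < n" using assms(1) by auto
    have "\<bar>orbit_sum \<alpha> h n x - real n * m\<bar> \<le>
        \<bar>orbit_sum \<alpha> h q x - real q * m\<bar> + \<bar>orbit_sum \<alpha> h (n - q) (x + real q * \<alpha>) - real (n - q) * m\<bar>"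
      using orbit_sum_add[of \<alpha> h q "n - q" x] n False by (simp add: algebra_simps of_nat_diff)
    also have "\<dots> \<le> \<epsilon> * real q + (\<epsilon> * real (n - q) + real q * B)"
      using assms(2) less[OF n(2)] by (intro add_mono) auto
    also have "\<dots> = \<epsilon> * real n + real q * B" using False by (simp add: algebra_simps of_nat_diff)
    finally show ?thesis .
  qed
qed

text \<open>
  Unique ergodicity of the rotation for continuous functions, in the form used below: the deviation
  is sublinear, uniformly in the starting point.
\<close>

lemma orbit_sum_uniform_continuous:
  fixes h :: "real \<Rightarrow> real"
  assumes irr: "\<alpha> \<notin> \<rat>"
    and per: "\<And>x. h (x + 1) = h x" and cont: "continuous_on UNIV h" and int: "(h has_integral m) {0..1}"
    and "\<epsilon> > 0"
  shows "\<exists>C\<ge>0. \<forall>n x. \<bar>orbit_sum \<alpha> h n x - real n * m\<bar> \<le> \<epsilon> * real n + C"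
proof -
  obtain B where B: "B > 0" "\<And>x. \<bar>h x\<bar> \<le> B" using periodic_bounded[of h] per cont by blast
  obtain \<delta> where \<delta>: "\<delta> > 0" "\<And>x y. \<bar>x - y\<bar> \<le> \<delta> \<Longrightarrow> \<bar>h x - h y\<bar> \<le> \<epsilon> / 2"
    using periodic_uniformly_continuous[of h "\<epsilon>/2"] per cont \<open>\<epsilon> > 0\<close> by auto
  obtain p q where cf: "close_fraction \<alpha> p q" and qN: "q \<ge> nat \<lceil>2 / \<delta>\<rceil>" using close_fraction_unbounded[OF irr] by blast
  have q: "q > 0" using cf by (simp add: close_fraction_def)
  have "2 / \<delta> \<le> real q" using qN by linarith
  then have q2: "2 / real q \<le> \<delta>" using q \<delta>(1) by (simp add: field_simps)
  have "\<bar>orbit_sum \<alpha> h j (x + d) - orbit_sum \<alpha> h j x\<bar> \<le> real q * (\<epsilon> / 2)" if "j \<le> q" "\<bar>d\<bar> \<le> 2 / real q" for j d x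
  proof -
    have "\<bar>orbit_sum \<alpha> h j (x + d) - orbit_sum \<alpha> h j x\<bar> = \<bar>\<Sum>k<j. h (x + d + real k * \<alpha>) - h (x + real k * \<alpha>)\<bar>"
      by (simp add: orbit_sum_def sum_subtractf)
    also have "\<dots> \<le> (\<Sum>k<j. \<epsilon> / 2)"
      by (rule order_trans[OF sum_abs]) (intro sum_mono \<delta>(2), use that q2 in auto)
    also have "\<dots> \<le> real q * (\<epsilon> / 2)" using that \<open>\<epsilon> > 0\<close> by simp
    finally show ?thesis .
  qed
  then have "\<bar>orbit_sum \<alpha> h q x - real q * m\<bar> \<le> 2 * (real q * (\<epsilon> / 2))" for x
    using per cont int cf by (intro orbit_sum_near_mean[of h m \<alpha> p q]) auto
  then have 1: "\<bar>orbit_sum \<alpha> h q x - real q * m\<bar> \<le> \<epsilon> * real q" for x by (simp add: mult.commute)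
  have 2: "\<bar>h x - m\<bar> \<le> B + \<bar>m\<bar>" for x using B(2)[of x] by linarith
  have "\<bar>orbit_sum \<alpha> h n x - real n * m\<bar> \<le> \<epsilon> * real n + real q * (B + \<bar>m\<bar>)" for n x
    using orbit_sum_linear_bound[of q \<alpha> h m \<epsilon> "B + \<bar>m\<bar>"] q 1 2 \<open>\<epsilon> > 0\<close> by auto
  then show ?thesis using B(1) by (intro exI[of _ "real q * (B + \<bar>m\<bar>)"]) auto
qed

text \<open>
  The derivative of the orbit sum is the orbit sum of \<open>h'\<close>, which has mean zero and is therefore
  sublinear.  Over distances of order \<open>1/n\<close>, orbit sums of length \<open>n\<close> are thus nearly constant.
\<close>

lemma orbit_sum_C1_increment:
  assumes irr: "\<alpha> \<notin> \<rat>"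
    and per: "\<And>x. h (x + 1) = h x" and der: "\<And>x. (h has_real_derivative h' x) (at x)"
    and cont: "continuous_on UNIV h'" and "\<epsilon> > 0"
  shows "\<exists>C\<ge>0. \<forall>n x d. \<bar>orbit_sum \<alpha> h n (x + d) - orbit_sum \<alpha> h n x\<bar> \<le> \<bar>d\<bar> * (\<epsilon> * real n + C)"
proof -
  have per': "h' (x + 1) = h' x" for x
  proof -
    have "((\<lambda>x. h (x + 1)) has_real_derivative h' (x + 1)) (at x)" using der[of "x+1"] by (simp add: DERIV_shift)
    then show ?thesis using der[of x] per by (auto dest: DERIV_unique)
  qed
  have "(h' has_integral h 1 - h 0) {0..1}"
    using der by (intro fundamental_theorem_of_calculus)
      (auto simp: has_real_derivative_iff_has_vector_derivative[symmetric] intro: has_field_derivative_at_within)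
  then have "(h' has_integral 0) {0..1}" using per[of 0] by simp
  then obtain C where C: "C \<ge> 0" "\<And>n x. \<bar>orbit_sum \<alpha> h' n x\<bar> \<le> \<epsilon> * real n + C"
    using orbit_sum_uniform_continuous[OF irr, of h' 0 \<epsilon>] per' cont \<open>\<epsilon> > 0\<close> by auto
  have Sd: "(orbit_sum \<alpha> h n has_real_derivative orbit_sum \<alpha> h' n x) (at x)" for x n
  proof -
    have "((\<lambda>x. \<Sum>k<n. h (x + real k * \<alpha>)) has_real_derivative (\<Sum>k<n. h' (x + real k * \<alpha>))) (at x)"
      by (intro DERIV_sum DERIV_shift[THEN iffD1] der)
    then show ?thesis by (simp add: orbit_sum_def[abs_def])
  qed
  have "\<bar>orbit_sum \<alpha> h n (x + d) - orbit_sum \<alpha> h n x\<bar> \<le> \<bar>d\<bar> * (\<epsilon> * real n + C)" for n x d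
    using field_differentiable_bound[of UNIV "orbit_sum \<alpha> h n" "orbit_sum \<alpha> h' n" "\<epsilon> * real n + C" "x + d" x] Sd C
    by (simp add: mult.commute)
  then show ?thesis using C(1) by blast
qed

text \<open>
  A Denjoy-Koksma estimate with error tending to zero.  It is the reason why the regular part of a
  roof has no influence on the flow at rigidity times.
\<close>

lemma orbit_sum_C1_close_fraction:
  assumes irr: "\<alpha> \<notin> \<rat>"
    and per: "\<And>x. h (x + 1) = h x" and der: "\<And>x. (h has_real_derivative h' x) (at x)"
    and cont: "continuous_on UNIV h'" and int: "(h has_integral m) {0..1}" and "\<epsilon> > 0"
  shows "\<exists>Q. \<forall>p q x. close_fraction \<alpha> p q \<longrightarrow> q \<ge> Q \<longrightarrow> \<bar>orbit_sum \<alpha> h q x - real q * m\<bar> \<le> \<epsilon>"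
proof -
  obtain C where C: "C \<ge> 0" "\<And>n x d. \<bar>orbit_sum \<alpha> h n (x + d) - orbit_sum \<alpha> h n x\<bar> \<le> \<bar>d\<bar> * (\<epsilon> / 8 * real n + C)"
    using orbit_sum_C1_increment[OF irr, of h h' "\<epsilon>/8"] per der cont \<open>\<epsilon> > 0\<close> by (auto simp del: times_divide_eq_left)
  have "\<bar>orbit_sum \<alpha> h q x - real q * m\<bar> \<le> \<epsilon>" if cf: "close_fraction \<alpha> p q" and "q \<ge> nat \<lceil>8 * C / \<epsilon>\<rceil>" for p q x
  proof -
    have q: "real q > 0" using cf by (simp add: close_fraction_def)
    have "8 * C / \<epsilon> \<le> real q" using that by linarith
    then have C8: "8 * C \<le> \<epsilon> * real q" using \<open>\<epsilon> > 0\<close> by (simp add: field_simps)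
    have "\<bar>orbit_sum \<alpha> h j (y + d) - orbit_sum \<alpha> h j y\<bar> \<le> \<epsilon> / 2" if "j \<le> q" "\<bar>d\<bar> \<le> 2 / real q" for j d y
    proof -
      have "\<bar>d\<bar> * (\<epsilon> / 8 * real j + C) \<le> (2 / real q) * (\<epsilon> / 8 * real q + C)"
        using that \<open>\<epsilon> > 0\<close> C(1) by (intro mult_mono add_mono) auto
      also have "\<dots> \<le> \<epsilon> / 2" using q C8 by (simp add: field_simps)
      finally show ?thesis using C(2)[of j y d] by linarith
    qed
    moreover have "continuous_on UNIV h" using der by (intro continuous_at_imp_continuous_on) (auto intro: DERIV_isCont)
    ultimately have "\<bar>orbit_sum \<alpha> h q x - real q * m\<bar> \<le> 2 * (\<epsilon> / 2)"
      using per int cf by (intro orbit_sum_near_mean[of h m \<alpha> p q]) auto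
    then show ?thesis by simp
  qed
  then show ?thesis by blast
qed

text \<open>
  Rigidity of the sawtooth.  If \<open>\<alpha>\<close> is replaced by \<open>p/q\<close>, the points \<open>x + k \<alpha>\<close> run once through a
  coset of the fractions with denominator \<open>q\<close>, and the sum is the sawtooth \<open>u\<close> plus a constant.  The
  perturbation \<open>k \<theta> / q\<^sup>2\<close> is too small to carry any point over an integer except for the one in the
  residue class adjacent to the integers; that point has some index \<open>j\<close>, and crosses when
  \<open>u + j \<theta> / q\<close> leaves \<open>[0,1)\<close>.
\<close>

lemma orbit_sum_frac_block:
  fixes i :: int
  assumes cf: "close_fraction \<alpha> p q"
  defines "\<theta> \<equiv> real q * (real q * \<alpha> - real_of_int p)"
  shows "\<exists>j<q. \<forall>u\<in>{0..<1}. orbit_sum \<alpha> frac q ((real_of_int i + u) / real q) =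
     frac (u + real j * \<theta> / real q) - real j * \<theta> / real q + (real q - 1) / 2 + (real q - 1) * \<theta> / (2 * real q)"
proof -
  have q: "real q > 0" "q > 0" and a: "\<bar>real q * \<alpha> - real_of_int p\<bar> \<le> 1 / (2 * real q)" and cop: "coprime p (int q)"
    using cf by (auto simp: close_fraction_def)
  have \<theta>: "\<bar>\<theta>\<bar> \<le> 1 / 2" using mult_left_mono[OF a, of "real q"] q by (simp add: \<theta>_def abs_mult)
  \<comment> \<open>the residue class whose point can cross an integer: the last one if the points move to the right,
    the first one if they move to the left\<close>
  define c where "c = (if \<theta> \<ge> 0 then int q - 1 else 0)"
  obtain j l where j: "j < q" "int j * p = (c - i) + int q * l" using close_fraction_residue[OF cf] by blast
  define \<rho> where "\<rho> = (\<lambda>k. (i + int k * p) mod int q)"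
  define D where "D = (\<lambda>k. (i + int k * p) div int q)"
  have \<rho>b: "0 \<le> \<rho> k" "\<rho> k < int q" for k using q by (auto simp: \<rho>_def)
  have split: "i + int k * p = int q * D k + \<rho> k" for k by (simp add: \<rho>_def D_def)
  have cb: "0 \<le> c" "c < int q" using q by (auto simp: c_def)
  have \<rho>j: "\<rho> j = c"
  proof -
    have "i + int j * p = c + int q * l" using j by simp
    then show ?thesis using cb by (simp add: \<rho>_def)
  qed
  have inj: "inj_on \<rho> {..<q}"
  proof (rule inj_onI)
    fix k k' assume k: "k \<in> {..<q}" "k' \<in> {..<q}" "\<rho> k = \<rho> k'"
    then have "int q dvd (i + int k * p) - (i + int k' * p)" by (simp add: \<rho>_def mod_eq_dvd_iff)
    then have "int q dvd p * (int k - int k')" by (simp add: algebra_simps)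
    then have "int q dvd int k - int k'" using cop by (metis coprime_commute coprime_dvd_mult_right_iff)
    then have "(int k) mod int q = (int k') mod int q" by (simp add: mod_eq_dvd_iff)
    then show "k = k'" using k by simp
  qed
  have img: "\<rho> ` {..<q} = {0..<int q}"
    using \<rho>b by (intro card_subset_eq) (auto simp: card_image[OF inj])
  have sum\<rho>: "(\<Sum>k<q. real_of_int (\<rho> k)) = real q * (real q - 1) / 2"
  proof -
    have "(\<Sum>k<q. real_of_int (\<rho> k)) = (\<Sum>r\<in>{0..<int q}. real_of_int r)"
      using sum.reindex[OF inj, of real_of_int] img by simp
    also have "\<dots> = (\<Sum>r<q. real r)"
      by (rule sum.reindex_bij_witness[of _ int nat]) auto
    also have "\<dots> = real q * (real q - 1) / 2" by (induction q) (auto simp: field_simps)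
    finally show ?thesis .
  qed
  have sumk: "(\<Sum>k<q. real k) = real q * (real q - 1) / 2" by (induction q) (auto simp: field_simps)
  have sumD: "(\<Sum>k<q. real_of_int (D k)) = real_of_int i + real_of_int p * (real q - 1) / 2 - (real q - 1) / 2"
  proof -
    have "real q * (\<Sum>k<q. real_of_int (D k)) = (\<Sum>k<q. real_of_int i + real k * real_of_int p - real_of_int (\<rho> k))"
      unfolding sum_distrib_left
    proof (rule sum.cong)
      fix k
      have "real_of_int (i + int k * p) = real_of_int (int q * D k + \<rho> k)" using split[of k] by simp
      then show "real q * real_of_int (D k) = real_of_int i + real k * real_of_int p - real_of_int (\<rho> k)" by simp
    qed simp
    also have "\<dots> = real q * real_of_int i + (\<Sum>k<q. real k) * real_of_int p - real q * (real q - 1) / 2"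
      by (simp add: sum.distrib sum_subtractf sum\<rho> sum_distrib_right)
    also have "\<dots> = real q * (real_of_int i + real_of_int p * (real q - 1) / 2 - (real q - 1) / 2)"
      unfolding sumk by (simp add: field_simps)
    finally show ?thesis using q by simp
  qed
  have main: "orbit_sum \<alpha> frac q ((real_of_int i + u) / real q) =
     frac (u + real j * \<theta> / real q) - real j * \<theta> / real q + (real q - 1) / 2 + (real q - 1) * \<theta> / (2 * real q)"
    if u: "0 \<le> u" "u < 1" for u
  proof -
    have fl: "\<lfloor>(real_of_int i + u) / real q + real k * \<alpha>\<rfloor> = D k + (if k = j then \<lfloor>u + real j * \<theta> / real q\<rfloor> else 0)"
      if k: "k < q" for k
    proof -
      define w where "w = u + real k * \<theta> / real q"
      have "\<bar>real k * \<theta>\<bar> \<le> real q * (1/2)" unfolding abs_mult using k \<theta> by (intro mult_mono) auto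
      then have kb: "\<bar>real k * \<theta> / real q\<bar> \<le> 1 / 2" using q by (simp add: abs_divide field_simps)
      have wb: "- (1/2) \<le> w" "w < 3/2" using kb u unfolding w_def by linarith+
      have wpos: "\<theta> \<ge> 0 \<Longrightarrow> w \<ge> 0" using u by (simp add: w_def)
      have wneg: "\<theta> < 0 \<Longrightarrow> w < 1" using u
        using divide_right_mono[OF mult_left_mono[of \<theta> 0 "real k"], of "real q"] by (simp add: w_def)
      have e: "(real_of_int i + u) / real q + real k * \<alpha> = real_of_int (D k) + (real_of_int (\<rho> k) + w) / real q"
      proof -
        have "real_of_int (i + int k * p) = real_of_int (int q * D k + \<rho> k)" using split[of k] by simp
        then have "real_of_int i + real k * real_of_int p = real q * real_of_int (D k) + real_of_int (\<rho> k)" by simp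
        moreover have "real q * ((real_of_int i + u) / real q + real k * \<alpha>) = real_of_int i + u + real k * (real q * \<alpha>)"
          using q by (simp add: field_simps)
        moreover have "real k * \<theta> / real q = real k * (real q * \<alpha>) - real k * real_of_int p"
          using q by (simp add: \<theta>_def field_simps)
        ultimately have "real q * ((real_of_int i + u) / real q + real k * \<alpha>) = real q * real_of_int (D k) + (real_of_int (\<rho> k) + w)"
          by (simp add: w_def)
        also have "\<dots> = real q * (real_of_int (D k) + (real_of_int (\<rho> k) + w) / real q)" using q by (simp add: distrib_left[of "real q" "real_of_int (D k)"])
        finally show ?thesis using q by (subst (asm) mult_left_cancel) auto
      qed
      have "\<lfloor>(real_of_int (\<rho> k) + w) / real q\<rfloor> = (if k = j then \<lfloor>w\<rfloor> else 0)"
      proof (cases "k = j")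
        case True
        show ?thesis
        proof (cases "\<theta> \<ge> 0")
          case T: True
          then have r: "real_of_int (\<rho> k) = real q - 1" using \<rho>j True by (simp add: c_def)
          have "\<lfloor>(real q - 1 + w) / real q\<rfloor> = \<lfloor>w\<rfloor>"
          proof (cases "w < 1")
            case True
            then have "\<lfloor>w\<rfloor> = 0" using wpos[OF T] by (simp add: floor_eq_iff)
            moreover have "\<lfloor>(real q - 1 + w) / real q\<rfloor> = 0" using True wpos[OF T] q by (simp add: floor_eq_iff)
            ultimately show ?thesis by simp
          next
            case False
            then have "\<lfloor>w\<rfloor> = 1" using wb by (simp add: floor_eq_iff)
            moreover have "real q \<ge> 1" using q by simp
            then have "w < 1 + real q" using wb by linarith
            then have "\<lfloor>(real q - 1 + w) / real q\<rfloor> = 1" using False q by (simp add: floor_eq_iff field_simps)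
            ultimately show ?thesis by simp
          qed
          then show ?thesis using True r by simp
        next
          case T: False
          then have r: "\<rho> k = 0" using \<rho>j True by (simp add: c_def)
          have q1: "real q \<ge> 1" using q by simp
          have "\<lfloor>w / real q\<rfloor> = \<lfloor>w\<rfloor>"
          proof (cases "w < 0")
            case True
            then have "\<lfloor>w\<rfloor> = -1" using wb by (simp add: floor_eq_iff)
            moreover have "\<lfloor>w / real q\<rfloor> = -1" using True wb q q1 by (simp add: floor_eq_iff field_simps)
            ultimately show ?thesis by simp
          next
            case False
            then have "\<lfloor>w\<rfloor> = 0" using wneg T by (simp add: floor_eq_iff)
            moreover have "\<lfloor>w / real q\<rfloor> = 0" using False wneg T q q1 by (simp add: floor_eq_iff field_simps)
            ultimately show ?thesis by simp
          qed
          then show ?thesis using True r by simp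
        qed
      next
        case False
        then have ne: "\<rho> k \<noteq> c" using \<rho>j inj k j by (metis inj_onD lessThan_iff)
        have "0 \<le> real_of_int (\<rho> k) + w \<and> real_of_int (\<rho> k) + w < real q"
        proof (cases "\<theta> \<ge> 0")
          case True
          then have "\<rho> k \<le> int q - 2" using ne \<rho>b[of k] by (simp add: c_def)
          then have "real_of_int (\<rho> k) \<le> real q - 2" by linarith
          then show ?thesis using wpos[OF True] wb \<rho>b[of k] by auto
        next
          case False
          then have "\<rho> k \<ge> 1" using ne \<rho>b[of k] by (simp add: c_def)
          moreover have "\<rho> k \<le> int q - 1" using \<rho>b[of k] by simp
          ultimately have "real_of_int (\<rho> k) \<ge> 1" "real_of_int (\<rho> k) \<le> real q - 1" by linarith+
          then show ?thesis using wneg wb False by auto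
        qed
        then show ?thesis using False q by (simp add: floor_eq_iff)
      qed
      then show ?thesis unfolding e by (auto simp: w_def)
    qed
    have "orbit_sum \<alpha> frac q ((real_of_int i + u) / real q) =
       (\<Sum>k<q. (real_of_int i + u) / real q + real k * \<alpha> - real_of_int (D k) - (if k = j then real_of_int \<lfloor>u + real j * \<theta> / real q\<rfloor> else 0))"
      unfolding orbit_sum_def by (rule sum.cong) (auto simp: frac_def fl)
    also have "\<dots> = real_of_int i + u + (\<Sum>k<q. real k) * \<alpha> - (\<Sum>k<q. real_of_int (D k)) - real_of_int \<lfloor>u + real j * \<theta> / real q\<rfloor>"
      using q j by (simp add: sum.distrib sum_subtractf sum_distrib_right sum.delta)
    also have "\<dots> = frac (u + real j * \<theta> / real q) - real j * \<theta> / real q + (real q - 1) / 2 + (real q - 1) * \<theta> / (2 * real q)"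
      unfolding sumk sumD frac_def using q by (simp add: \<theta>_def field_simps)
    finally show ?thesis .
  qed
  show ?thesis using j main by (intro exI[of _ j]) auto
qed

lemma orbit_sum_frac_bounded:
  assumes cf: "close_fraction \<alpha> p q"
  shows "\<bar>orbit_sum \<alpha> frac q x - real q / 2\<bar> \<le> 3"
proof -
  have q: "real q > 0" and a: "\<bar>real q * \<alpha> - real_of_int p\<bar> \<le> 1 / (2 * real q)"
    using cf by (auto simp: close_fraction_def)
  define \<theta> where "\<theta> = real q * (real q * \<alpha> - real_of_int p)"
  have \<theta>: "\<bar>\<theta>\<bar> \<le> 1 / 2" using mult_left_mono[OF a, of "real q"] q by (simp add: \<theta>_def abs_mult)
  define i where "i = \<lfloor>real q * x\<rfloor>"
  define u where "u = frac (real q * x)"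
  have u: "u \<in> {0..<1}" by (simp add: u_def frac_lt_1)
  have x: "x = (real_of_int i + u) / real q" using q by (simp add: u_def i_def frac_def)
  obtain j where j: "j < q" "orbit_sum \<alpha> frac q x =
     frac (u + real j * \<theta> / real q) - real j * \<theta> / real q + (real q - 1) / 2 + (real q - 1) * \<theta> / (2 * real q)"
    using orbit_sum_frac_block[OF cf, of i] u unfolding x \<theta>_def by blast
  have b: "\<bar>r * \<theta> / real q\<bar> \<le> 1/2" if "0 \<le> r" "r \<le> real q" for r
  proof -
    have "\<bar>r * \<theta>\<bar> \<le> real q * (1/2)" unfolding abs_mult using that \<theta> by (intro mult_mono) auto
    then show ?thesis using q by (simp add: field_simps)
  qed
  have "\<bar>real j * \<theta> / real q\<bar> \<le> 1/2" "\<bar>(real q - 1) * \<theta> / real q\<bar> \<le> 1/2" using b[of j] b[of "real q - 1"] j q by simp_all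
  moreover have "(real q - 1) * \<theta> / (2 * real q) = (1/2) * ((real q - 1) * \<theta> / real q)" by simp
  ultimately show ?thesis
    unfolding j(2) using frac_ge_0[of "u + real j * \<theta> / real q"] frac_lt_1[of "u + real j * \<theta> / real q"]
    unfolding \<open>(real q - 1) * \<theta> / (2 * real q) = (1/2) * ((real q - 1) * \<theta> / real q)\<close> by argo
qed

lemma orbit_sum_uniform_frac:
  assumes irr: "\<alpha> \<notin> \<rat>" and "\<epsilon> > 0"
  shows "\<exists>C\<ge>0. \<forall>n x. \<bar>orbit_sum \<alpha> frac n x - real n / 2\<bar> \<le> \<epsilon> * real n + C"
proof -
  obtain p q where cf: "close_fraction \<alpha> p q" and qN: "q \<ge> nat \<lceil>3 / \<epsilon>\<rceil>" using close_fraction_unbounded[OF irr] by blast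
  have q: "q > 0" using cf by (simp add: close_fraction_def)
  have "3 / \<epsilon> \<le> real q" using qN by linarith
  then have "3 \<le> \<epsilon> * real q" using \<open>\<epsilon> > 0\<close> by (simp add: field_simps)
  then have 1: "\<bar>orbit_sum \<alpha> frac q x - real q * (1/2)\<bar> \<le> \<epsilon> * real q" for x
    using orbit_sum_frac_bounded[OF cf, of x] by simp
  have 2: "\<bar>frac x - 1/2\<bar> \<le> 1" for x :: real using frac_ge_0[of x] frac_lt_1[of x] by linarith
  have "\<bar>orbit_sum \<alpha> frac n x - real n * (1/2)\<bar> \<le> \<epsilon> * real n + real q * 1" for n x
    using orbit_sum_linear_bound[of q \<alpha> frac "1/2" \<epsilon> 1] q 1 2 \<open>\<epsilon> > 0\<close> by auto
  then show ?thesis by (intro exI[of _ "real q"]) auto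
qed

section \<open>Small shears of the plane\<close>

text \<open>
  Horizontal translations of the region under a roof, and the return of the special flow at rigidity
  times, have this form.
\<close>

definition shear :: "real \<Rightarrow> (real \<Rightarrow> real) \<Rightarrow> real \<times> real \<Rightarrow> real \<times> real" where
  "shear d r = (\<lambda>(x, s). (x + d, s - r x))"

lemma shear_measurable:
  assumes "r \<in> borel_measurable borel"
  shows "shear d r \<in> borel_measurable borel"
proof -
  note [measurable] = assms
  have "shear d r \<in> borel \<Otimes>\<^sub>M borel \<rightarrow>\<^sub>M borel \<Otimes>\<^sub>M borel"
    unfolding shear_def by measurable
  then show ?thesis by (simp add: borel_prod)
qed

lemma emeasure_lborel_translate:
  fixes A :: "real set"
  assumes "A \<in> sets borel"
  shows "emeasure lborel {s. s - c \<in> A} = emeasure lborel A"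
proof -
  have "emeasure lborel A = emeasure (distr lborel borel ((+) (- c))) A" by (simp add: lborel_distr_plus)
  also have "\<dots> = emeasure lborel {s. s - c \<in> A}" using assms by (subst emeasure_distr) (auto simp: vimage_def)
  finally show ?thesis by simp
qed

text \<open>
  By Fubini: every vertical section is translated, and then the sections are translated.
\<close>

lemma emeasure_shear_vimage:
  assumes r: "r \<in> borel_measurable borel" and E: "E \<in> sets borel"
  shows "emeasure lborel (shear d r -` E) = emeasure lborel E"
proof -
  have "sets (lborel \<Otimes>\<^sub>M lborel) = sets (borel :: (real \<times> real) measure)"
    by (metis lborel_prod sets_lborel)
  note sets_prod = this
  have E': "E \<in> sets (lborel \<Otimes>\<^sub>M lborel)" using E sets_prod by blast
  have V: "shear d r -` E \<in> sets (lborel \<Otimes>\<^sub>M lborel)"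
    using measurable_sets[OF shear_measurable[OF r] E] unfolding sets_prod by simp
  have sec: "Pair x -` E \<in> sets borel" for x using sets_Pair1[OF E'] by simp
  have "emeasure lborel (shear d r -` E) = emeasure (lborel \<Otimes>\<^sub>M lborel) (shear d r -` E)" by (simp add: lborel_prod)
  also have "\<dots> = (\<integral>\<^sup>+x. emeasure lborel (Pair x -` (shear d r -` E)) \<partial>lborel)"
    by (rule lborel.emeasure_pair_measure_alt[OF V])
  also have "\<dots> = (\<integral>\<^sup>+x. emeasure lborel (Pair (d + 1 * x) -` E) \<partial>lborel)"
  proof (rule nn_integral_cong)
    fix x :: real
    have "Pair x -` (shear d r -` E) = {s. s - r x \<in> Pair (x + d) -` E}" by (auto simp: shear_def)
    then show "emeasure lborel (Pair x -` (shear d r -` E)) = emeasure lborel (Pair (d + 1 * x) -` E)"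
      using emeasure_lborel_translate[OF sec, of "r x" "x + d"] by (simp add: add.commute)
  qed
  also have "\<dots> = (\<integral>\<^sup>+x. emeasure lborel (Pair x -` E) \<partial>lborel)"
    using nn_integral_real_affine[of "\<lambda>x. emeasure lborel (Pair x -` E)" 1 d]
      lborel.measurable_emeasure_Pair[OF E'] by simp
  also have "\<dots> = emeasure (lborel \<Otimes>\<^sub>M lborel) E" by (rule lborel.emeasure_pair_measure_alt[OF E', symmetric])
  finally show ?thesis by (simp add: lborel_prod)
qed

lemma integral_shear:
  fixes g :: "real \<times> real \<Rightarrow> real"
  assumes r: "r \<in> borel_measurable borel" and g: "g \<in> borel_measurable borel"
  shows "(\<integral>z. g (shear d r z) \<partial>lborel) = (\<integral>z. g z \<partial>lborel)"
proof -
  have "distr lborel borel (shear d r) = lborel"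
    by (rule measure_eqI) (use r in \<open>auto simp: emeasure_distr emeasure_shear_vimage shear_measurable\<close>)
  then show ?thesis
    using integral_distr[of "shear d r" lborel borel g] shear_measurable[OF r] g by simp
qed

text \<open>
  A Borel function is the almost everywhere limit of continuous functions; on a set of finite measure
  this gives convergence in measure.
\<close>

lemma borel_nearly_continuous:
  fixes \<phi> :: "'a::euclidean_space \<Rightarrow> real"
  assumes \<phi>: "\<phi> \<in> borel_measurable borel" and B: "B \<in> sets borel" "emeasure lborel B < \<infinity>" and \<eta>: "\<eta> > 0"
  shows "\<exists>k E. continuous_on UNIV k \<and> E \<in> sets borel \<and> emeasure lborel E \<le> ennreal \<eta> \<and> (\<forall>z\<in>B - E. \<bar>\<phi> z - k z\<bar> \<le> \<eta>)"
proof -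
  have "\<phi> \<in> borel_measurable lebesgue" using \<phi> by (simp add: measurable_completion)
  then have "\<phi> measurable_on UNIV" by (rule lebesgue_measurable_imp_measurable_on) simp
  then obtain N g where N: "negligible N" and g: "\<And>n. continuous_on UNIV (g n)"
      and lim: "\<And>x. x \<notin> N \<Longrightarrow> (\<lambda>n. g n x) \<longlonglongrightarrow> \<phi> x"
    unfolding measurable_on_def by auto
  note [measurable] = borel_measurable_continuous_onI[OF g] \<phi> B(1)
  define A where "A = (\<lambda>n. {z\<in>B. \<exists>m\<ge>n. \<bar>\<phi> z - g m z\<bar> > \<eta>})"
  have A[measurable]: "A n \<in> sets borel" for n
  proof -
    have "A n = B \<inter> {z \<in> space borel. \<exists>m\<ge>n. \<bar>\<phi> z - g m z\<bar> > \<eta>}" by (auto simp: A_def)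
    moreover have "{z \<in> space borel. \<exists>m\<ge>n. \<bar>\<phi> z - g m z\<bar> > \<eta>} \<in> sets borel" by measurable
    ultimately show ?thesis using B(1) by simp
  qed
  have dec: "decseq A" by (rule antimonoI) (auto simp: A_def intro: order_trans)
  have "(\<Inter>n. A n) \<subseteq> N"
  proof
    fix z assume z: "z \<in> (\<Inter>n. A n)"
    show "z \<in> N"
    proof (rule ccontr)
      assume "z \<notin> N"
      then obtain n where "\<And>m. m \<ge> n \<Longrightarrow> dist (g m z) (\<phi> z) < \<eta>" using lim[of z] \<eta> by (auto simp: lim_sequentially)
      then have "z \<notin> A n" by (fastforce simp: A_def dist_real_def abs_minus_commute)
      then show False using z by auto
    qed
  qed
  then have "negligible (\<Inter>n. A n)" by (rule negligible_subset[OF N])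
  then have z: "emeasure lborel (\<Inter>n. A n) = 0"
    by (simp add: negligible_iff_null_sets null_sets_def emeasure_completion)
  have fin: "emeasure lborel (A n) \<noteq> \<infinity>" for n
  proof -
    have "emeasure lborel (A n) \<le> emeasure lborel B" by (rule emeasure_mono) (use B in \<open>auto simp: A_def\<close>)
    then show ?thesis using B(2) by (auto simp: top_unique)
  qed
  have "(\<lambda>n. emeasure lborel (A n)) \<longlonglongrightarrow> emeasure lborel (\<Inter>n. A n)"
    by (rule Lim_emeasure_decseq) (use dec fin in auto)
  then have "(\<lambda>n. emeasure lborel (A n)) \<longlonglongrightarrow> 0" using z by simp
  then have "eventually (\<lambda>n. emeasure lborel (A n) < ennreal \<eta>) sequentially"
    using \<eta> by (intro order_tendstoD(2)) auto
  then obtain n where n: "emeasure lborel (A n) < ennreal \<eta>" by (auto simp: eventually_sequentially)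
  have "\<bar>\<phi> z - g n z\<bar> \<le> \<eta>" if "z \<in> B - A n" for z
    using that by (auto simp: A_def not_less)
  then show ?thesis using g[of n] n A by (intro exI[of _ "g n"] exI[of _ "A n"]) (simp add: less_imp_le)
qed

text \<open>
  Continuity of translations in measure, uniformly over all small shears.  A continuous function close
  to \<open>\<phi>\<close> hardly changes under a small shear, and the set where it is not close to \<open>\<phi>\<close> keeps its measure
  when it is pulled back.  No modulus of continuity of \<open>\<phi>\<close> is involved, so the lemma applies to the
  coordinates of a measurable isomorphism.
\<close>

lemma borel_nearly_shear_invariant:
  fixes \<phi> :: "real \<times> real \<Rightarrow> real"
  assumes \<phi>: "\<phi> \<in> borel_measurable borel" and B: "bounded B" and \<eta>: "\<eta> > 0"
  shows "\<exists>\<kappa>>0. \<forall>d r. \<bar>d\<bar> \<le> \<kappa> \<longrightarrow> r \<in> borel_measurable borel \<longrightarrow> (\<forall>x. \<bar>r x\<bar> \<le> \<kappa>) \<longrightarrow>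
     (\<exists>E\<in>sets borel. emeasure lborel E \<le> ennreal \<eta> \<and> (\<forall>z\<in>B - E. \<bar>\<phi> (shear d r z) - \<phi> z\<bar> \<le> \<eta>))"
proof -
  obtain R where R: "R > 0" "\<And>z. z \<in> B \<Longrightarrow> norm z \<le> R" using B by (auto simp: bounded_pos)
  define C where "C = cball (0 :: real \<times> real) (R + 2)"
  have C: "C \<in> sets borel" "emeasure lborel C < \<infinity>" "compact C"
    using emeasure_bounded_finite[of C] by (auto simp: C_def)
  obtain k E where k: "continuous_on UNIV k" and E: "E \<in> sets borel" "emeasure lborel E \<le> ennreal (\<eta>/3)"
      and kE: "\<And>z. z \<in> C - E \<Longrightarrow> \<bar>\<phi> z - k z\<bar> \<le> \<eta>/3"
    using borel_nearly_continuous[OF \<phi> C(1,2), of "\<eta>/3"] \<eta> by (auto simp: less_top[symmetric])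
  have "uniformly_continuous_on C k" using k C(3) by (intro compact_uniformly_continuous) (auto intro: continuous_on_subset)
  then obtain \<delta> where \<delta>: "\<delta> > 0" "\<And>z w. z \<in> C \<Longrightarrow> w \<in> C \<Longrightarrow> dist w z < \<delta> \<Longrightarrow> dist (k w) (k z) < \<eta>/3"
    unfolding uniformly_continuous_on_def using half_gt_zero[OF \<eta>] \<eta> by (auto dest!: spec[of _ "\<eta>/3"])
  define \<kappa> where "\<kappa> = min 1 (\<delta> / 3)"
  have \<kappa>: "\<kappa> > 0" using \<delta> by (simp add: \<kappa>_def)
  have "\<exists>E\<in>sets borel. emeasure lborel E \<le> ennreal \<eta> \<and> (\<forall>z\<in>B - E. \<bar>\<phi> (shear d r z) - \<phi> z\<bar> \<le> \<eta>)"
    if d: "\<bar>d\<bar> \<le> \<kappa>" and r: "r \<in> borel_measurable borel" "\<And>x. \<bar>r x\<bar> \<le> \<kappa>" for d r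
  proof -
    define E' where "E' = E \<union> shear d r -` E"
    have V: "shear d r -` E \<in> sets borel" using measurable_sets[OF shear_measurable[OF r(1)] E(1)] by simp
    have "emeasure lborel E' \<le> emeasure lborel E + emeasure lborel (shear d r -` E)"
      unfolding E'_def using E V by (intro emeasure_subadditive) auto
    also have "\<dots> = emeasure lborel E + emeasure lborel E" using emeasure_shear_vimage[OF r(1) E(1)] by simp
    also have "\<dots> \<le> ennreal (\<eta>/3) + ennreal (\<eta>/3)" using E(2) by (intro add_mono)
    also have "\<dots> \<le> ennreal \<eta>" using \<eta> by (subst ennreal_plus[symmetric]) (auto intro!: ennreal_leI)
    finally have 1: "emeasure lborel E' \<le> ennreal \<eta>" .
    have 2: "\<bar>\<phi> (shear d r z) - \<phi> z\<bar> \<le> \<eta>" if z: "z \<in> B - E'" for z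
    proof -
      have "dist (shear d r z) z \<le> \<bar>d\<bar> + \<bar>r (fst z)\<bar>"
        by (cases z) (auto simp: shear_def dist_prod_def dist_real_def intro!: sqrt_sum_squares_le_sum_abs[THEN order_trans])
      then have ds: "dist (shear d r z) z \<le> 2 * \<kappa>" using d r(2)[of "fst z"] by linarith
      have zn: "norm z \<le> R" using z R by auto
      then have "norm (shear d r z) \<le> R + 2"
        using ds norm_triangle_ineq2[of "shear d r z" z] by (simp add: \<kappa>_def dist_norm)
      then have zC: "z \<in> C" "shear d r z \<in> C" using zn by (auto simp: C_def)
      have "dist (k (shear d r z)) (k z) < \<eta>/3" using ds zC \<delta>(1) by (intro \<delta>(2)) (auto simp: \<kappa>_def)
      moreover have "\<bar>\<phi> z - k z\<bar> \<le> \<eta>/3" "\<bar>\<phi> (shear d r z) - k (shear d r z)\<bar> \<le> \<eta>/3"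
        using z zC kE[of z] kE[of "shear d r z"] by (auto simp: E'_def)
      ultimately show ?thesis unfolding dist_real_def by argo
    qed
    show ?thesis using 1 2 E V by (intro bexI[of _ E']) (auto simp: E'_def)
  qed
  then show ?thesis using \<kappa> by blast
qed

section \<open>The region under a roof\<close>

definition roof_domain :: "(real \<Rightarrow> real) \<Rightarrow> (real \<times> real) set" where
  "roof_domain f = {(x, s). x \<in> circle \<and> 0 \<le> s \<and> s < f x}"

lemma pair_restrict_lborel:
  assumes C: "C \<in> sets borel"
  shows "restrict_space lborel C \<Otimes>\<^sub>M lborel = restrict_space (lborel \<Otimes>\<^sub>M (lborel :: real measure)) ((C :: real set) \<times> UNIV)"
proof (rule pair_measure_eqI)
  show "sigma_finite_measure (restrict_space lborel C)"
    using C by (intro sigma_finite_measure_restrict_space) (auto intro: sigma_finite_lborel)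
  show "sigma_finite_measure (lborel :: real measure)" by (rule sigma_finite_lborel)
  have CU: "C \<times> UNIV \<in> sets (lborel \<Otimes>\<^sub>M (lborel :: real measure))" using C by auto
  show "sets (restrict_space lborel C \<Otimes>\<^sub>M lborel) = sets (restrict_space (lborel \<Otimes>\<^sub>M (lborel :: real measure)) (C \<times> UNIV))"
    (is "sets ?P = sets ?Q")
  proof
    have "(\<lambda>z. z) \<in> measurable ?Q ?P"
    proof -
      have "(\<lambda>z. (fst z, snd z)) \<in> measurable ?Q ?P"
      proof (rule measurable_Pair)
        show "fst \<in> measurable ?Q (restrict_space lborel C)"
          using C by (intro measurable_restrict_space2) (auto simp: space_restrict_space intro!: measurable_restrict_space1)
        show "snd \<in> measurable ?Q lborel" by (intro measurable_restrict_space1) auto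
      qed
      then show ?thesis by simp
    qed
    then show "sets ?P \<subseteq> sets ?Q"
    proof -
      assume id: "(\<lambda>z. z) \<in> measurable ?Q ?P"
      show ?thesis
      proof
        fix A assume A: "A \<in> sets ?P"
        have "A \<subseteq> space ?P" by (rule sets.sets_into_space[OF A])
        then have "A \<subseteq> space ?Q" by (auto simp: space_pair_measure space_restrict_space)
        then show "A \<in> sets ?Q" using measurable_sets[OF id A] by (simp add: Int_absorb2)
      qed
    qed
    have "(\<lambda>z. z) \<in> measurable ?P (lborel \<Otimes>\<^sub>M lborel)"
    proof -
      have "(\<lambda>z. (fst z, snd z)) \<in> measurable ?P (lborel \<Otimes>\<^sub>M lborel)"
      proof (rule measurable_Pair)
        have "(\<lambda>x. x) \<in> measurable (restrict_space lborel C) lborel" by (intro measurable_restrict_space1) auto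
        from measurable_compose[OF measurable_fst this]
        show "fst \<in> measurable ?P lborel" by simp
      qed auto
      then show ?thesis by simp
    qed
    then have "(\<lambda>z. z) \<in> measurable ?P ?Q"
      by (intro measurable_restrict_space2) (auto simp: space_pair_measure space_restrict_space)
    then show "sets ?Q \<subseteq> sets ?P"
    proof -
      assume id: "(\<lambda>z. z) \<in> measurable ?P ?Q"
      show ?thesis
      proof
        fix A assume A: "A \<in> sets ?Q"
        have "A \<subseteq> space ?Q" by (rule sets.sets_into_space[OF A])
        then have "A \<subseteq> space ?P" by (auto simp: space_pair_measure space_restrict_space)
        then show "A \<in> sets ?P" using measurable_sets[OF id A] by (simp add: Int_absorb2)
      qed
    qed
  qed
  fix A B assume A: "A \<in> sets (restrict_space lborel C)" and B: "B \<in> sets (lborel :: real measure)"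
  have A': "A \<in> sets lborel" "A \<subseteq> C" using A C by (auto simp: sets_restrict_space)
  have "emeasure (restrict_space (lborel \<Otimes>\<^sub>M (lborel :: real measure)) (C \<times> UNIV)) (A \<times> B) = emeasure (lborel \<Otimes>\<^sub>M lborel) (A \<times> B)"
    using A' CU by (intro emeasure_restrict_space) auto
  also have "\<dots> = emeasure lborel A * emeasure lborel B" using A' B by (intro lborel.emeasure_pair_measure_Times) auto
  also have "emeasure lborel A = emeasure (restrict_space lborel C) A"
    using A' C by (intro emeasure_restrict_space[symmetric]) auto
  finally show "emeasure (restrict_space lborel C) A * emeasure lborel B =
      emeasure (restrict_space (lborel \<Otimes>\<^sub>M (lborel :: real measure)) (C \<times> UNIV)) (A \<times> B)" by simp
qed

lemma roof_domain_borel: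
  assumes F: "F \<in> borel_measurable borel" and eq: "\<And>x. x \<in> circle \<Longrightarrow> f x = F x"
  shows "roof_domain f \<in> sets borel"
proof -
  note [measurable] = F
  have "roof_domain f = {z \<in> space (borel \<Otimes>\<^sub>M borel). 0 \<le> fst z \<and> fst z < 1 \<and> 0 \<le> snd z \<and> snd z < F (fst z)}"
    by (auto simp: roof_domain_def eq space_pair_measure)
  also have "\<dots> \<in> sets (borel \<Otimes>\<^sub>M borel)" by measurable
  finally show ?thesis by (metis borel_prod)
qed

lemma special_measure_eq:
  assumes "roof_domain f \<in> sets borel"
  shows "special_measure circle_measure f = restrict_space lborel (roof_domain f)"
proof -
  have "space circle_measure = circle" by (simp add: circle_measure_def space_restrict_space)
  then have "special_measure circle_measure f = restrict_space (circle_measure \<Otimes>\<^sub>M lborel) (roof_domain f)"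
    by (simp add: special_measure_def roof_domain_def)
  also have "circle_measure \<Otimes>\<^sub>M (lborel :: real measure) = restrict_space lborel (circle \<times> UNIV)"
    unfolding circle_measure_def by (subst pair_restrict_lborel) (auto simp: lborel_prod)
  also have "restrict_space (restrict_space lborel (circle \<times> UNIV)) (roof_domain f) = restrict_space lborel ((circle \<times> UNIV) \<inter> roof_domain f)"
    using assms by (intro restrict_restrict_space) (auto intro: borel_Times)
  also have "(circle \<times> UNIV) \<inter> roof_domain f = roof_domain f" by (auto simp: roof_domain_def)
  finally show ?thesis .
qed

section \<open>Roofs with one jump\<close>

lemma frac_borel_measurable [measurable]: "(frac :: real \<Rightarrow> real) \<in> borel_measurable borel"
  unfolding frac_def[abs_def] by measurable

lemma frac_add_int: "frac (y + of_int l) = frac (y :: real)"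
  by (simp add: frac_def)

text \<open>
  The regular part \<open>h\<close> is the 1-periodic lift of \<open>f\<^sub>a\<^sub>c\<close>, and \<open>m\<close> is its mean, so that \<open>A / 2 + m\<close> is
  the integral of the roof.  The roof may tend
  to zero at the right end of the circle, so the estimates below rest on the uniform growth of its
  orbit sums and never on a positive lower bound.
\<close>

locale one_jump_roof =
  fixes \<alpha> A m :: real and h h' f :: "real \<Rightarrow> real"
  assumes irrational: "\<alpha> \<notin> \<rat>"
    and h_periodic: "\<And>x. h (x + 1) = h x"
    and h_deriv: "\<And>x. (h has_real_derivative h' x) (at x)"
    and h'_cont: "continuous_on UNIV h'"
    and h_integral: "(h has_integral m) {0..1}"
    and mean_one: "A / 2 + m = 1"
    and jump: "A \<noteq> 0"
    and f_eq: "\<And>x. x \<in> circle \<Longrightarrow> f x = A * frac x + h x"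
    and f_pos: "\<And>x. x \<in> circle \<Longrightarrow> f x > 0"
begin

definition lift :: "real \<Rightarrow> real" where
  "lift x = A * frac x + h x"

abbreviation S :: "nat \<Rightarrow> real \<Rightarrow> real" where
  "S \<equiv> orbit_sum \<alpha> lift"

abbreviation flow :: "real \<Rightarrow> real \<times> real \<Rightarrow> real \<times> real" where
  "flow \<equiv> special_flow circle (rotation \<alpha>) f"

abbreviation dom :: "(real \<times> real) set" where
  "dom \<equiv> roof_domain f"

lemma f_lift: "x \<in> circle \<Longrightarrow> f x = lift x"
  by (simp add: f_eq lift_def)

lemma frac_circle: "frac x \<in> circle"
  by (simp add: frac_lt_1)

lemma lift_frac: "lift (frac x) = lift x"
  using periodic_int[of h "frac x" "\<lfloor>x\<rfloor>"] h_periodic by (simp add: lift_def) (simp add: frac_def)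

lemma lift_pos: "lift x > 0"
  using f_pos[OF frac_circle, of x] f_lift[OF frac_circle, of x] by (simp add: lift_frac)

lemma h_cont: "continuous_on UNIV h"
  using h_deriv by (intro continuous_at_imp_continuous_on) (auto intro: DERIV_isCont)

lemma lift_measurable [measurable]: "lift \<in> borel_measurable borel"
proof -
  have [measurable]: "h \<in> borel_measurable borel" using h_cont by (rule borel_measurable_continuous_onI)

  show ?thesis unfolding lift_def[abs_def] by measurable
qed

lemma S_measurable [measurable]: "S n \<in> borel_measurable borel"
  unfolding orbit_sum_def[abs_def] by measurable

lemma lift_bounded: obtains B where "B > 0" "\<And>x. lift x \<le> B"
proof -
  obtain B where B: "B > 0" "\<And>x. \<bar>h x\<bar> \<le> B" using periodic_bounded[of h] h_periodic h_cont by blast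
  have "lift x \<le> \<bar>A\<bar> + B" for x
  proof -
    have "\<bar>A * frac x\<bar> \<le> \<bar>A\<bar> * 1" unfolding abs_mult by (intro mult_left_mono) (auto simp: frac_lt_1 less_imp_le)
    then show ?thesis using B(2)[of x] unfolding lift_def by linarith
  qed
  then show thesis using that[of "\<bar>A\<bar> + B"] B(1) by auto
qed

lemma dom_borel: "dom \<in> sets borel"
  using lift_measurable f_lift by (rule roof_domain_borel)

lemma dom_iff: "(x, s) \<in> dom \<longleftrightarrow> 0 \<le> x \<and> x < 1 \<and> 0 \<le> s \<and> s < lift x"
  by (auto simp: roof_domain_def f_lift)

lemma dom_bounded: "bounded dom"
proof -
  obtain B where B: "B > 0" "\<And>x. lift x \<le> B" using lift_bounded by blast
  have "dom \<subseteq> {0..1} \<times> {0..B}" using B(2) by (fastforce simp: dom_iff intro: order_trans[OF less_imp_le])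
  moreover have "bounded ({0..1::real} \<times> {0..B})" by (intro bounded_Times) auto
  ultimately show ?thesis using bounded_subset by blast
qed

lemma dom_finite: "emeasure lborel dom < \<infinity>"
  using dom_bounded by (rule emeasure_bounded_finite)

lemma S_split: "S n x = A * orbit_sum \<alpha> frac n x + orbit_sum \<alpha> h n x"
  by (simp add: lift_def[abs_def] orbit_sum_plus orbit_sum_scale)

lemma S_uniform:
  assumes "\<epsilon> > 0"
  shows "\<exists>C\<ge>0. \<forall>n x. \<bar>S n x - real n\<bar> \<le> \<epsilon> * real n + C"
proof -
  obtain C1 where C1: "C1 \<ge> 0" "\<And>n x. \<bar>orbit_sum \<alpha> h n x - real n * m\<bar> \<le> \<epsilon> / 2 * real n + C1"
    using orbit_sum_uniform_continuous[OF irrational, of h m "\<epsilon>/2"] h_periodic h_cont h_integral assms by auto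
  obtain C2 where C2: "C2 \<ge> 0" "\<And>n x. \<bar>orbit_sum \<alpha> frac n x - real n / 2\<bar> \<le> \<epsilon> / (2 * \<bar>A\<bar>) * real n + C2"
    using orbit_sum_uniform_frac[OF irrational, of "\<epsilon> / (2 * \<bar>A\<bar>)"] assms jump by auto
  have "\<bar>S n x - real n\<bar> \<le> \<epsilon> * real n + (\<bar>A\<bar> * C2 + C1)" for n x
  proof -
    have "S n x - real n = A * (orbit_sum \<alpha> frac n x - real n / 2) + (orbit_sum \<alpha> h n x - real n * m) + real n * (A / 2 + m - 1)"
      unfolding S_split by (simp add: algebra_simps)
    then have "S n x - real n = A * (orbit_sum \<alpha> frac n x - real n / 2) + (orbit_sum \<alpha> h n x - real n * m)"
      using mean_one by simp
    moreover have "\<bar>A * (orbit_sum \<alpha> frac n x - real n / 2)\<bar> \<le> \<bar>A\<bar> * (\<epsilon> / (2 * \<bar>A\<bar>) * real n + C2)"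
      unfolding abs_mult by (intro mult_left_mono C2) auto
    moreover have "\<bar>A\<bar> * (\<epsilon> / (2 * \<bar>A\<bar>) * real n + C2) = \<epsilon> / 2 * real n + \<bar>A\<bar> * C2"
      using jump by (simp add: field_simps)
    ultimately show ?thesis using C1(2)[of n x] by linarith
  qed
  then show ?thesis using C1 C2 by (intro exI[of _ "\<bar>A\<bar> * C2 + C1"]) auto
qed

text \<open>
  The displacement of the flow at a rigidity time, up to an error tending to zero: on each interval
  \<open>[i/q, (i+1)/q)\<close> it is a sawtooth of height \<open>A\<close>, cut at a point that depends on the interval.
\<close>

lemma S_block:
  assumes "\<epsilon> > 0"
  shows "\<exists>Q. \<forall>p q. close_fraction \<alpha> p q \<longrightarrow> q \<ge> Q \<longrightarrow>
     (\<exists>K. \<bar>K\<bar> \<le> \<bar>A\<bar> \<and> (\<forall>i::int. \<exists>j<q. \<forall>u\<in>{0..<1}.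
        \<bar>S q ((real_of_int i + u) / real q) - real q
          - (A * (frac (u + real j * (real q * (real q * \<alpha> - real_of_int p)) / real q)
                   - real j * (real q * (real q * \<alpha> - real_of_int p)) / real q) + K)\<bar> \<le> \<epsilon>))"
proof -
  obtain Q where Q: "\<And>p q x. close_fraction \<alpha> p q \<Longrightarrow> q \<ge> Q \<Longrightarrow> \<bar>orbit_sum \<alpha> h q x - real q * m\<bar> \<le> \<epsilon>"
    using orbit_sum_C1_close_fraction[OF irrational, of h h' m \<epsilon>] h_periodic h_deriv h'_cont h_integral assms by blast
  show ?thesis
  proof (intro exI[of _ Q] allI impI)
    fix p q assume cf: "close_fraction \<alpha> p q" and qQ: "q \<ge> Q"
    have q: "real q \<ge> 1" and a: "\<bar>real q * \<alpha> - real_of_int p\<bar> \<le> 1 / (2 * real q)"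
      using cf by (auto simp: close_fraction_def)
    define \<theta> where "\<theta> = real q * (real q * \<alpha> - real_of_int p)"
    have \<theta>: "\<bar>\<theta>\<bar> \<le> 1 / 2" using mult_left_mono[OF a, of "real q"] q by (simp add: \<theta>_def abs_mult)
    define k where "k = (real q - 1) * \<theta> / (2 * real q) - 1/2"
    have "\<bar>(real q - 1) * \<theta>\<bar> \<le> real q * (1/2)" unfolding abs_mult using \<theta> q by (intro mult_mono) auto
    then have "\<bar>(real q - 1) * \<theta> / (2 * real q)\<bar> \<le> 1/4" using q by (simp add: abs_divide field_simps)
    then have "\<bar>k\<bar> \<le> 1" unfolding k_def by linarith
    then have k: "\<bar>A * k\<bar> \<le> \<bar>A\<bar>" unfolding abs_mult by (simp add: mult_left_le)
    have main: "\<exists>j<q. \<forall>u\<in>{0..<1}. \<bar>S q ((real_of_int i + u) / real q) - real q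
          - (A * (frac (u + real j * \<theta> / real q) - real j * \<theta> / real q) + A * k)\<bar> \<le> \<epsilon>" for i :: int
    proof -
      obtain j where j: "j < q" "\<And>u. u \<in> {0..<1} \<Longrightarrow> orbit_sum \<alpha> frac q ((real_of_int i + u) / real q) =
         frac (u + real j * \<theta> / real q) - real j * \<theta> / real q + (real q - 1) / 2 + (real q - 1) * \<theta> / (2 * real q)"
        using orbit_sum_frac_block[OF cf, of i] unfolding \<theta>_def by blast
      have "\<bar>S q ((real_of_int i + u) / real q) - real q
          - (A * (frac (u + real j * \<theta> / real q) - real j * \<theta> / real q) + A * k)\<bar> \<le> \<epsilon>" if u: "u \<in> {0..<1}" for u
      proof -
        define H where "H = orbit_sum \<alpha> h q ((real_of_int i + u) / real q)"
        define w where "w = frac (u + real j * \<theta> / real q) - real j * \<theta> / real q"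
        have "S q ((real_of_int i + u) / real q) = A * (w + (real q - 1) / 2 + (real q - 1) * \<theta> / (2 * real q)) + H"
          unfolding S_split j(2)[OF u] by (simp add: H_def w_def)
        also have "\<dots> = A * w + A * k + real q * (A / 2) + H" by (simp add: k_def field_simps)
        finally have "S q ((real_of_int i + u) / real q) - real q - (A * w + A * k) = (H - real q * m) + real q * (A / 2 + m - 1)"
          by (simp add: algebra_simps)
        then have "S q ((real_of_int i + u) / real q) - real q - (A * w + A * k) = H - real q * m"
          using mean_one by simp
        then show ?thesis using Q[OF cf qQ, of "(real_of_int i + u) / real q"] unfolding H_def w_def by simp
      qed
      then show ?thesis using j(1) by blast
    qed
    show "\<exists>K. \<bar>K\<bar> \<le> \<bar>A\<bar> \<and> (\<forall>i::int. \<exists>j<q. \<forall>u\<in>{0..<1}.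
        \<bar>S q ((real_of_int i + u) / real q) - real q
          - (A * (frac (u + real j * (real q * (real q * \<alpha> - real_of_int p)) / real q)
                   - real j * (real q * (real q * \<alpha> - real_of_int p)) / real q) + K)\<bar> \<le> \<epsilon>)"
      using main k unfolding \<theta>_def by (intro exI[of _ "A * k"]) blast
  qed
qed

lemma S_close_fraction_bounded:
  "\<exists>Q. \<forall>p q x. close_fraction \<alpha> p q \<longrightarrow> q \<ge> Q \<longrightarrow> \<bar>S q x - real q\<bar> \<le> 3 * \<bar>A\<bar> + 1"
proof -
  obtain Q where Q: "\<And>p q x. close_fraction \<alpha> p q \<Longrightarrow> q \<ge> Q \<Longrightarrow> \<bar>orbit_sum \<alpha> h q x - real q * m\<bar> \<le> 1"
    using orbit_sum_C1_close_fraction[OF irrational, of h h' m 1] h_periodic h_deriv h'_cont h_integral zero_less_one by blast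
  have "\<bar>S q x - real q\<bar> \<le> 3 * \<bar>A\<bar> + 1" if cf: "close_fraction \<alpha> p q" "q \<ge> Q" for p q x
  proof -
    have "S q x - real q = A * (orbit_sum \<alpha> frac q x - real q / 2) + (orbit_sum \<alpha> h q x - real q * m) + real q * (A / 2 + m - 1)"
      unfolding S_split by (simp add: algebra_simps)
    then have "S q x - real q = A * (orbit_sum \<alpha> frac q x - real q / 2) + (orbit_sum \<alpha> h q x - real q * m)"
      using mean_one by simp
    moreover have "\<bar>A * (orbit_sum \<alpha> frac q x - real q / 2)\<bar> \<le> \<bar>A\<bar> * 3"
      unfolding abs_mult by (intro mult_left_mono orbit_sum_frac_bounded[OF cf(1)]) auto
    ultimately show ?thesis using Q[OF cf, of x] by linarith
  qed
  then show ?thesis by blast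
qed

text \<open>
  The divergence that drives the argument: neighbouring orbits drift apart linearly, with
  slope \<open>A\<close>, up to integer multiples of the jump \<open>A\<close> and a small error from the regular part.
\<close>

lemma S_increment:
  "S n (x + d) - S n x = A * (real n * d - real_of_int (\<Sum>k<n. \<lfloor>x + d + real k * \<alpha>\<rfloor> - \<lfloor>x + real k * \<alpha>\<rfloor>))
     + (orbit_sum \<alpha> h n (x + d) - orbit_sum \<alpha> h n x)"
proof -
  have "orbit_sum \<alpha> frac n (x + d) - orbit_sum \<alpha> frac n x =
      (\<Sum>k<n. d - real_of_int (\<lfloor>x + d + real k * \<alpha>\<rfloor> - \<lfloor>x + real k * \<alpha>\<rfloor>))"
    unfolding orbit_sum_def sum_subtractf[symmetric] by (rule sum.cong) (auto simp: frac_def)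
  also have "\<dots> = real n * d - real_of_int (\<Sum>k<n. \<lfloor>x + d + real k * \<alpha>\<rfloor> - \<lfloor>x + real k * \<alpha>\<rfloor>)"
    by (simp add: sum_subtractf)
  finally have "A * (orbit_sum \<alpha> frac n (x + d) - orbit_sum \<alpha> frac n x) =
      A * (real n * d - real_of_int (\<Sum>k<n. \<lfloor>x + d + real k * \<alpha>\<rfloor> - \<lfloor>x + real k * \<alpha>\<rfloor>))" by simp
  then show ?thesis unfolding S_split by (simp only: right_diff_distrib)
qed

lemma S_mono: "strict_mono (\<lambda>n. S n x)"
  by (rule strict_monoI_Suc) (simp add: orbit_sum_Suc lift_pos)

lemma S_nonneg: "S n x \<ge> 0"
  unfolding orbit_sum_def by (intro sum_nonneg) (simp add: lift_pos less_imp_le)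

section \<open>The flow in terms of orbit sums\<close>

lemma rotation_iterate:
  assumes "x \<in> circle"
  shows "(rotation \<alpha> ^^ k) x = frac (x + real k * \<alpha>)"
proof (induction k)
  case 0 then show ?case using assms by (simp add: frac_eq)
next
  case (Suc k)
  have "frac (frac (x + real k * \<alpha>) + \<alpha>) = frac (x + real k * \<alpha> + \<alpha>)"
    using frac_add_int[of "x + real k * \<alpha> + \<alpha>" "- \<lfloor>x + real k * \<alpha>\<rfloor>"] by (simp add: frac_def[of "x + real k * \<alpha>"] algebra_simps)
  then show ?case using Suc by (simp add: rotation_def algebra_simps)
qed

lemma inv_rotation_iterate_circle:
  assumes "x \<in> circle"
  shows "(inv_into circle (rotation \<alpha>) ^^ k) x \<in> circle"
proof (induction k)
  case 0 then show ?case using assms by simp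
next
  case (Suc k)
  define y where "y = (inv_into circle (rotation \<alpha>) ^^ k) x"
  have "rotation \<alpha> (frac (y - \<alpha>)) = y"
  proof -
    have "frac (y - \<alpha>) + \<alpha> = y + of_int (- \<lfloor>y - \<alpha>\<rfloor>)" by (simp add: frac_def)
    then have "rotation \<alpha> (frac (y - \<alpha>)) = frac (y + of_int (- \<lfloor>y - \<alpha>\<rfloor>))" by (simp add: rotation_def)
    also have "\<dots> = frac y" by (rule frac_add_int)
    also have "\<dots> = y" using Suc by (simp add: y_def frac_eq)
    finally show ?thesis .
  qed
  then have "y \<in> rotation \<alpha> ` circle" by (metis frac_circle imageI)
  then show ?case using inv_into_into[of y "rotation \<alpha>" circle] by (simp add: y_def)
qed

lemma birkhoff_sum_nonneg:
  assumes "x \<in> circle"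
  shows "birkhoff_sum circle (rotation \<alpha>) f (int n) x = S n x"
proof -
  have "birkhoff_sum circle (rotation \<alpha>) f (int n) x = (\<Sum>k\<in>{0..<int n}. f (int_iterate circle (rotation \<alpha>) k x))"
    by (simp add: birkhoff_sum_def)
  also have "\<dots> = (\<Sum>k<n. f (int_iterate circle (rotation \<alpha>) (int k) x))"
    by (rule sum.reindex_bij_witness[of _ int nat]) auto
  also have "\<dots> = S n x"
    unfolding orbit_sum_def
    by (rule sum.cong) (simp_all add: int_iterate_def rotation_iterate[OF assms] f_lift[OF frac_circle] lift_frac)
  finally show ?thesis .
qed

lemma birkhoff_sum_nonpos:
  assumes "x \<in> circle" "n \<le> 0"
  shows "birkhoff_sum circle (rotation \<alpha>) f n x \<le> 0"
proof (cases "n = 0")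
  case True then show ?thesis by (simp add: birkhoff_sum_def)
next
  case False
  have "f (int_iterate circle (rotation \<alpha>) k x) \<ge> 0" if "k < 0" for k
    using that f_pos[OF inv_rotation_iterate_circle[OF assms(1), of "nat (- k)"]] by (simp add: int_iterate_def)
  then have "(\<Sum>k\<in>{n..<0}. f (int_iterate circle (rotation \<alpha>) k x)) \<ge> 0" by (intro sum_nonneg) auto
  then show ?thesis using False assms(2) by (simp add: birkhoff_sum_def)
qed

text \<open>
  The definite description in the special flow ranges over all integers; the sums with negative
  index are excluded because they are at most zero.
\<close>

lemma flow_eq:
  assumes x: "x \<in> circle" and n: "S n x \<le> s + t" "s + t < S (Suc n) x"
  shows "flow t (x, s) = (frac (x + real n * \<alpha>), s + t - S n x)"
proof -
  let ?P = "\<lambda>n. birkhoff_sum circle (rotation \<alpha>) f n x \<le> s + t \<and> s + t < birkhoff_sum circle (rotation \<alpha>) f (n + 1) x"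
  have B: "birkhoff_sum circle (rotation \<alpha>) f (int k + 1) x = S (Suc k) x" for k
    using birkhoff_sum_nonneg[OF x, of "Suc k"] by (simp add: add.commute)
  have "(THE n. ?P n) = int n"
  proof (rule the_equality)
    show "?P (int n)" using n by (simp add: B birkhoff_sum_nonneg[OF x])
  next
    fix k assume k: "?P k"
    have "k \<ge> 0"
    proof (rule ccontr)
      assume "\<not> k \<ge> 0"
      then have "birkhoff_sum circle (rotation \<alpha>) f (k + 1) x \<le> 0" by (intro birkhoff_sum_nonpos[OF x]) auto
      then show False using k n(1) S_nonneg[of n x] by linarith
    qed
    then obtain l where l: "k = int l" by (metis nonneg_int_cases)
    have "S l x \<le> s + t" "s + t < S (Suc l) x" using k unfolding l B birkhoff_sum_nonneg[OF x] by auto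
    then have "S l x < S (Suc n) x" "S n x < S (Suc l) x" using n by linarith+
    then have "l < Suc n" "n < Suc l" using strict_mono_less[OF S_mono] by blast+
    then show "k = int n" using l by simp
  qed
  then show ?thesis
    by (simp add: special_flow_def Let_def birkhoff_sum_nonneg[OF x] int_iterate_def rotation_iterate[OF x])
qed

lemma S_reaches:
  assumes "r \<ge> 0"
  shows "\<exists>n. S n x \<le> r \<and> r < S (Suc n) x"
proof -
  obtain C where C: "\<And>n x. \<bar>S n x - real n\<bar> \<le> 1/2 * real n + C" using S_uniform[of "1/2"] by auto
  define n where "n = nat \<lceil>2 * (r + C) + 1\<rceil>"
  have "real n > 2 * (r + C)" unfolding n_def by linarith
  moreover have "S n x \<ge> 1/2 * real n - C" using C[of n x] unfolding abs_le_iff by (simp add: algebra_simps)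
  ultimately have ex: "S n x > r" by (simp add: field_simps)
  define k where "k = (LEAST n. S n x > r)"
  have k: "S k x > r" unfolding k_def by (rule LeastI[of "\<lambda>n. S n x > r" n]) (rule ex)
  have "k \<noteq> 0" using k assms by (cases "k = 0") auto
  then obtain l where l: "k = Suc l" by (cases k) auto
  have "\<not> S l x > r" using not_less_Least[of l "\<lambda>n. S n x > r"] l by (simp add: k_def[symmetric])
  then show ?thesis using k l by (intro exI[of _ l]) auto
qed

lemma flow_cases:
  assumes "(x, s) \<in> dom" "s + t \<ge> 0"
  obtains n where "S n x \<le> s + t" "s + t < S (Suc n) x" "flow t (x, s) = (frac (x + real n * \<alpha>), s + t - S n x)"
proof -
  obtain n where "S n x \<le> s + t" "s + t < S (Suc n) x" using S_reaches[OF assms(2)] by blast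
  moreover have "x \<in> circle" using assms(1) by (simp add: dom_iff)
  ultimately show thesis using that flow_eq by blast
qed

lemma flow_in_dom:
  assumes "z \<in> dom" "t \<ge> 0"
  shows "flow t z \<in> dom"
proof -
  obtain x s where xs: "z = (x, s)" by (cases z)
  have "s + t \<ge> 0" using assms by (simp add: xs dom_iff)
  then obtain n where n: "S n x \<le> s + t" "s + t < S (Suc n) x" "flow t (x, s) = (frac (x + real n * \<alpha>), s + t - S n x)"
    using flow_cases assms(1) xs by metis
  then show ?thesis unfolding xs n(3) dom_iff by (simp add: lift_frac orbit_sum_Suc frac_lt_1)
qed

text \<open>
  Up to null sets the flow is one of countably many shears, indexed by the number of base steps and by
  the integer that is subtracted to return to \<open>[0,1)\<close>.
\<close>

lemma flow_nonsingular:
  assumes t: "t \<ge> 0" and E: "E \<in> null_sets (restrict_space lborel dom)"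
  shows "AE z in restrict_space lborel dom. flow t z \<notin> E"
proof -
  have E0: "E \<in> sets borel" "emeasure lborel E = 0"
    using E null_sets_restrict_space[of dom lborel] dom_borel by (auto simp: null_sets_def)
  define V where "V = (\<lambda>(n, l). shear (real n * \<alpha> - real_of_int l) (\<lambda>x. S n x - t) -` E)"
  have V: "V nl \<in> null_sets lborel" for nl :: "nat \<times> int"
  proof (cases nl)
    case (Pair n l)
    have r: "(\<lambda>x. S n x - t) \<in> borel_measurable borel" by measurable
    show ?thesis
      using emeasure_shear_vimage[OF r E0(1)] measurable_sets[OF shear_measurable[OF r] E0(1)] E0(2)
      by (simp add: V_def Pair null_sets_def)
  qed
  have "(\<Union>nl. V nl) \<in> null_sets lborel" using V by (intro null_sets_UN')  auto
  then have "AE z in lborel. z \<notin> (\<Union>nl. V nl)" by (rule AE_not_in)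
  moreover have "flow t z \<notin> E" if z: "z \<in> dom" "z \<notin> (\<Union>nl. V nl)" for z
  proof
    assume fE: "flow t z \<in> E"
    obtain x s where xs: "z = (x, s)" by (cases z)
    have "s + t \<ge> 0" using z(1) t by (simp add: xs dom_iff)
    then obtain n where "flow t (x, s) = (frac (x + real n * \<alpha>), s + t - S n x)"
      using flow_cases z(1) xs by metis
    then have "z \<in> V (n, \<lfloor>x + real n * \<alpha>\<rfloor>)"
      using fE by (simp add: V_def xs shear_def frac_def algebra_simps)
    then show False using z(2) by blast
  qed
  ultimately have "AE z in lborel. z \<in> dom \<longrightarrow> flow t z \<notin> E" by (auto elim: eventually_mono)
  then show ?thesis using dom_borel by (subst AE_restrict_space_iff) auto
qed

end

section \<open>Conjugacies in positive time\<close>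

text \<open>
  The part of an isomorphism that is used to carry the return behaviour of the first flow over to
  the second one.  Restricting to \<open>t \<ge> 0\<close> keeps the sums with negative index out of the argument.
\<close>

definition half_isomorphic ::
    "'a measure \<Rightarrow> (real \<Rightarrow> 'a \<Rightarrow> 'a) \<Rightarrow> 'b measure \<Rightarrow> (real \<Rightarrow> 'b \<Rightarrow> 'b) \<Rightarrow> bool" where
  "half_isomorphic M \<phi> N \<psi> \<longleftrightarrow>
     (\<exists>S S'. S \<in> measurable M N \<and> S' \<in> measurable N M \<and> distr N M S' = M \<and>
             (AE y in N. S (S' y) = y) \<and> (\<forall>t\<ge>0. AE x in M. S (\<phi> t x) = \<psi> t (S x)))"

lemma half_isomorphic_direct:
  "flows_isomorphic M \<phi> N \<psi> \<Longrightarrow> half_isomorphic M \<phi> N \<psi>"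
  unfolding flows_isomorphic_def half_isomorphic_def by blast

text \<open>
  The relation \<open>S \<circ> \<phi> t = \<psi> t \<circ> S\<close> is composed with the almost everywhere inverse on both sides; the
  nonsingularity of \<open>\<phi> t\<close> makes sure that the points \<open>\<phi> t (S' y)\<close> avoid the null set where \<open>S'\<close> fails
  to invert \<open>S\<close>.
\<close>

lemma half_isomorphic_inverse:
  assumes iso: "flows_isomorphic M \<phi> N \<psi>"
    and nonsing: "\<And>t E. t \<ge> 0 \<Longrightarrow> E \<in> null_sets M \<Longrightarrow> AE x in M. \<phi> t x \<notin> E"
    and inv: "\<And>t x. t \<ge> 0 \<Longrightarrow> x \<in> space M \<Longrightarrow> \<phi> t x \<in> space M"
  shows "half_isomorphic N \<psi> M \<phi>"
proof -
  obtain S S' where S: "S \<in> measurable M N" "distr M N S = N" and S': "S' \<in> measurable N M" "distr N M S' = M"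
    and inv1: "AE x in M. S' (S x) = x" and inv2: "AE y in N. S (S' y) = y"
    and eq: "\<And>t. AE x in M. S (\<phi> t x) = \<psi> t (S x)"
    using iso unfolding flows_isomorphic_def by blast
  have pull: "AE y in N. P (S' y)" if "AE x in M. P x" for P
  proof (rule AE_distrD[OF S'(1)])
    show "AE x in distr N M S'. P x" unfolding S'(2) by (rule that)
  qed
  have "AE y in N. S' (\<psi> t y) = \<phi> t (S' y)" if t: "t \<ge> 0" for t
  proof -
    obtain E where E: "{x \<in> space M. \<not> S' (S x) = x} \<subseteq> E" "E \<in> null_sets M"
      using inv1 by (auto elim!: AE_E simp: null_sets_def)
    have "AE x in M. S' (S (\<phi> t x)) = \<phi> t x"
      using nonsing[OF t E(2)] AE_space[of M] inv[OF t] E(1) by (auto elim!: eventually_elim2)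
    from pull[OF this] pull[OF eq[of t]] inv2 show ?thesis
      by eventually_elim auto
  qed
  then show ?thesis unfolding half_isomorphic_def using S S' inv1 by blast
qed

section \<open>Rotations preserve Lebesgue measure\<close>

lemma emeasure_circle_rotate:
  fixes c :: real
  assumes B: "B \<in> sets borel"
  shows "emeasure lborel {x \<in> circle. frac (x + c) \<in> B} = emeasure lborel (B \<inter> circle)"
proof -
  define a where "a = frac c"
  have a: "0 \<le> a" "a < 1" by (auto simp: a_def frac_lt_1)
  have fr: "frac (x + c) = (if x < 1 - a then x - (- a) else x - (1 - a))" if "x \<in> circle" for x
  proof -
    have "frac (x + c) = frac (x + a + of_int \<lfloor>c\<rfloor>)" by (simp add: a_def frac_def)
    also have "\<dots> = frac (x + a)" by (simp add: frac_def)
    also have "\<dots> = (if x < 1 - a then x - (- a) else x - (1 - a))"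
      using that a by (subst frac_unique_iff) (auto simp: Ints_def)
    finally show ?thesis .
  qed
  let ?B1 = "{s. s - (- a) \<in> B \<inter> {a..<1}}" and ?B2 = "{s. s - (1 - a) \<in> B \<inter> {0..<a}}"
  have eq: "{x \<in> circle. frac (x + c) \<in> B} = ?B1 \<union> ?B2" using a by (auto simp: fr split: if_splits)
  have meas: "?B1 \<in> sets borel" "?B2 \<in> sets borel"
  proof -
    have "{s. s - k \<in> E} \<in> sets borel" if [measurable]: "E \<in> sets borel" for E and k :: real
    proof -
      have "{s \<in> space borel. s - k \<in> E} \<in> sets borel" by measurable
      then show ?thesis by simp
    qed
    then show "?B1 \<in> sets borel" "?B2 \<in> sets borel" using B by auto
  qed
  have "emeasure lborel {x \<in> circle. frac (x + c) \<in> B} = emeasure lborel ?B1 + emeasure lborel ?B2"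
    unfolding eq using meas by (intro plus_emeasure[symmetric]) auto
  also have "\<dots> = emeasure lborel (B \<inter> {a..<1}) + emeasure lborel (B \<inter> {0..<a})"
  proof -
    have "B \<inter> {a..<1} \<in> sets borel" "B \<inter> {0..<a} \<in> sets borel" using B by auto
    then show ?thesis by (simp only: emeasure_lborel_translate)
  qed
  also have "\<dots> = emeasure lborel ((B \<inter> {a..<1}) \<union> (B \<inter> {0..<a}))"
    using B by (intro plus_emeasure) auto
  also have "(B \<inter> {a..<1}) \<union> (B \<inter> {0..<a}) = B \<inter> circle" using a by auto
  finally show ?thesis .
qed

lemma integral_circle_rotate:
  fixes \<phi> :: "real \<Rightarrow> real"
  assumes [measurable]: "\<phi> \<in> borel_measurable borel"
  shows "(\<integral>x. indicator circle x * \<phi> (frac (x + c)) \<partial>lborel) = (\<integral>x. indicator circle x * \<phi> x \<partial>lborel)"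
proof -
  let ?M = "restrict_space lborel circle"
  have [measurable]: "(\<lambda>x. frac (x + c)) \<in> borel_measurable ?M" "(\<lambda>x. x) \<in> borel_measurable ?M"
    by (auto intro!: measurable_restrict_space1)
  have "distr ?M borel (\<lambda>x. frac (x + c)) = distr ?M borel (\<lambda>x. x)"
  proof (rule measure_eqI)
    fix B :: "real set" assume "B \<in> sets (distr ?M borel (\<lambda>x. frac (x + c)))"
    then have B: "B \<in> sets borel" by simp
    have 1: "(\<lambda>x. frac (x + c)) -` B \<inter> space ?M = {x \<in> circle. frac (x + c) \<in> B}"
      by (auto simp: space_restrict_space)
    have 2: "(\<lambda>x. x) -` B \<inter> space ?M = B \<inter> circle" by (auto simp: space_restrict_space)
    show "emeasure (distr ?M borel (\<lambda>x. frac (x + c))) B = emeasure (distr ?M borel (\<lambda>x. x)) B"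
    proof -
      have "emeasure (distr ?M borel (\<lambda>x. frac (x + c))) B = emeasure ?M {x \<in> circle. frac (x + c) \<in> B}"
        using B by (subst emeasure_distr) (simp_all only: 1, measurable)
      also have "\<dots> = emeasure lborel {x \<in> circle. frac (x + c) \<in> B}"
        by (intro emeasure_restrict_space) auto
      also have "\<dots> = emeasure lborel (B \<inter> circle)" by (rule emeasure_circle_rotate[OF B])
      also have "\<dots> = emeasure ?M (B \<inter> circle)" by (intro emeasure_restrict_space[symmetric]) auto
      also have "\<dots> = emeasure (distr ?M borel (\<lambda>x. x)) B"
        using B by (subst emeasure_distr) (simp_all only: 2, measurable)
      finally show ?thesis .
    qed
  qed simp
  then have "(\<integral>x. \<phi> (frac (x + c)) \<partial>?M) = (\<integral>x. \<phi> x \<partial>?M)"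
    using integral_distr[of "\<lambda>x. frac (x + c)" ?M borel \<phi>] integral_distr[of "\<lambda>x. x" ?M borel \<phi>] by simp
  then show ?thesis by (simp add: integral_restrict_space)
qed

text \<open>
  The number of times that an orbit segment of the interval \<open>[x, x + d]\<close> meets the discontinuity.
\<close>

definition crossings :: "real \<Rightarrow> real \<Rightarrow> nat \<Rightarrow> real \<Rightarrow> int" where
  "crossings \<alpha> d n x = (\<Sum>k<n. \<lfloor>x + d + real k * \<alpha>\<rfloor> - \<lfloor>x + real k * \<alpha>\<rfloor>)"

lemma crossings_measurable [measurable]: "(\<lambda>x. real_of_int (crossings \<alpha> d n x)) \<in> borel_measurable borel"
  unfolding crossings_def of_int_sum of_int_diff by measurable

lemma crossings_nonneg: "d \<ge> 0 \<Longrightarrow> crossings \<alpha> d n x \<ge> 0"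
  unfolding crossings_def by (intro sum_nonneg) (simp add: floor_mono)

lemma crossings_mono: "d \<ge> 0 \<Longrightarrow> n \<le> n' \<Longrightarrow> crossings \<alpha> d n x \<le> crossings \<alpha> d n' x"
  unfolding crossings_def by (intro sum_mono2) (auto simp: floor_mono)

lemma floor_increment_frac:
  fixes d y :: real
  assumes "0 \<le> d" "d < 1"
  shows "\<lfloor>y + d\<rfloor> - \<lfloor>y\<rfloor> = (if frac y \<in> {1 - d..<1} then 1 else 0)"
proof (cases "frac y \<ge> 1 - d")
  case True
  then have "\<lfloor>y + d\<rfloor> = \<lfloor>y\<rfloor> + 1" using assms frac_lt_1[of y] by (simp add: floor_eq_iff frac_def)
  then show ?thesis using True frac_lt_1[of y] by simp
next
  case False
  then have "\<lfloor>y + d\<rfloor> = \<lfloor>y\<rfloor>" using assms of_int_floor_le[of y] unfolding floor_eq_iff frac_def by linarith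
  then show ?thesis using False by simp
qed

text \<open>
  The expected number of crossings is \<open>n d\<close>, so Markov's inequality applies.  Bounding \<open>n d\<close> alone gives
  no bound that holds at every point: if \<open>\<alpha>\<close> has very good rational approximations, the orbits of some
  points meet a short interval in rapid succession.
\<close>

lemma emeasure_many_crossings:
  assumes d: "0 \<le> d" "d < 1" and K: "K > 0"
  shows "emeasure lborel {x \<in> circle. real_of_int (crossings \<alpha> d n x) \<ge> K} \<le> ennreal (real n * d / K)"
proof -
  let ?I = "\<lambda>k. {x \<in> circle. frac (x + real k * \<alpha>) \<in> {1 - d..<1}}"
  let ?u = "\<lambda>x. \<Sum>k<n. indicator (?I k) x :: ennreal"
  have I: "?I k \<in> sets borel" for k
  proof -
    have "?I k = circle \<inter> {x \<in> space borel. frac (x + real k * \<alpha>) \<in> {1 - d..<1}}" by auto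
    also have "\<dots> \<in> sets borel" by measurable
    finally show ?thesis .
  qed
  have em: "emeasure lborel (?I k) = ennreal d" for k
  proof -
    have "{1 - d..<1} \<inter> circle = {1 - d..<1}" using d by auto
    then show ?thesis using emeasure_circle_rotate[of "{1 - d..<1}" "real k * \<alpha>"] d by simp
  qed
  have u: "ennreal (real_of_int (crossings \<alpha> d n x)) = ?u x" if x: "x \<in> circle" for x
  proof -
    have "real_of_int (crossings \<alpha> d n x) = (\<Sum>k<n. indicator (?I k) x)"
      unfolding crossings_def of_int_sum
    proof (rule sum.cong)
      fix k
      have "\<lfloor>x + d + real k * \<alpha>\<rfloor> - \<lfloor>x + real k * \<alpha>\<rfloor> = (if frac (x + real k * \<alpha>) \<in> {1 - d..<1} then 1 else 0)"
        using floor_increment_frac[OF d, of "x + real k * \<alpha>"] by (simp add: algebra_simps)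
      then show "real_of_int (\<lfloor>x + d + real k * \<alpha>\<rfloor> - \<lfloor>x + real k * \<alpha>\<rfloor>) = indicator (?I k) x"
        using x by (simp add: indicator_def)
    qed simp
    then show ?thesis by (simp add: sum_nonneg ennreal_indicator flip: sum_ennreal)
  qed
  have sub: "{x \<in> circle. real_of_int (crossings \<alpha> d n x) \<ge> K} \<subseteq> {x \<in> circle. 1 \<le> ennreal (1 / K) * ?u x}"
  proof
    fix x assume x: "x \<in> {x \<in> circle. real_of_int (crossings \<alpha> d n x) \<ge> K}"
    then have "1 \<le> (1 / K) * real_of_int (crossings \<alpha> d n x)" using K by (simp add: field_simps)
    then have "ennreal 1 \<le> ennreal ((1 / K) * real_of_int (crossings \<alpha> d n x))" by (rule ennreal_leI)
    also have "\<dots> = ennreal (1 / K) * ?u x" using x K u[of x] by (subst ennreal_mult') auto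
    finally show "x \<in> {x \<in> circle. 1 \<le> ennreal (1 / K) * ?u x}" using x by simp
  qed
  have um: "?u \<in> borel_measurable lborel" using I by (intro borel_measurable_sum borel_measurable_indicator) auto
  have "emeasure lborel {x \<in> circle. real_of_int (crossings \<alpha> d n x) \<ge> K}
      \<le> emeasure lborel {x \<in> circle. 1 \<le> ennreal (1 / K) * ?u x}"
  proof (rule emeasure_mono[OF sub])
    note [measurable] = um
    have "{x \<in> space lborel. x \<in> circle \<and> 1 \<le> ennreal (1 / K) * ?u x} \<in> sets lborel" by measurable
    then show "{x \<in> circle. 1 \<le> ennreal (1 / K) * ?u x} \<in> sets lborel" by simp
  qed
  also have "\<dots> \<le> ennreal (1 / K) * (\<integral>\<^sup>+x. ?u x * indicator circle x \<partial>lborel)"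
    using um by (intro nn_integral_Markov_inequality) auto
  also have "(\<integral>\<^sup>+x. ?u x * indicator circle x \<partial>lborel) \<le> (\<integral>\<^sup>+x. ?u x \<partial>lborel)"
    by (intro nn_integral_mono) (simp add: indicator_def)
  also have "\<dots> = (\<Sum>k<n. emeasure lborel (?I k))"
    using I by (subst nn_integral_sum) auto
  also have "\<dots> = ennreal (real n * d)" using d unfolding em by (simp add: ennreal_mult ennreal_of_nat_eq_real_of_nat)
  finally have "emeasure lborel {x \<in> circle. real_of_int (crossings \<alpha> d n x) \<ge> K} \<le> ennreal (1 / K) * ennreal (real n * d)"
    by (simp add: mult_left_mono)
  also have "\<dots> = ennreal (real n * d / K)" using K d by (subst ennreal_mult[symmetric]) auto
  finally show ?thesis .
qed

section \<open>Displacement along the flow of a nearly returning orbit\<close>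

lemma abs_cos_diff_le: "\<bar>cos a - cos b\<bar> \<le> \<bar>a - (b :: real)\<bar>"
  using field_differentiable_bound[of UNIV cos "\<lambda>x. - sin x" 1 a b]
  by (auto intro!: derivative_eq_intros)

context one_jump_roof
begin

text \<open>
  Let both \<open>(x, s)\<close> and \<open>(x + d, s)\<close>, with \<open>d = 1/(2t)\<close>, nearly return at times \<open>t + \<sigma>1\<close> and
  \<open>t + \<sigma>2\<close>, after \<open>N\<close> and \<open>N'\<close> base steps.  The orbit sums over these steps are known up to a bounded
  error, so \<open>N - N'\<close> is bounded; and \<open>(N - N') \<alpha>\<close> is close to an integer, so \<open>N = N'\<close>.  Then
  \<open>\<sigma>2 - \<sigma>1\<close> is the increment of the orbit sum over the distance \<open>d\<close>, where \<open>N d\<close> is close to \<open>1/2\<close>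
  since \<open>N\<close> is close to \<open>t\<close>.
\<close>

lemma return_times_differ_by_half_jump:
  assumes C: "C \<ge> 0" and K: "K \<ge> 0" and \<epsilon>: "\<epsilon> > 0"
  shows "\<exists>\<eta>>0. \<exists>t0\<ge>1. \<forall>t\<ge>t0. \<forall>x s \<sigma>1 \<sigma>2. let d = 1 / (2 * t) in
      (x, s) \<in> dom \<longrightarrow> (x + d, s) \<in> dom \<longrightarrow> \<bar>\<sigma>1\<bar> \<le> C \<longrightarrow> \<bar>\<sigma>2\<bar> \<le> C \<longrightarrow>
      \<bar>fst (flow (t + \<sigma>1) (x, s)) - x\<bar> \<le> \<eta> \<longrightarrow> \<bar>snd (flow (t + \<sigma>1) (x, s)) - s\<bar> \<le> \<eta> \<longrightarrow>
      \<bar>fst (flow (t + \<sigma>2) (x + d, s)) - (x + d)\<bar> \<le> \<eta> \<longrightarrow> \<bar>snd (flow (t + \<sigma>2) (x + d, s)) - s\<bar> \<le> \<eta> \<longrightarrow>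
      real_of_int (crossings \<alpha> d (nat \<lfloor>4 * t\<rfloor>) x) \<le> K \<longrightarrow>
      (\<exists>k::int. \<bar>\<sigma>2 - \<sigma>1 - A * (1 / 2 - real_of_int k)\<bar> \<le> \<epsilon>)"
proof -
  obtain C0 where C0: "C0 \<ge> 0" "\<And>n x. \<bar>S n x - real n\<bar> \<le> 1/2 * real n + C0" using S_uniform[of "1/2"] by auto
  define \<epsilon>1 where "\<epsilon>1 = \<epsilon> / (16 * \<bar>A\<bar>)"
  have \<epsilon>1: "\<epsilon>1 > 0" using \<epsilon> jump by (simp add: \<epsilon>1_def)
  obtain C2 where C2: "C2 \<ge> 0" "\<And>n x. \<bar>S n x - real n\<bar> \<le> \<epsilon>1 * real n + C2" using S_uniform[OF \<epsilon>1] by auto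
  obtain C3 where C3: "C3 \<ge> 0" "\<And>n x d. \<bar>orbit_sum \<alpha> h n (x + d) - orbit_sum \<alpha> h n x\<bar> \<le> \<bar>d\<bar> * (\<epsilon> / 16 * real n + C3)"
    using orbit_sum_C1_increment[OF irrational, of h h' "\<epsilon>/16"] h_periodic h_deriv h'_cont \<epsilon> by (metis zero_less_divide_iff zero_less_numeral)
  define D0 where "D0 = \<bar>A\<bar> * (2 + K) + \<epsilon>"
  define J where "J = nat \<lceil>2 * (2 * C + 2 + D0 + C0)\<rceil>"
  obtain e where e: "e > 0" "\<And>(k::int) (l::int). k \<noteq> 0 \<Longrightarrow> \<bar>k\<bar> \<le> int J \<Longrightarrow> \<bar>real_of_int k * \<alpha> - real_of_int l\<bar> \<ge> e"
    using multiples_away_from_integers[OF irrational, of J] by blast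
  define \<eta> where "\<eta> = min (min (\<epsilon> / 8) (e / 3)) 1"
  have \<eta>: "\<eta> > 0" "\<eta> \<le> \<epsilon> / 8" "\<eta> \<le> e / 3" "\<eta> \<le> 1" using \<epsilon> e by (auto simp: \<eta>_def)
  define t0 where "t0 = 1 + C + C0 + 8 * C3 / \<epsilon> + 8 * \<bar>A\<bar> * (C2 + C + 1) / \<epsilon>"
  have pos: "8 * C3 / \<epsilon> \<ge> 0" "8 * \<bar>A\<bar> * (C2 + C + 1) / \<epsilon> \<ge> 0" using C C3 C2 \<epsilon> by auto
  have t0: "t0 \<ge> 1" "t0 \<ge> 1 + C + C0" "t0 \<ge> 8 * C3 / \<epsilon>" "t0 \<ge> 8 * \<bar>A\<bar> * (C2 + C + 1) / \<epsilon>"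
    using pos C C0(1) unfolding t0_def by linarith+
  have "\<exists>k::int. \<bar>\<sigma>2 - \<sigma>1 - A * (1 / 2 - real_of_int k)\<bar> \<le> \<epsilon>"
    if t: "t \<ge> t0" and d: "d = 1 / (2 * t)" and z: "(x, s) \<in> dom" "(x + d, s) \<in> dom"
      and \<sigma>: "\<bar>\<sigma>1\<bar> \<le> C" "\<bar>\<sigma>2\<bar> \<le> C"
      and c1: "\<bar>fst (flow (t + \<sigma>1) (x, s)) - x\<bar> \<le> \<eta>" "\<bar>snd (flow (t + \<sigma>1) (x, s)) - s\<bar> \<le> \<eta>"
      and c2: "\<bar>fst (flow (t + \<sigma>2) (x + d, s)) - (x + d)\<bar> \<le> \<eta>" "\<bar>snd (flow (t + \<sigma>2) (x + d, s)) - s\<bar> \<le> \<eta>"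
      and cr: "real_of_int (crossings \<alpha> d (nat \<lfloor>4 * t\<rfloor>) x) \<le> K" for t d x s \<sigma>1 \<sigma>2
  proof -
    have t1: "t \<ge> 1" "t \<ge> 1 + C + C0" using t t0 by linarith+
    have dpos: "d > 0" using t1 by (simp add: d)
    have s0: "s \<ge> 0" using z by (simp add: dom_iff)
    have "s + (t + \<sigma>1) \<ge> 0" "s + (t + \<sigma>2) \<ge> 0" using s0 t1 \<sigma> C0(1) by linarith+
    then obtain N N' where N: "flow (t + \<sigma>1) (x, s) = (frac (x + real N * \<alpha>), s + (t + \<sigma>1) - S N x)"
      and N': "flow (t + \<sigma>2) (x + d, s) = (frac (x + d + real N' * \<alpha>), s + (t + \<sigma>2) - S N' (x + d))"
      using flow_cases z by metis
    have SN: "\<bar>S N x - (t + \<sigma>1)\<bar> \<le> \<eta>" using c1(2) unfolding N by simp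
    have SN': "\<bar>S N' (x + d) - (t + \<sigma>2)\<bar> \<le> \<eta>" using c2(2) unfolding N' by simp
    have size: "real n \<le> 4 * t" if "\<bar>S n y - (t + \<sigma>)\<bar> \<le> \<eta>" "\<bar>\<sigma>\<bar> \<le> C" for n y \<sigma>
      using C0(2)[of n y] that t1 \<eta>(4) by (simp add: abs_le_iff)
    have Nt: "real N \<le> 4 * t" "real N' \<le> 4 * t" using size SN SN' \<sigma> by blast+
    have hb: "\<bar>orbit_sum \<alpha> h n (x + d) - orbit_sum \<alpha> h n x\<bar> \<le> \<epsilon> / 4" if "real n \<le> 4 * t" for n
    proof -
      have "t \<ge> 8 * C3 / \<epsilon>" using t t0 by linarith
      then have "8 * C3 \<le> \<epsilon> * t" using \<epsilon> by (simp add: field_simps)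
      moreover have "\<epsilon> / 16 * real n \<le> \<epsilon> / 16 * (4 * t)" using that \<epsilon> by (intro mult_left_mono) auto
      moreover have "\<epsilon> * t \<ge> 0" using \<epsilon> t1 by simp
      ultimately have "\<epsilon> / 16 * real n + C3 \<le> \<epsilon> / 2 * t" by simp
      then have "d * (\<epsilon> / 16 * real n + C3) \<le> d * (\<epsilon> / 2 * t)" using dpos by (intro mult_left_mono) auto
      also have "\<dots> = \<epsilon> / 4" using t1 by (simp add: d)
      finally show ?thesis using C3(2)[of n x d] dpos by simp
    qed
    have inc: "S n (x + d) - S n x = A * (real n * d - real_of_int (crossings \<alpha> d n x))
       + (orbit_sum \<alpha> h n (x + d) - orbit_sum \<alpha> h n x)" for n
      unfolding crossings_def by (rule S_increment)
    have D: "\<bar>S N' (x + d) - S N' x\<bar> \<le> D0"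
    proof -
      have "real N' * d \<le> 4 * t * d" using Nt dpos by (intro mult_right_mono) auto
      then have 1: "real N' * d \<le> 2" using t1 by (simp add: d)
      have "N' \<le> nat \<lfloor>4 * t\<rfloor>" using Nt(2) by (simp add: le_nat_floor)
      then have "real_of_int (crossings \<alpha> d N' x) \<le> K"
        using crossings_mono[of d N' "nat \<lfloor>4 * t\<rfloor>" \<alpha> x] dpos cr by linarith
      moreover have "real_of_int (crossings \<alpha> d N' x) \<ge> 0" using crossings_nonneg[of d \<alpha> N' x] dpos by simp
      moreover have "real N' * d \<ge> 0" using dpos by simp
      ultimately have "\<bar>real N' * d - real_of_int (crossings \<alpha> d N' x)\<bar> \<le> 2 + K" using 1 by linarith
      then have "\<bar>A * (real N' * d - real_of_int (crossings \<alpha> d N' x))\<bar> \<le> \<bar>A\<bar> * (2 + K)"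
        unfolding abs_mult by (intro mult_left_mono) auto
      then show ?thesis using hb[OF Nt(2)] \<epsilon> unfolding inc D0_def by linarith
    qed
    have diff: "\<bar>S N x - S N' x\<bar> \<le> 2 * C + 2 + D0" using SN SN' D \<sigma> \<eta>(4) by linarith
    have gap: "real (n - n') \<le> 2 * (2 * C + 2 + D0 + C0)" if "n' \<le> n" "\<bar>S n x - S n' x\<bar> \<le> 2 * C + 2 + D0" for n n'
    proof -
      have "S n x - S n' x = S (n - n') (x + real n' * \<alpha>)"
        using orbit_sum_add[of \<alpha> lift n' "n - n'" x] that(1) by simp
      then show ?thesis using C0(2)[of "n - n'" "x + real n' * \<alpha>"] that(2) by (simp add: abs_le_iff)
    qed
    have J: "\<bar>int N - int N'\<bar> \<le> int J"
    proof (cases "N' \<le> N")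
      case True
      then show ?thesis using gap[OF True] diff unfolding J_def by linarith
    next
      case False
      then have "real (N' - N) \<le> 2 * (2 * C + 2 + D0 + C0)" using gap[of N N'] diff by (simp add: abs_minus_commute)
      then show ?thesis using False unfolding J_def by linarith
    qed
    have NN: "N = N'"
    proof (rule ccontr)
      assume "N \<noteq> N'"
      define l where "l = \<lfloor>x + real N * \<alpha>\<rfloor>"
      define l' where "l' = \<lfloor>x + d + real N' * \<alpha>\<rfloor>"
      have "\<bar>real N * \<alpha> - real_of_int l\<bar> \<le> \<eta>" using c1(1) unfolding N l_def frac_def by simp
      moreover have "\<bar>real N' * \<alpha> - real_of_int l'\<bar> \<le> \<eta>" using c2(1) unfolding N' l'_def frac_def by simp
      ultimately have "\<bar>real_of_int (int N - int N') * \<alpha> - real_of_int (l - l')\<bar> \<le> 2 * \<eta>"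
        by (simp add: algebra_simps)
      moreover have "e \<le> \<bar>real_of_int (int N - int N') * \<alpha> - real_of_int (l - l')\<bar>"
        using \<open>N \<noteq> N'\<close> J by (intro e(2)) auto
      ultimately show False using \<eta>(3) e(1) by linarith
    qed
    have half: "\<bar>A * (real N * d - 1 / 2)\<bar> \<le> \<epsilon> / 4"
    proof -
      have "\<epsilon>1 * real N \<le> \<epsilon>1 * (4 * t)" using Nt \<epsilon>1 by (intro mult_left_mono) auto
      then have "\<bar>real N - t\<bar> \<le> \<epsilon>1 * (4 * t) + C2 + C + 1" using C2(2)[of N x] SN \<sigma> \<eta>(4) by linarith
      then have "\<bar>A\<bar> * \<bar>real N - t\<bar> \<le> \<bar>A\<bar> * (\<epsilon>1 * (4 * t) + C2 + C + 1)" by (intro mult_left_mono) auto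
      also have "\<dots> = \<epsilon> / 4 * t + \<bar>A\<bar> * (C2 + C + 1)" using jump by (simp add: \<epsilon>1_def field_simps)
      also have "\<bar>A\<bar> * (C2 + C + 1) \<le> \<epsilon> / 8 * t"
      proof -
        have "t \<ge> 8 * \<bar>A\<bar> * (C2 + C + 1) / \<epsilon>" using t t0 by linarith
        then have "8 * \<bar>A\<bar> * (C2 + C + 1) \<le> t * \<epsilon>" using \<epsilon> by (simp add: pos_divide_le_eq)
        then show ?thesis by (simp add: algebra_simps)
      qed
      finally have "\<bar>A\<bar> * \<bar>real N - t\<bar> \<le> \<epsilon> / 4 * t + \<epsilon> / 8 * t" by simp
      moreover have "0 \<le> \<epsilon> * t" using \<epsilon> t1 by simp
      ultimately have "\<bar>A\<bar> * \<bar>real N - t\<bar> \<le> \<epsilon> / 2 * t" by simp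
      moreover have "real N * d - 1 / 2 = (real N - t) / (2 * t)" using t1 by (simp add: d field_simps)
      ultimately have "\<bar>A * (real N * d - 1 / 2)\<bar> = \<bar>A\<bar> * \<bar>real N - t\<bar> / (2 * t)" using t1 by (simp add: abs_mult)
      also have "\<dots> \<le> (\<epsilon> / 2 * t) / (2 * t)"
        using \<open>\<bar>A\<bar> * \<bar>real N - t\<bar> \<le> \<epsilon> / 2 * t\<close> t1 by (intro divide_right_mono) auto
      also have "\<dots> = \<epsilon> / 4" using t1 by simp
      finally show ?thesis .
    qed
    let ?k = "crossings \<alpha> d N x"
    have "\<sigma>2 - \<sigma>1 - A * (1 / 2 - real_of_int ?k) =
       (S N x - (t + \<sigma>1)) - (S N' (x + d) - (t + \<sigma>2)) + A * (real N * d - 1 / 2) + (orbit_sum \<alpha> h N (x + d) - orbit_sum \<alpha> h N x)"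
      using inc[of N] NN by (simp add: algebra_simps)
    then have "\<bar>\<sigma>2 - \<sigma>1 - A * (1 / 2 - real_of_int ?k)\<bar> \<le> \<epsilon>"
      using SN SN' half hb[OF Nt(1)] \<eta>(2) \<epsilon> by linarith
    then show ?thesis by blast
  qed
  then show ?thesis unfolding Let_def using \<eta>(1) t0(1) by (intro exI[of _ \<eta>] conjI exI[of _ t0]) auto
qed


lemma cos_half_jump:
  fixes c :: real and k :: int
  shows "cos (2 * pi * (v + A * (1 / 2 - real_of_int k) - c) / A) = - cos (2 * pi * (v - c) / A)"
proof -
  have "2 * pi * (v + A * (1 / 2 - real_of_int k) - c) / A = (2 * pi * (v - c) / A + pi) - of_int k * (2 * pi)"
    using jump by (simp add: field_simps)
  then have "cos (2 * pi * (v + A * (1 / 2 - real_of_int k) - c) / A) = cos (2 * pi * (v - c) / A + pi)"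
    by (simp only: cos_diff sin_int_2pin cos_int_2pin mult.commute[of _ "2 * pi"])
  then show ?thesis by simp
qed

text \<open>
  If most points nearly return at the time \<open>t + \<sigma>\<close> with a bounded \<open>\<sigma>\<close>, then translating a point by
  \<open>1/(2t)\<close> changes \<open>\<sigma>\<close> by \<open>A/2\<close> modulo \<open>A\<close> and hence changes the sign of \<open>cos (2\<pi> (\<sigma> - c) / A)\<close>.
  The translation preserves the measure and nearly preserves the domain, so the integral of this
  function almost equals its own negative.
\<close>

lemma nearly_returning_cancellation:
  assumes C: "C \<ge> 0" and \<epsilon>: "\<epsilon> > 0"
  shows "\<exists>\<eta>>0. \<exists>t0. \<forall>t\<ge>t0. \<forall>\<sigma> Bad c. \<sigma> \<in> borel_measurable borel \<longrightarrow> (\<forall>z\<in>dom. \<bar>\<sigma> z\<bar> \<le> C) \<longrightarrow>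
      Bad \<in> sets borel \<longrightarrow> emeasure lborel Bad \<le> ennreal \<eta> \<longrightarrow>
      (\<forall>z\<in>dom - Bad. \<bar>fst (flow (t + \<sigma> z) z) - fst z\<bar> \<le> \<eta> \<and> \<bar>snd (flow (t + \<sigma> z) z) - snd z\<bar> \<le> \<eta>) \<longrightarrow>
      \<bar>\<integral>z. indicator dom z * cos (2 * pi * (\<sigma> z - c) / A) \<partial>lborel\<bar> \<le> \<epsilon>"
proof -
  obtain B where B: "B > 0" "\<And>x. lift x \<le> B" using lift_bounded by blast
  define D where "D = measure lborel dom"
  have D: "D \<ge> 0" by (simp add: D_def)
  define \<epsilon>1 where "\<epsilon>1 = \<epsilon> / (D + 1)"
  have \<epsilon>1: "\<epsilon>1 > 0" "\<epsilon>1 * D \<le> \<epsilon>" using \<epsilon> D by (auto simp: \<epsilon>1_def field_simps)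
  define \<epsilon>2 where "\<epsilon>2 = \<epsilon>1 * \<bar>A\<bar> / (2 * pi)"
  have \<epsilon>2: "\<epsilon>2 > 0" using \<epsilon>1 jump by (simp add: \<epsilon>2_def)
  \<comment> \<open>the roof is at most \<open>B\<close> and the expected number of crossings is at most 3, so more than \<open>K\<close>
    crossings occur on a set of measure at most \<open>3 B / K = \<epsilon> / 8\<close>\<close>
  define K where "K = 24 * B / \<epsilon>"
  have K: "K > 0" using B \<epsilon> by (simp add: K_def)
  define \<Omega> where "\<Omega> = {-1..1::real} \<times> {0..B}"
  have \<Omega>: "bounded \<Omega>" unfolding \<Omega>_def by (intro bounded_Times) auto
  define \<eta>3 where "\<eta>3 = min (\<epsilon> / 8) (1 / 2)"
  have \<eta>3: "\<eta>3 > 0" "\<eta>3 \<le> \<epsilon> / 8" "\<eta>3 < 1" using \<epsilon> by (auto simp: \<eta>3_def)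
  have [measurable]: "dom \<in> sets borel" by (rule dom_borel)
  obtain \<kappa> where \<kappa>: "\<kappa> > 0" "\<And>d r. \<bar>d\<bar> \<le> \<kappa> \<Longrightarrow> r \<in> borel_measurable borel \<Longrightarrow> (\<And>x. \<bar>r x\<bar> \<le> \<kappa>) \<Longrightarrow>
     \<exists>E\<in>sets borel. emeasure lborel E \<le> ennreal \<eta>3 \<and> (\<forall>z\<in>\<Omega> - E. \<bar>indicator dom (shear d r z) - indicator dom z :: real\<bar> \<le> \<eta>3)"
    using borel_nearly_shear_invariant[of "indicator dom" \<Omega> \<eta>3] \<Omega> \<eta>3 by (auto simp: borel_measurable_indicator)
  obtain \<eta>0 t1 where \<eta>0: "\<eta>0 > 0" "t1 \<ge> 1" and core: "\<And>t x s \<sigma>1 \<sigma>2. t \<ge> t1 \<Longrightarrow>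
      (x, s) \<in> dom \<Longrightarrow> (x + 1 / (2 * t), s) \<in> dom \<Longrightarrow> \<bar>\<sigma>1\<bar> \<le> C \<Longrightarrow> \<bar>\<sigma>2\<bar> \<le> C \<Longrightarrow>
      \<bar>fst (flow (t + \<sigma>1) (x, s)) - x\<bar> \<le> \<eta>0 \<Longrightarrow> \<bar>snd (flow (t + \<sigma>1) (x, s)) - s\<bar> \<le> \<eta>0 \<Longrightarrow>
      \<bar>fst (flow (t + \<sigma>2) (x + 1 / (2 * t), s)) - (x + 1 / (2 * t))\<bar> \<le> \<eta>0 \<Longrightarrow> \<bar>snd (flow (t + \<sigma>2) (x + 1 / (2 * t), s)) - s\<bar> \<le> \<eta>0 \<Longrightarrow>
      real_of_int (crossings \<alpha> (1 / (2 * t)) (nat \<lfloor>4 * t\<rfloor>) x) \<le> K \<Longrightarrow>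
      \<exists>k::int. \<bar>\<sigma>2 - \<sigma>1 - A * (1 / 2 - real_of_int k)\<bar> \<le> \<epsilon>2"
    using return_times_differ_by_half_jump[OF C less_imp_le[OF K] \<epsilon>2] unfolding Let_def by blast
  define \<eta> where "\<eta> = min \<eta>0 (\<epsilon> / 8)"
  have \<eta>: "\<eta> > 0" "\<eta> \<le> \<eta>0" "\<eta> \<le> \<epsilon> / 8" using \<eta>0 \<epsilon> by (auto simp: \<eta>_def)
  define t0 where "t0 = max t1 (1 / (2 * \<kappa>))"
  have main: "\<bar>\<integral>z. indicator dom z * cos (2 * pi * (\<sigma> z - c) / A) \<partial>lborel\<bar> \<le> \<epsilon>"
    if t: "t \<ge> t0" and \<sigma>[measurable]: "\<sigma> \<in> borel_measurable borel" and \<sigma>C: "\<And>z. z \<in> dom \<Longrightarrow> \<bar>\<sigma> z\<bar> \<le> C"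
      and Bad[measurable]: "Bad \<in> sets borel" and BadE: "emeasure lborel Bad \<le> ennreal \<eta>"
      and close: "\<And>z. z \<in> dom - Bad \<Longrightarrow> \<bar>fst (flow (t + \<sigma> z) z) - fst z\<bar> \<le> \<eta> \<and> \<bar>snd (flow (t + \<sigma> z) z) - snd z\<bar> \<le> \<eta>"
    for t \<sigma> Bad c
  proof -
    define d where "d = 1 / (2 * t)"
    have t1: "t \<ge> t1" "t \<ge> 1" "t \<ge> 1 / (2 * \<kappa>)" using t \<eta>0 by (auto simp: t0_def)
    have d: "0 < d" "d < 1" "d \<le> \<kappa>" using t1 \<kappa>(1) by (auto simp: d_def field_simps)
    define u where "u = shear d (\<lambda>_. 0)"
    have u: "u (x, s) = (x + d, s)" for x s by (simp add: u_def shear_def)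
    have um[measurable]: "u \<in> borel_measurable borel" unfolding u_def by (rule shear_measurable) simp
    obtain E1 where E1[measurable]: "E1 \<in> sets borel" and E1e: "emeasure lborel E1 \<le> ennreal \<eta>3"
        and E1d: "\<And>z. z \<in> \<Omega> - E1 \<Longrightarrow> \<bar>indicator dom (u z) - indicator dom z :: real\<bar> \<le> \<eta>3"
      using \<kappa>(2)[of d "\<lambda>_. 0"] d \<kappa>(1) unfolding u_def by auto
    define X where "X = {x \<in> circle. real_of_int (crossings \<alpha> d (nat \<lfloor>4 * t\<rfloor>) x) \<ge> K}"
    have X: "X \<in> sets borel"
    proof -
      have "X = circle \<inter> {x \<in> space borel. real_of_int (crossings \<alpha> d (nat \<lfloor>4 * t\<rfloor>) x) \<ge> K}" by (auto simp: X_def)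
      also have "\<dots> \<in> sets borel" by measurable
      finally show ?thesis .
    qed
    define E2 where "E2 = X \<times> {0..B}"
    have E2[measurable]: "E2 \<in> sets borel" unfolding E2_def using X by (intro borel_Times) auto
    have E2e: "emeasure lborel E2 \<le> ennreal (\<epsilon> / 8)"
    proof -
      have "emeasure lborel E2 = emeasure (lborel \<Otimes>\<^sub>M lborel) (X \<times> {0..B})" by (simp add: lborel_prod E2_def)
      also have "\<dots> = emeasure lborel X * ennreal B" using X B by (subst lborel.emeasure_pair_measure_Times) auto
      also have "\<dots> \<le> ennreal (real (nat \<lfloor>4 * t\<rfloor>) * d / K) * ennreal B"
        unfolding X_def using d K by (intro mult_right_mono emeasure_many_crossings) auto
      also have "\<dots> = ennreal (real (nat \<lfloor>4 * t\<rfloor>) * d / K * B)" using d K B by (subst ennreal_mult) auto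
      also have "\<dots> \<le> ennreal (\<epsilon> / 8)"
      proof (rule ennreal_leI)
        have "real (nat \<lfloor>4 * t\<rfloor>) * d \<le> 4 * t * d" using d t1 by (intro mult_right_mono) auto
        also have "\<dots> \<le> 3" using t1 by (simp add: d_def)
        finally have "real (nat \<lfloor>4 * t\<rfloor>) * d / K * B \<le> 3 / K * B" using K B by (intro mult_right_mono divide_right_mono) auto
        also have "\<dots> = \<epsilon> / 8" using B \<epsilon> by (simp add: K_def)
        finally show "real (nat \<lfloor>4 * t\<rfloor>) * d / K * B \<le> \<epsilon> / 8" .
      qed
      finally show ?thesis .
    qed
    \<comment> \<open>the points that enter or leave the domain under the translation, those with too many crossings,
      and those that do not nearly return before or after the translation\<close>
    define E where "E = E1 \<union> E2 \<union> Bad \<union> u -` Bad"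
    have uB[measurable]: "u -` Bad \<in> sets borel" using measurable_sets[OF um Bad] by simp
    have uBe: "emeasure lborel (u -` Bad) = emeasure lborel Bad" unfolding u_def by (rule emeasure_shear_vimage) (use Bad in auto)
    have E[measurable]: "E \<in> sets borel" unfolding E_def by measurable
    have Ee: "emeasure lborel E \<le> ennreal (\<epsilon> / 2)"
    proof -
      have "emeasure lborel E1 \<le> ennreal (\<epsilon> / 8)" "emeasure lborel Bad \<le> ennreal (\<epsilon> / 8)"
        using order_trans[OF E1e ennreal_leI[OF \<eta>3(2)]] order_trans[OF BadE ennreal_leI[OF \<eta>(3)]] .
      note parts = this
      have "emeasure lborel E \<le> emeasure lborel E1 + emeasure lborel E2 + emeasure lborel Bad + emeasure lborel (u -` Bad)"
        unfolding E_def by (intro order_trans[OF emeasure_subadditive] add_mono order_refl) auto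
      also have "\<dots> \<le> ennreal (\<epsilon> / 8) + ennreal (\<epsilon> / 8) + ennreal (\<epsilon> / 8) + ennreal (\<epsilon> / 8)"
        unfolding uBe using parts E2e by (intro add_mono)
      also have "\<dots> = ennreal (\<epsilon> / 2)" using \<epsilon> by (simp add: ennreal_plus[symmetric] del: ennreal_plus)
      finally show ?thesis .
    qed
    then have Efin: "emeasure lborel E < \<infinity>" using le_less_trans by fastforce
    have Em: "measure lborel E \<le> \<epsilon> / 2" using Ee \<epsilon> unfolding measure_def by (intro enn2real_leI) auto
    define \<psi> where "\<psi> = (\<lambda>v. cos (2 * pi * (v - c) / A))"
    have [measurable]: "\<psi> \<in> borel_measurable borel" unfolding \<psi>_def by measurable
    have \<psi>1: "\<bar>\<psi> v\<bar> \<le> 1" for v by (simp add: \<psi>_def)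
    define F where "F = (\<lambda>z. indicator dom z * \<psi> (\<sigma> z))"
    have [measurable]: "F \<in> borel_measurable borel" unfolding F_def by measurable
    have F1: "\<bar>F z\<bar> \<le> indicator dom z" for z using \<psi>1[of "\<sigma> z"] by (auto simp: F_def indicator_def)
    have Fi: "integrable lborel F"
      by (rule Bochner_Integration.integrable_bound[of lborel "indicator dom :: _ \<Rightarrow> real"])
        (use dom_finite F1 in \<open>auto simp: integrable_indicator_iff\<close>)
    have Fui: "integrable lborel (\<lambda>z. F (u z))"
    proof -
      have "distr lborel borel u = lborel" unfolding u_def
        by (rule measure_eqI) (auto simp: emeasure_distr emeasure_shear_vimage shear_measurable)
      then show ?thesis using integrable_distr[of u lborel borel F] Fi um by simp
    qed
    have Fu: "(\<integral>z. F (u z) \<partial>lborel) = (\<integral>z. F z \<partial>lborel)" unfolding u_def by (rule integral_shear) auto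
    have pt: "\<bar>F z + F (u z)\<bar> \<le> \<epsilon>1 * indicator dom z + 2 * indicator E z" for z
    proof (cases "z \<in> E")
      case True
      have "\<bar>F z\<bar> \<le> 1" "\<bar>F (u z)\<bar> \<le> 1" using \<psi>1[of "\<sigma> z"] \<psi>1[of "\<sigma> (u z)"] by (auto simp: F_def indicator_def)
      moreover have "\<epsilon>1 * indicator dom z \<ge> 0" using \<epsilon>1 by simp
      ultimately show ?thesis using True by simp
    next
      case False
      obtain x s where z: "z = (x, s)" by (cases z)
      have in\<Omega>: "z \<in> \<Omega>" if "z \<in> dom \<or> u z \<in> dom"
        using that d B(2)[of x] B(2)[of "x + d"] by (auto simp: z u \<Omega>_def dom_iff)
      have "z \<in> dom \<longleftrightarrow> u z \<in> dom"
        using E1d[of z] in\<Omega> False \<eta>3(3) by (cases "z \<in> dom"; cases "u z \<in> dom") (auto simp: E_def)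
      then consider "z \<notin> dom" "u z \<notin> dom" | "z \<in> dom" "u z \<in> dom" by blast
      then show ?thesis
      proof cases
        case 1
        then show ?thesis using False by (simp add: F_def)
      next
        case 2
        have nb: "z \<notin> Bad" "u z \<notin> Bad" "z \<notin> E2" using False by (auto simp: E_def)
        have "x \<in> circle" "s \<in> {0..B}" using 2(1) B(2)[of x] by (auto simp: z dom_iff)
        then have "real_of_int (crossings \<alpha> d (nat \<lfloor>4 * t\<rfloor>) x) \<le> K"
          using nb(3) by (auto simp: E2_def X_def z)
        moreover have "\<bar>fst (flow (t + \<sigma> z) z) - fst z\<bar> \<le> \<eta>0 \<and> \<bar>snd (flow (t + \<sigma> z) z) - snd z\<bar> \<le> \<eta>0"
          using close[of z] 2 nb \<eta>(2) by auto
        moreover have "\<bar>fst (flow (t + \<sigma> (u z)) (u z)) - fst (u z)\<bar> \<le> \<eta>0 \<and> \<bar>snd (flow (t + \<sigma> (u z)) (u z)) - snd (u z)\<bar> \<le> \<eta>0"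
          using close[of "u z"] 2 nb \<eta>(2) by auto
        ultimately obtain k :: int where k: "\<bar>\<sigma> (u z) - \<sigma> z - A * (1 / 2 - real_of_int k)\<bar> \<le> \<epsilon>2"
          using core[OF t1(1), of x s "\<sigma> z" "\<sigma> (u z)"] 2 \<sigma>C[of z] \<sigma>C[of "u z"] unfolding z u fst_conv snd_conv d_def by blast
        define w where "w = \<sigma> z + A * (1 / 2 - real_of_int k)"
        have "\<psi> w = - \<psi> (\<sigma> z)" unfolding \<psi>_def w_def by (rule cos_half_jump)
        then have "\<bar>F z + F (u z)\<bar> = \<bar>\<psi> (\<sigma> (u z)) - \<psi> w\<bar>" using 2 by (simp add: F_def)
        also have "\<dots> \<le> \<bar>2 * pi * (\<sigma> (u z) - c) / A - 2 * pi * (w - c) / A\<bar>"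
          unfolding \<psi>_def by (rule abs_cos_diff_le)
        also have "\<dots> = 2 * pi / \<bar>A\<bar> * \<bar>\<sigma> (u z) - w\<bar>"
        proof -
          have "2 * pi * (\<sigma> (u z) - c) / A - 2 * pi * (w - c) / A = 2 * pi / A * (\<sigma> (u z) - w)"
            by (simp add: diff_divide_distrib right_diff_distrib)
          then show ?thesis by (simp add: abs_mult)
        qed
        also have "\<dots> \<le> 2 * pi / \<bar>A\<bar> * \<epsilon>2"
          using k by (intro mult_left_mono) (auto simp: w_def algebra_simps)
        also have "\<dots> = \<epsilon>1" using jump by (simp add: \<epsilon>2_def)
        finally show ?thesis using 2 False by simp
      qed
    qed
    have Gi: "integrable lborel (\<lambda>z. \<epsilon>1 * indicator dom z + 2 * indicator E z :: real)"
      using dom_finite Efin by (intro Bochner_Integration.integrable_add integrable_mult_right) (auto simp: integrable_indicator_iff)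
    have "\<bar>2 * (\<integral>z. F z \<partial>lborel)\<bar> = \<bar>\<integral>z. F z + F (u z) \<partial>lborel\<bar>"
      using Fi Fui Fu by simp
    also have "\<dots> \<le> (\<integral>z. \<epsilon>1 * indicator dom z + 2 * indicator E z \<partial>lborel)"
      using Fi Fui Gi pt by (intro order_trans[OF integral_abs_bound] integral_mono) auto
    also have "\<dots> = \<epsilon>1 * D + 2 * measure lborel E"
      using dom_finite Efin by (subst Bochner_Integration.integral_add) (auto simp: D_def integrable_indicator_iff)
    also have "\<dots> \<le> 2 * \<epsilon>" using \<epsilon>1(2) Em by linarith
    finally have "\<bar>\<integral>z. F z \<partial>lborel\<bar> \<le> \<epsilon>" by linarith
    then show ?thesis by (simp add: F_def \<psi>_def)
  qed
  show ?thesis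
    apply (rule exI[of _ \<eta>], rule conjI[OF \<eta>(1)], rule exI[of _ t0], intro allI impI)
    apply (rule main)
         apply (assumption | erule bspec, assumption)+
    done
qed

end

section \<open>A Fourier coefficient of the displacement at a rigidity time\<close>

lemma circle_integral_eq:
  fixes \<phi> :: "real \<Rightarrow> real"
  assumes cont: "continuous_on {0..1} \<phi>" and int: "(\<phi> has_integral I) {0..1}"
  shows "integrable lborel (\<lambda>x. indicator circle x * \<phi> x)" "(\<integral>x. indicator circle x * \<phi> x \<partial>lborel) = I"
proof -
  have si: "set_integrable lborel {0..1} \<phi>" using borel_integrable_atLeastAtMost'[OF cont] by simp
  then have i1: "integrable lborel (\<lambda>x. indicator {0..1} x * \<phi> x)" by (simp add: set_integrable_def)
  have "set_integrable lborel circle \<phi>" by (rule set_integrable_subset[OF si]) auto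
  then show i2: "integrable lborel (\<lambda>x. indicator circle x * \<phi> x)" by (simp add: set_integrable_def)
  have "AE x in lborel. x \<noteq> (1::real)" by (rule AE_lborel_singleton)
  then have "AE x in lborel. indicator circle x * \<phi> x = indicator {0..1} x * \<phi> x"
    by eventually_elim (auto simp: indicator_def)
  then have "(\<integral>x. indicator circle x * \<phi> x \<partial>lborel) = (\<integral>x. indicator {0..1} x * \<phi> x \<partial>lborel)"
    using i1 i2 by (intro integral_cong_AE) auto
  also have "\<dots> = integral {0..1} \<phi>" using set_borel_integral_eq_integral(2)[OF si] by (simp add: set_lebesgue_integral_def)
  also have "\<dots> = I" using int by (rule integral_unique)
  finally show "(\<integral>x. indicator circle x * \<phi> x \<partial>lborel) = I" .
qed

lemma has_integral_linear_unit: "((\<lambda>x. A * x) has_integral A / 2) {0..1::real}"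
proof -
  have "((\<lambda>x. A * x) has_integral A * 1\<^sup>2 / 2 - A * 0\<^sup>2 / 2) {0..1}"
    by (rule fundamental_theorem_of_calculus)
      (auto simp: has_real_derivative_iff_has_vector_derivative[symmetric] intro!: derivative_eq_intros)
  then show ?thesis by simp
qed

lemma circle_integral_blocks:
  fixes H :: "real \<Rightarrow> real"
  assumes H: "integrable lborel (\<lambda>x. indicator circle x * H x)" and q: "q > 0"
  shows "(\<integral>x. indicator circle x * H x \<partial>lborel) =
    (\<Sum>i<q. (1 / real q) * (\<integral>u. indicator circle u * H ((real i + u) / real q) \<partial>lborel))"
proof -
  let ?I = "\<lambda>i. {real i / real q..<(real i + 1) / real q}"
  have q': "real q > 0" using q by simp
  have sub: "?I i \<subseteq> circle" if "i < q" for i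
  proof -
    have "real i + 1 \<le> real q" using that by linarith
    then have "(real i + 1) / real q \<le> 1" using q' by simp
    moreover have "real i / real q \<ge> 0" using q' by simp
    ultimately show ?thesis by auto
  qed
  have int: "integrable lborel (\<lambda>x. indicator (?I i) x * H x)" if "i < q" for i
  proof -
    have "set_integrable lborel circle H" using H by (simp add: set_integrable_def)
    then have "set_integrable lborel (?I i) H" by (rule set_integrable_subset) (use sub[OF that] in auto)
    then show ?thesis by (simp add: set_integrable_def)
  qed
  have split: "indicator circle x = (\<Sum>i<q. indicator (?I i) x :: real)" for x
  proof (cases "x \<in> circle")
    case True
    define j where "j = nat \<lfloor>real q * x\<rfloor>"
    have j0: "0 \<le> real q * x" "real q * x < real q" using True q' by auto
    then have j: "real j \<le> real q * x" "real q * x < real j + 1" "j < q" unfolding j_def by linarith+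
    have "x \<in> ?I i \<longleftrightarrow> i = j" for i
    proof -
      have "x \<in> ?I i \<longleftrightarrow> real i \<le> real q * x \<and> real q * x < real i + 1"
        using q' by (auto simp: field_simps)
      also have "\<dots> \<longleftrightarrow> i = j"
      proof
        assume "real i \<le> real q * x \<and> real q * x < real i + 1"
        then have "real i < real j + 1" "real j < real i + 1" using j by linarith+
        then show "i = j" by linarith
      qed (use j in auto)
      finally show ?thesis .
    qed
    then have "(\<Sum>i<q. indicator (?I i) x :: real) = (\<Sum>i<q. if i = j then 1 else 0)"
      by (intro sum.cong) (auto simp: indicator_def simp del: atLeastLessThan_iff)
    then show ?thesis using True j by simp
  next
    case False
    then have "(\<Sum>i<q. indicator (?I i) x :: real) = 0"
      using subsetD[OF sub] by (intro sum.neutral ballI) (simp add: indicator_def del: atLeastLessThan_iff, blast)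
    then show ?thesis using False by simp
  qed
  have "(\<integral>x. indicator circle x * H x \<partial>lborel) = (\<integral>x. (\<Sum>i<q. indicator (?I i) x * H x) \<partial>lborel)"
    by (simp add: split sum_distrib_right)
  also have "\<dots> = (\<Sum>i<q. \<integral>x. indicator (?I i) x * H x \<partial>lborel)"
    using int by (intro Bochner_Integration.integral_sum) auto
  also have "\<dots> = (\<Sum>i<q. (1 / real q) * (\<integral>u. indicator circle u * H ((real i + u) / real q) \<partial>lborel))"
  proof (rule sum.cong)
    fix i
    have ind: "indicator (?I i) (real i / real q + 1 / real q * u) = (indicator circle u :: real)" for u
      using q' by (auto simp: indicator_def field_simps)
    have "(\<integral>x. indicator (?I i) x * H x \<partial>lborel) =
        \<bar>1 / real q\<bar> *\<^sub>R (\<integral>u. indicator (?I i) (real i / real q + 1 / real q * u) * H (real i / real q + 1 / real q * u) \<partial>lborel)"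
      using q' by (intro lborel_integral_real_affine) auto
    also have "(\<lambda>u. indicator (?I i) (real i / real q + 1 / real q * u) * H (real i / real q + 1 / real q * u)) =
        (\<lambda>u. indicator circle u * H ((real i + u) / real q))"
    proof
      fix u
      have "real i / real q + 1 / real q * u = (real i + u) / real q" by (simp add: add_divide_distrib)
      then show "indicator (?I i) (real i / real q + 1 / real q * u) * H (real i / real q + 1 / real q * u) =
          indicator circle u * H ((real i + u) / real q)"
        unfolding ind by (simp only:)
    qed
    finally show "(\<integral>x. indicator (?I i) x * H x \<partial>lborel) = (1 / real q) * (\<integral>u. indicator circle u * H ((real i + u) / real q) \<partial>lborel)"
      by simp
  qed simp
  finally show ?thesis .
qed

lemma circle_integral_cos:
  fixes a z :: real
  assumes "a \<noteq> 0"
  shows "(\<integral>w. indicator circle w * cos (2 * pi * (a * w - z)) \<partial>lborel) = sin (pi * a) / (pi * a) * cos (2 * pi * (a / 2 - z))"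
proof -
  let ?G = "\<lambda>w. sin (2 * pi * (a * w - z)) / (2 * pi * a)"
  have "((\<lambda>w. cos (2 * pi * (a * w - z))) has_integral ?G 1 - ?G 0) {0..1}"
  proof (rule fundamental_theorem_of_calculus)
    fix x :: real
    show "(?G has_vector_derivative cos (2 * pi * (a * x - z))) (at x within {0..1})"
      unfolding has_real_derivative_iff_has_vector_derivative[symmetric]
      using assms by (auto intro!: derivative_eq_intros simp: field_simps)
  qed simp
  then have "(\<integral>w. indicator circle w * cos (2 * pi * (a * w - z)) \<partial>lborel) = ?G 1 - ?G 0"
    by (intro circle_integral_eq(2)) (auto intro!: continuous_intros)
  also have "\<dots> = (sin (2 * pi * (a - z)) + sin (2 * pi * z)) / (2 * pi * a)"
    by (simp add: diff_divide_distrib add_divide_distrib)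
  also have "sin (2 * pi * (a - z)) + sin (2 * pi * z) = 2 * sin (pi * a) * cos (2 * pi * (a / 2 - z))"
  proof -
    have e: "(2 * pi * (a - z) + 2 * pi * z) / 2 = pi * a" "(2 * pi * (a - z) - 2 * pi * z) / 2 = 2 * pi * (a / 2 - z)"
      by (simp_all add: field_simps)
    show ?thesis unfolding sin_plus_sin e by simp
  qed
  finally show ?thesis using assms by simp
qed

context one_jump_roof
begin

lemma integral_lift: "integrable lborel (\<lambda>x. indicator circle x * lift x)" "(\<integral>x. indicator circle x * lift x \<partial>lborel) = 1"
proof -
  have c: "continuous_on {0..1} (\<lambda>x. A * x + h x)"
    using h_cont by (intro continuous_intros) (auto intro: continuous_on_subset)
  have "((\<lambda>x. A * x + h x) has_integral A / 2 + m) {0..1}"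
    by (rule has_integral_add[OF has_integral_linear_unit h_integral])
  then have i: "((\<lambda>x. A * x + h x) has_integral 1) {0..1}" by (simp add: mean_one)
  have e: "indicator circle x * lift x = indicator circle x * (A * x + h x)" for x
    by (auto simp: indicator_def lift_def frac_eq)
  show "integrable lborel (\<lambda>x. indicator circle x * lift x)" "(\<integral>x. indicator circle x * lift x \<partial>lborel) = 1"
    unfolding e by (rule circle_integral_eq[OF c i])+
qed

lemma lift_Lipschitz: "\<exists>L\<ge>0. \<forall>x\<in>circle. \<forall>y\<in>circle. \<bar>lift x - lift y\<bar> \<le> L * \<bar>x - y\<bar>"
proof -
  have "continuous_on {0..1} h'" using h'_cont by (rule continuous_on_subset) simp
  then have "bounded (h' ` {0..1})" by (intro compact_imp_bounded compact_continuous_image) auto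
  then obtain B where B: "B > 0" "\<And>x. x \<in> {0..1} \<Longrightarrow> \<bar>h' x\<bar> \<le> B" by (auto simp: bounded_pos)
  have "\<bar>lift x - lift y\<bar> \<le> (\<bar>A\<bar> + B) * \<bar>x - y\<bar>" if "x \<in> circle" "y \<in> circle" for x y
  proof -
    have "\<bar>h x - h y\<bar> \<le> B * \<bar>x - y\<bar>"
      using field_differentiable_bound[of "{0..1}" h h' B x y] h_deriv B that by (auto intro: has_field_derivative_at_within)
    moreover have "lift x - lift y = A * (x - y) + (h x - h y)" using that by (simp add: lift_def frac_eq algebra_simps)
    moreover have "\<bar>A * (x - y)\<bar> = \<bar>A\<bar> * \<bar>x - y\<bar>" by (simp add: abs_mult)
    ultimately show ?thesis by (simp add: algebra_simps)
  qed
  then show ?thesis using B(1) by (intro exI[of _ "\<bar>A\<bar> + B"]) auto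
qed

lemma integral_dom_base:
  fixes \<phi> :: "real \<Rightarrow> real"
  assumes [measurable]: "\<phi> \<in> borel_measurable borel" and b: "\<And>x. \<bar>\<phi> x\<bar> \<le> 1"
  shows "(\<integral>z. indicator dom z * \<phi> (fst z) \<partial>lborel) = (\<integral>x. indicator circle x * (lift x * \<phi> x) \<partial>lborel)"
proof -
  let ?F = "\<lambda>z. indicator dom z * \<phi> (fst z)"
  have [measurable]: "dom \<in> sets borel" by (rule dom_borel)
  have [measurable]: "fst \<in> borel_measurable (borel :: (real \<times> real) measure)"
    by (intro borel_measurable_continuous_onI continuous_intros)
  have "integrable lborel ?F"
  proof (rule Bochner_Integration.integrable_bound[of lborel "indicator dom :: _ \<Rightarrow> real"])
    show "integrable lborel (indicator dom :: _ \<Rightarrow> real)" using dom_finite by (simp add: integrable_indicator_iff)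
    show "?F \<in> borel_measurable lborel" by measurable
    show "AE z in lborel. norm (?F z) \<le> norm (indicator dom z :: real)"
      using b by (auto simp: indicator_def)
  qed
  then have i: "integrable (lborel \<Otimes>\<^sub>M lborel) ?F" by (simp add: lborel_prod)
  have "(\<integral>z. ?F z \<partial>lborel) = (\<integral>z. ?F z \<partial>(lborel \<Otimes>\<^sub>M lborel))" by (simp add: lborel_prod)
  also have "\<dots> = (\<integral>x. (\<integral>s. ?F (x, s) \<partial>lborel) \<partial>lborel)" by (rule lborel_pair.integral_fst'[OF i, symmetric])
  also have "\<dots> = (\<integral>x. indicator circle x * (lift x * \<phi> x) \<partial>lborel)"
  proof (rule Bochner_Integration.integral_cong)
    fix x :: real
    have "?F (x, s) = indicator {0..<lift x} s * (indicator circle x * \<phi> x)" for s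
      by (auto simp: indicator_def dom_iff)
    then have "(\<integral>s. ?F (x, s) \<partial>lborel) = (\<integral>s. indicator {0..<lift x} s * (indicator circle x * \<phi> x) \<partial>lborel)"
      by (simp only:)
    then show "(\<integral>s. ?F (x, s) \<partial>lborel) = indicator circle x * (lift x * \<phi> x)"
      using lift_pos[of x] by (simp add: mult.commute)
  qed simp
  finally show ?thesis .
qed

text \<open>
  With \<open>a = A/G\<close>, the displacement on a block of length \<open>1/q\<close> is \<open>A (w - v)\<close> plus a constant, where \<open>w\<close>
  is uniformly distributed in \<open>[0,1)\<close> and \<open>v\<close> is a number between \<open>0\<close> and \<open>\<theta>\<close>.  The average of
  \<open>exp (2\<pi>i (a w - a v))\<close> over \<open>w\<close> has modulus \<open>sin (\<pi>a) / (\<pi>a)\<close>, which is positive because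
  \<open>\<bar>a\<bar> < 1\<close>, and its phase varies over the blocks by less than a half turn, so that the blocks cannot
  cancel each other.  The function \<open>\<tau>\<close> stands for the displacement rounded to multiples of \<open>1/q\<close>.
\<close>

lemma rigidity_time_fourier_coefficient:
  assumes G: "\<bar>A\<bar> < \<bar>G\<bar>"
  shows "\<exists>\<gamma>>0. \<exists>Q. \<forall>p q \<tau>. close_fraction \<alpha> p q \<longrightarrow> q \<ge> Q \<longrightarrow> \<tau> \<in> borel_measurable borel \<longrightarrow>
    (\<forall>x. \<bar>\<tau> x - (S q x - real q)\<bar> \<le> 1 / real q) \<longrightarrow>
    (\<exists>c. (\<integral>z. indicator dom z * cos (2 * pi * (\<tau> (fst z) - c) / G) \<partial>lborel) \<ge> \<gamma>)"
proof -
  define a where "a = A / G"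
  have Gn: "G \<noteq> 0" using G by auto
  have a: "a \<noteq> 0" "\<bar>a\<bar> < 1" using jump G Gn by (auto simp: a_def)
  define sc where "sc = sin (pi * a) / (pi * a)"
  have sc: "sc > 0"
  proof (cases "a > 0")
    case True
    then have "sin (pi * a) > 0" using a by (intro sin_gt_zero) auto
    then show ?thesis using True by (simp add: sc_def)
  next
    case False
    then have a': "- a > 0" using a by simp
    have "0 < - (pi * a)" using a' by (simp add: mult_pos_neg)
    moreover have "- (pi * a) < pi" using mult_strict_left_mono[of "- a" 1 pi] a by simp
    ultimately have "sin (- (pi * a)) > 0" by (rule sin_gt_zero)
    then show ?thesis using a' by (simp add: sc_def divide_neg_neg mult_pos_neg)
  qed
  have sc1: "sc \<le> 1"
  proof -
    have "\<bar>sin (pi * a)\<bar> \<le> \<bar>pi * a\<bar>" by (rule abs_sin_x_le_abs_x)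
    then have "\<bar>sc\<bar> \<le> 1" using a by (simp add: sc_def abs_divide)
    then show ?thesis by simp
  qed
  define \<mu> where "\<mu> = sc * cos (pi * \<bar>a\<bar> / 2)"
  have cosp: "cos (pi * \<bar>a\<bar> / 2) > 0"
  proof (rule cos_gt_zero_pi)
    show "- (pi / 2) < pi * \<bar>a\<bar> / 2" using mult_nonneg_nonneg[of pi "\<bar>a\<bar>"] pi_gt_zero by linarith
    show "pi * \<bar>a\<bar> / 2 < pi / 2" using a pi_gt_zero by simp
  qed
  have \<mu>: "\<mu> > 0" "\<mu> \<le> 1" using sc sc1 cosp by (auto simp: \<mu>_def intro!: mult_le_one)
  obtain L where L: "L \<ge> 0" "\<And>x y. x \<in> circle \<Longrightarrow> y \<in> circle \<Longrightarrow> \<bar>lift x - lift y\<bar> \<le> L * \<bar>x - y\<bar>"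
    using lift_Lipschitz by blast
  define \<epsilon> where "\<epsilon> = \<mu> * \<bar>G\<bar> / (16 * pi)"
  have \<epsilon>: "\<epsilon> > 0" using \<mu> Gn by (simp add: \<epsilon>_def)
  obtain Q0 where Q0: "\<And>p q. close_fraction \<alpha> p q \<Longrightarrow> q \<ge> Q0 \<Longrightarrow>
     (\<exists>K. \<bar>K\<bar> \<le> \<bar>A\<bar> \<and> (\<forall>i::int. \<exists>j<q. \<forall>u\<in>{0..<1}.
        \<bar>S q ((real_of_int i + u) / real q) - real q
          - (A * (frac (u + real j * (real q * (real q * \<alpha> - real_of_int p)) / real q)
                   - real j * (real q * (real q * \<alpha> - real_of_int p)) / real q) + K)\<bar> \<le> \<epsilon>))"
    using S_block[OF \<epsilon>] by blast
  define Q where "Q = max Q0 (max (nat \<lceil>1 / \<epsilon>\<rceil>) (nat \<lceil>8 * L / \<mu>\<rceil>))"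
  have main: "\<exists>c. (\<integral>z. indicator dom z * cos (2 * pi * (\<tau> (fst z) - c) / G) \<partial>lborel) \<ge> \<mu> / 2"
    if cf: "close_fraction \<alpha> p q" and qQ: "q \<ge> Q" and [measurable]: "\<tau> \<in> borel_measurable borel"
      and \<tau>: "\<And>x. \<bar>\<tau> x - (S q x - real q)\<bar> \<le> 1 / real q" for p q \<tau>
  proof -
    have q: "real q > 0" "q > 0" and ap: "\<bar>real q * \<alpha> - real_of_int p\<bar> \<le> 1 / (2 * real q)"
      using cf by (auto simp: close_fraction_def)
    have "real q \<ge> 1 / \<epsilon>" "real q \<ge> 8 * L / \<mu>" using qQ unfolding Q_def by linarith+
    then have q1: "1 / real q \<le> \<epsilon>" "8 * L \<le> \<mu> * real q" using q \<epsilon> \<mu> by (auto simp: field_simps)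
    define \<theta> where "\<theta> = real q * (real q * \<alpha> - real_of_int p)"
    have \<theta>: "\<bar>\<theta>\<bar> \<le> 1 / 2" using mult_left_mono[OF ap, of "real q"] q by (simp add: \<theta>_def abs_mult)
    obtain K where K: "\<And>i::int. \<exists>j<q. \<forall>u\<in>{0..<1}. \<bar>S q ((real_of_int i + u) / real q) - real q
          - (A * (frac (u + real j * \<theta> / real q) - real j * \<theta> / real q) + K)\<bar> \<le> \<epsilon>"
      using Q0[OF cf] qQ unfolding Q_def \<theta>_def by auto
    \<comment> \<open>centres the phases of the blocks, which then lie between \<open>-\<pi> a \<theta>\<close> and \<open>\<pi> a \<theta>\<close>\<close>
    define c where "c = K + A * (1 - \<theta>) / 2"
    define \<psi> where "\<psi> = (\<lambda>v. cos (2 * pi * (v - c) / G))"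
    have \<psi>m[measurable]: "\<psi> \<in> borel_measurable borel" unfolding \<psi>_def by measurable
    have \<psi>1: "\<bar>\<psi> v\<bar> \<le> 1" for v by (simp add: \<psi>_def)
    define H where "H = (\<lambda>x. lift x * \<psi> (\<tau> x))"
    have [measurable]: "H \<in> borel_measurable borel" unfolding H_def by measurable
    have Hi: "integrable lborel (\<lambda>x. indicator circle x * H x)"
    proof (rule Bochner_Integration.integrable_bound[OF integral_lift(1)])
      show "AE x in lborel. norm (indicator circle x * H x) \<le> norm (indicator circle x * lift x)"
        using \<psi>1 lift_pos by (auto simp: H_def abs_mult indicator_def mult_left_le)
    qed measurable
    have block: "(\<integral>u. indicator circle u * H ((real i + u) / real q) \<partial>lborel)
        \<ge> 3 / 4 * \<mu> * (\<integral>u. indicator circle u * lift ((real i + u) / real q) \<partial>lborel) - 2 * L / real q" (is "?lhs \<ge> _ * ?li - _")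
      if i: "i < q" for i
    proof -
      define X where "X = (\<lambda>u. (real i + u) / real q)"
      have Xm[measurable]: "X \<in> borel_measurable borel" unfolding X_def by measurable
      have Xc: "X u \<in> circle" if "u \<in> circle" for u
      proof -
        have "real i + u < real q" using i that by auto
        then show ?thesis using that q by (auto simp: X_def)
      qed
      have XL: "\<bar>lift (X u) - lift (X 0)\<bar> \<le> L / real q" if "u \<in> circle" for u
      proof -
        have "\<bar>lift (X u) - lift (X 0)\<bar> \<le> L * \<bar>X u - X 0\<bar>" using Xc that by (intro L) auto
        also have "X u - X 0 = u / real q" by (simp add: X_def add_divide_distrib)
        also have "L * \<bar>u / real q\<bar> \<le> L * (1 / real q)" using that q L(1) by (intro mult_left_mono) (auto simp: divide_right_mono)
        finally show ?thesis by simp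
      qed
      obtain B where B: "B > 0" "\<And>x. lift x \<le> B" using lift_bounded by blast
      have ib: "integrable lborel (\<lambda>u. indicator circle u * k u)"
        if [measurable]: "k \<in> borel_measurable borel" and "\<And>u. \<bar>k u\<bar> \<le> R" for k :: "real \<Rightarrow> real" and R
      proof (rule Bochner_Integration.integrable_bound[of lborel "\<lambda>u. indicator circle u * R"])
        show "integrable lborel (\<lambda>u. indicator circle u * R)" by (intro integrable_mult_left) (auto simp: integrable_indicator_iff)
        show "AE u in lborel. norm (indicator circle u * k u) \<le> norm (indicator circle u * R)"
          using that(2) by (auto simp: indicator_def intro: order_trans[OF _ abs_ge_self])
      qed measurable
      obtain j where j: "j < q" "\<And>u. u \<in> {0..<1} \<Longrightarrow> \<bar>S q (X u) - real q - (A * (frac (u + real j * \<theta> / real q) - real j * \<theta> / real q) + K)\<bar> \<le> \<epsilon>"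
        using K[of "int i"] unfolding X_def by auto
      define v where "v = real j * \<theta> / real q"
      define \<Phi> where "\<Phi> = (\<lambda>w. cos (2 * pi * (a * w - (a * v + a * (1 - \<theta>) / 2))))"
      have \<Phi>m[measurable]: "\<Phi> \<in> borel_measurable borel" unfolding \<Phi>_def by measurable
      have \<Phi>1: "\<bar>\<Phi> w\<bar> \<le> 1" for w by (simp add: \<Phi>_def)
      have \<Phi>I: "(\<integral>u. indicator circle u * \<Phi> (frac (u + v)) \<partial>lborel) \<ge> \<mu>"
      proof -
        have "(\<integral>u. indicator circle u * \<Phi> (frac (u + v)) \<partial>lborel) = (\<integral>w. indicator circle w * \<Phi> w \<partial>lborel)"
          by (rule integral_circle_rotate) measurable
        also have "\<dots> = sc * cos (2 * pi * (a / 2 - (a * v + a * (1 - \<theta>) / 2)))"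
          unfolding \<Phi>_def sc_def by (rule circle_integral_cos[OF a(1)])
        also have "2 * pi * (a / 2 - (a * v + a * (1 - \<theta>) / 2)) = 2 * pi * a * (\<theta> / 2 - v)" by (simp add: field_simps)
        also have "cos (2 * pi * a * (\<theta> / 2 - v)) = cos \<bar>2 * pi * a * (\<theta> / 2 - v)\<bar>" by simp
        also have "sc * \<dots> \<ge> sc * cos (pi * \<bar>a\<bar> / 2)"
        proof (intro mult_left_mono)
          have "\<theta> / 2 - v = \<theta> * (1 / 2 - real j / real q)" by (simp add: v_def field_simps)
          moreover have "\<bar>1 / 2 - real j / real q\<bar> \<le> 1 / 2" using j q by (simp add: abs_le_iff field_simps)
          moreover have "\<bar>\<theta>\<bar> * \<bar>1 / 2 - real j / real q\<bar> \<le> 1 / 2 * (1 / 2)" using \<theta> calculation(2) by (intro mult_mono) auto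
          ultimately have "\<bar>\<theta> / 2 - v\<bar> \<le> 1 / 2 * (1 / 2)" by (simp only: abs_mult)
          then have "2 * pi * \<bar>a\<bar> * \<bar>\<theta> / 2 - v\<bar> \<le> 2 * pi * \<bar>a\<bar> * (1 / 4)" by (intro mult_left_mono) auto
          then have "\<bar>2 * pi * a * (\<theta> / 2 - v)\<bar> \<le> pi * \<bar>a\<bar> / 2" by (simp add: abs_mult)
          moreover have "pi * \<bar>a\<bar> / 2 \<le> pi" using mult_left_mono[of "\<bar>a\<bar>" 1 pi] a pi_ge_zero by simp
          ultimately show "cos (pi * \<bar>a\<bar> / 2) \<le> cos \<bar>2 * pi * a * (\<theta> / 2 - v)\<bar>" by (intro cos_monotone_0_pi_le) auto
        qed (use sc in simp)
        finally show ?thesis by (simp add: \<mu>_def)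
      qed
      have close: "\<psi> (\<tau> (X u)) \<ge> \<Phi> (frac (u + v)) - \<mu> / 4" if u: "u \<in> circle" for u
      proof -
        define T where "T = A * (frac (u + v) - v) + K"
        have "\<bar>\<tau> (X u) - T\<bar> \<le> 1 / real q + \<epsilon>" using \<tau>[of "X u"] j(2)[of u] u unfolding T_def v_def by simp
        then have T: "\<bar>\<tau> (X u) - T\<bar> \<le> 2 * \<epsilon>" using q1 by linarith
        have "\<psi> T = \<Phi> (frac (u + v))"
        proof -
          have "(T - c) / G = a * frac (u + v) - (a * v + a * (1 - \<theta>) / 2)"
            using Gn by (simp add: T_def c_def a_def field_simps)
          then show ?thesis unfolding \<psi>_def \<Phi>_def by (simp only: times_divide_eq_right[symmetric])
        qed
        moreover have "\<bar>\<psi> (\<tau> (X u)) - \<psi> T\<bar> \<le> \<mu> / 4"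
        proof -
          have "\<bar>\<psi> (\<tau> (X u)) - \<psi> T\<bar> \<le> \<bar>2 * pi * (\<tau> (X u) - c) / G - 2 * pi * (T - c) / G\<bar>"
            unfolding \<psi>_def by (rule abs_cos_diff_le)
          also have "2 * pi * (\<tau> (X u) - c) / G - 2 * pi * (T - c) / G = 2 * pi / G * (\<tau> (X u) - T)"
            by (simp add: diff_divide_distrib right_diff_distrib)
          also have "\<bar>2 * pi / G * (\<tau> (X u) - T)\<bar> \<le> 2 * pi / \<bar>G\<bar> * (2 * \<epsilon>)"
            unfolding abs_mult using T by (intro mult_mono) auto
          also have "2 * pi / \<bar>G\<bar> * (2 * \<epsilon>) = \<mu> / 4" using Gn by (simp add: \<epsilon>_def field_simps)
          finally show ?thesis .
        qed
        ultimately show ?thesis by linarith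
      qed
      have pt: "indicator circle u * H (X u) \<ge> lift (X 0) * (indicator circle u * \<Phi> (frac (u + v))) - L / real q * indicator circle u
          - \<mu> / 4 * (indicator circle u * lift (X u))" for u
      proof (cases "u \<in> circle")
        case True
        have "H (X u) \<ge> lift (X u) * (\<Phi> (frac (u + v)) - \<mu> / 4)"
          unfolding H_def using close[OF True] lift_pos[of "X u"] by (intro mult_left_mono) auto
        moreover have "(lift (X 0) - lift (X u)) * \<Phi> (frac (u + v)) \<le> L / real q * 1"
        proof -
          have "\<bar>(lift (X 0) - lift (X u)) * \<Phi> (frac (u + v))\<bar> \<le> L / real q * 1"
            unfolding abs_mult using XL[OF True] \<Phi>1 L(1) q by (intro mult_mono) (auto simp: abs_minus_commute)
          then show ?thesis by linarith
        qed
        ultimately show ?thesis using True by (simp add: algebra_simps)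
      qed auto
      have i1: "integrable lborel (\<lambda>u. indicator circle u * \<Phi> (frac (u + v)))"
        using \<Phi>1 by (intro ib[of _ 1]) auto
      have i2: "integrable lborel (\<lambda>u. indicator circle u * lift (X u))"
        using B lift_pos by (intro ib[of _ B]) (auto simp: abs_of_pos)
      have i3: "integrable lborel (\<lambda>u. indicator circle u * H (X u))"
      proof (intro ib[of _ B])
        show "\<bar>H (X u)\<bar> \<le> B" for u
          using mult_mono[OF B(2)[of "X u"] \<psi>1[of "\<tau> (X u)"]] lift_pos[of "X u"] B(1) by (simp add: H_def abs_mult)
      qed measurable
      have i4: "integrable lborel (indicator circle :: real \<Rightarrow> real)" by (simp add: integrable_indicator_iff)
      have "(\<integral>u. lift (X 0) * (indicator circle u * \<Phi> (frac (u + v))) - L / real q * indicator circle u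
          - \<mu> / 4 * (indicator circle u * lift (X u)) \<partial>lborel) \<le> (\<integral>u. indicator circle u * H (X u) \<partial>lborel)"
        using i1 i2 i3 i4 pt by (intro integral_mono) auto
      also have "(\<integral>u. lift (X 0) * (indicator circle u * \<Phi> (frac (u + v))) - L / real q * indicator circle u
          - \<mu> / 4 * (indicator circle u * lift (X u)) \<partial>lborel) =
          lift (X 0) * (\<integral>u. indicator circle u * \<Phi> (frac (u + v)) \<partial>lborel) - L / real q - \<mu> / 4 * (\<integral>u. indicator circle u * lift (X u) \<partial>lborel)"
        using i1 i2 i4 by simp
      finally have 1: "lift (X 0) * (\<integral>u. indicator circle u * \<Phi> (frac (u + v)) \<partial>lborel) - L / real q
           - \<mu> / 4 * (\<integral>u. indicator circle u * lift (X u) \<partial>lborel) \<le> (\<integral>u. indicator circle u * H (X u) \<partial>lborel)" .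
      have 2: "lift (X 0) * (\<integral>u. indicator circle u * \<Phi> (frac (u + v)) \<partial>lborel) \<ge> lift (X 0) * \<mu>"
        using \<Phi>I lift_pos[of "X 0"] by (intro mult_left_mono) auto
      have 3: "(\<integral>u. indicator circle u * lift (X u) \<partial>lborel) \<le> lift (X 0) + L / real q"
      proof -
        have "(\<integral>u. indicator circle u * lift (X u) \<partial>lborel) \<le> (\<integral>u. indicator circle u * (lift (X 0) + L / real q) \<partial>lborel)"
        proof (intro integral_mono i2)
          show "integrable lborel (\<lambda>u. indicator circle u * (lift (X 0) + L / real q))" using i4 by (intro integrable_mult_left)
          show "indicator circle u * lift (X u) \<le> indicator circle u * (lift (X 0) + L / real q)" for u
            using XL[of u] by (cases "u \<in> circle") (auto simp: abs_le_iff)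
        qed
        then show ?thesis by simp
      qed
      have "\<mu> * (\<integral>u. indicator circle u * lift (X u) \<partial>lborel) \<le> \<mu> * (lift (X 0) + L / real q)" using 3 \<mu> by (intro mult_left_mono) auto
      also have "\<dots> = lift (X 0) * \<mu> + L * \<mu> / real q" by (simp add: algebra_simps)
      also have "L * \<mu> / real q \<le> L / real q" using \<mu> L(1) by (intro divide_right_mono mult_left_le) auto
      finally show ?thesis using 1 2 by (simp add: X_def)
    qed
    have "(\<integral>z. indicator dom z * \<psi> (\<tau> (fst z)) \<partial>lborel) = (\<integral>x. indicator circle x * H x \<partial>lborel)"
      unfolding H_def using \<psi>1 by (intro integral_dom_base) auto
    also have "\<dots> = (\<Sum>i<q. (1 / real q) * (\<integral>u. indicator circle u * H ((real i + u) / real q) \<partial>lborel))"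
      by (rule circle_integral_blocks[OF Hi q(2)])
    also have "\<dots> \<ge> (\<Sum>i<q. (1 / real q) * (3 / 4 * \<mu> * (\<integral>u. indicator circle u * lift ((real i + u) / real q) \<partial>lborel) - 2 * L / real q))"
      using block q by (intro sum_mono mult_left_mono) auto
    also have "(\<Sum>i<q. (1 / real q) * (3 / 4 * \<mu> * (\<integral>u. indicator circle u * lift ((real i + u) / real q) \<partial>lborel) - 2 * L / real q))
       = 3 / 4 * \<mu> * (\<Sum>i<q. (1 / real q) * (\<integral>u. indicator circle u * lift ((real i + u) / real q) \<partial>lborel)) - 2 * L / real q"
      using q by (simp add: sum_subtractf sum_distrib_left right_diff_distrib mult_ac)
    also have "(\<Sum>i<q. (1 / real q) * (\<integral>u. indicator circle u * lift ((real i + u) / real q) \<partial>lborel)) = 1"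
      using circle_integral_blocks[OF integral_lift(1) q(2)] integral_lift(2) by simp
    finally have "3 / 4 * \<mu> - 2 * L / real q \<le> (\<integral>z. indicator dom z * \<psi> (\<tau> (fst z)) \<partial>lborel)" by simp
    moreover have "2 * L / real q \<le> \<mu> / 4" using q1 q by (simp add: field_simps)
    ultimately have "\<mu> / 2 \<le> (\<integral>z. indicator dom z * \<psi> (\<tau> (fst z)) \<partial>lborel)" by linarith
    then show ?thesis unfolding \<psi>_def by blast
  qed
  have "\<mu> / 2 > 0" using \<mu>(1) by simp
  then show ?thesis
    apply (rule exI[of _ "\<mu> / 2", OF conjI], intro exI[of _ Q] allI impI)
    apply (rule main)
       apply (assumption | erule spec)+
    done
qed

end

section \<open>Transport of the displacement through a conjugacy\<close>

lemma borel_measurable_extend_zero: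
  fixes k :: "real \<times> real \<Rightarrow> real"
  assumes "k \<in> borel_measurable (restrict_space lborel D)" "D \<in> sets borel"
  shows "(\<lambda>z. indicator D z * k z) \<in> borel_measurable borel"
  using borel_measurable_restrict_space_iff[of D lborel k] assms by simp

text \<open>
  At a rigidity time \<open>q\<close> of the first rotation, time \<open>q + \<tau>\<close> of the first flow is a small shear.  The
  conjugacy turns this into a near return of the second flow at time \<open>q + \<sigma>\<close>, where \<open>\<sigma>\<close> has the
  same distribution as \<open>\<tau>\<close>.  The same Fourier coefficient, at frequency \<open>1/G\<close>, is then both small and
  bounded away from zero.
\<close>

lemma not_half_isomorphic:
  assumes X: "one_jump_roof \<alpha> A m h h' f" and Y: "one_jump_roof \<beta> G n k k' g" and AG: "\<bar>A\<bar> < \<bar>G\<bar>"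
  shows "\<not> half_isomorphic
     (restrict_space lborel (roof_domain f)) (special_flow circle (rotation \<alpha>) f)
     (restrict_space lborel (roof_domain g)) (special_flow circle (rotation \<beta>) g)"
proof
  interpret X: one_jump_roof \<alpha> A m h h' f by (rule X)
  interpret Y: one_jump_roof \<beta> G n k k' g by (rule Y)
  let ?M = "restrict_space lborel X.dom" and ?N = "restrict_space lborel Y.dom"
  assume "half_isomorphic ?M X.flow ?N Y.flow"
  then obtain \<Phi> \<Psi> where \<Phi>: "\<Phi> \<in> measurable ?M ?N" and \<Psi>: "\<Psi> \<in> measurable ?N ?M" and distr: "distr ?N ?M \<Psi> = ?M"
    and inv: "AE y in ?N. \<Phi> (\<Psi> y) = y" and eq: "\<And>t. t \<ge> 0 \<Longrightarrow> AE z in ?M. \<Phi> (X.flow t z) = Y.flow t (\<Phi> z)"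
    unfolding half_isomorphic_def by blast
  have Xd[measurable]: "X.dom \<in> sets borel" and Yd[measurable]: "Y.dom \<in> sets borel"
    by (rule X.dom_borel Y.dom_borel)+
  have spM: "space ?M = X.dom" and spN: "space ?N = Y.dom" by (simp_all add: space_restrict_space)
  have \<Phi>in: "\<Phi> z \<in> Y.dom" if "z \<in> X.dom" for z using measurable_space[OF \<Phi>, of z] that spM spN by simp
  have \<Psi>in: "\<Psi> y \<in> X.dom" if "y \<in> Y.dom" for y using measurable_space[OF \<Psi>, of y] that spM spN by simp
  have fst_m[measurable]: "fst \<in> borel_measurable (borel :: (real \<times> real) measure)"
    and snd_m[measurable]: "snd \<in> borel_measurable (borel :: (real \<times> real) measure)"
    by (intro borel_measurable_continuous_onI continuous_intros)+
  have \<Phi>b: "\<Phi> \<in> borel_measurable ?M" and \<Psi>b: "\<Psi> \<in> borel_measurable ?N"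
    using \<Phi> \<Psi> by (auto simp: measurable_restrict_space2_iff)
  define \<phi>0 :: "real \<times> real \<Rightarrow> real" where "\<phi>0 = indicator X.dom"
  define \<phi>1 where "\<phi>1 = (\<lambda>z. indicator X.dom z * fst (\<Phi> z))"
  define \<phi>2 where "\<phi>2 = (\<lambda>z. indicator X.dom z * snd (\<Phi> z))"
  have \<phi>m: "\<phi>0 \<in> borel_measurable borel" "\<phi>1 \<in> borel_measurable borel" "\<phi>2 \<in> borel_measurable borel"
  proof -
    show "\<phi>0 \<in> borel_measurable borel" unfolding \<phi>0_def by measurable
    have "(\<lambda>z. fst (\<Phi> z)) \<in> borel_measurable ?M" "(\<lambda>z. snd (\<Phi> z)) \<in> borel_measurable ?M"
      using measurable_compose[OF \<Phi>b fst_m] measurable_compose[OF \<Phi>b snd_m] by auto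
    then show "\<phi>1 \<in> borel_measurable borel" "\<phi>2 \<in> borel_measurable borel"
      unfolding \<phi>1_def \<phi>2_def using Xd by (auto intro: borel_measurable_extend_zero)
  qed
  define C where "C = 3 * \<bar>A\<bar> + 2"
  have C: "C \<ge> 0" by (simp add: C_def)
  obtain \<gamma> Q1 where \<gamma>: "\<gamma> > 0" and coeff: "\<And>p q \<tau>. close_fraction \<alpha> p q \<Longrightarrow> q \<ge> Q1 \<Longrightarrow> \<tau> \<in> borel_measurable borel \<Longrightarrow>
    (\<And>x. \<bar>\<tau> x - (X.S q x - real q)\<bar> \<le> 1 / real q) \<Longrightarrow>
    \<exists>c. (\<integral>z. indicator X.dom z * cos (2 * pi * (\<tau> (fst z) - c) / G) \<partial>lborel) \<ge> \<gamma>"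
    using X.rigidity_time_fourier_coefficient[OF AG] by blast
  obtain Q2 where Q2: "\<And>p q x. close_fraction \<alpha> p q \<Longrightarrow> q \<ge> Q2 \<Longrightarrow> \<bar>X.S q x - real q\<bar> \<le> 3 * \<bar>A\<bar> + 1"
    using X.S_close_fraction_bounded by blast
  have \<gamma>2: "\<gamma> / 2 > 0" using \<gamma> by simp
  obtain \<eta> t0 where \<eta>: "\<eta> > 0" and cancel: "\<And>t \<sigma> Bad c. t \<ge> t0 \<Longrightarrow> \<sigma> \<in> borel_measurable borel \<Longrightarrow> (\<forall>y\<in>Y.dom. \<bar>\<sigma> y\<bar> \<le> C) \<Longrightarrow>
      Bad \<in> sets borel \<Longrightarrow> emeasure lborel Bad \<le> ennreal \<eta> \<Longrightarrow>
      (\<forall>y\<in>Y.dom - Bad. \<bar>fst (Y.flow (t + \<sigma> y) y) - fst y\<bar> \<le> \<eta> \<and> \<bar>snd (Y.flow (t + \<sigma> y) y) - snd y\<bar> \<le> \<eta>) \<Longrightarrow>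
      \<bar>\<integral>y. indicator Y.dom y * cos (2 * pi * (\<sigma> y - c) / G) \<partial>lborel\<bar> \<le> \<gamma> / 2"
    using Y.nearly_returning_cancellation[OF C \<gamma>2] by blast
  define \<eta>' where "\<eta>' = min (\<eta> / 3) (1 / 2)"
  have \<eta>': "\<eta>' > 0" "\<eta>' \<le> \<eta> / 3" "\<eta>' < 1" using \<eta> by (auto simp: \<eta>'_def)
  have inv_lemma: "\<exists>\<kappa>>0. \<forall>d r. \<bar>d\<bar> \<le> \<kappa> \<longrightarrow> r \<in> borel_measurable borel \<longrightarrow> (\<forall>x. \<bar>r x\<bar> \<le> \<kappa>) \<longrightarrow>
     (\<exists>E\<in>sets borel. emeasure lborel E \<le> ennreal \<eta>' \<and> (\<forall>z\<in>X.dom - E. \<bar>\<phi> (shear d r z) - \<phi> z\<bar> \<le> \<eta>'))"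
    if "\<phi> \<in> borel_measurable borel" for \<phi>
    using borel_nearly_shear_invariant[OF that X.dom_bounded \<eta>'(1)] .
  obtain \<kappa>0 where \<kappa>0: "\<kappa>0 > 0" and near0: "\<forall>d r. \<bar>d\<bar> \<le> \<kappa>0 \<longrightarrow> r \<in> borel_measurable borel \<longrightarrow> (\<forall>x. \<bar>r x\<bar> \<le> \<kappa>0) \<longrightarrow>
     (\<exists>E\<in>sets borel. emeasure lborel E \<le> ennreal \<eta>' \<and> (\<forall>z\<in>X.dom - E. \<bar>\<phi>0 (shear d r z) - \<phi>0 z\<bar> \<le> \<eta>'))"
    using inv_lemma[OF \<phi>m(1)] by (elim exE conjE)
  obtain \<kappa>1 where \<kappa>1: "\<kappa>1 > 0" and near1: "\<forall>d r. \<bar>d\<bar> \<le> \<kappa>1 \<longrightarrow> r \<in> borel_measurable borel \<longrightarrow> (\<forall>x. \<bar>r x\<bar> \<le> \<kappa>1) \<longrightarrow>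
     (\<exists>E\<in>sets borel. emeasure lborel E \<le> ennreal \<eta>' \<and> (\<forall>z\<in>X.dom - E. \<bar>\<phi>1 (shear d r z) - \<phi>1 z\<bar> \<le> \<eta>'))"
    using inv_lemma[OF \<phi>m(2)] by (elim exE conjE)
  obtain \<kappa>2 where \<kappa>2: "\<kappa>2 > 0" and near2: "\<forall>d r. \<bar>d\<bar> \<le> \<kappa>2 \<longrightarrow> r \<in> borel_measurable borel \<longrightarrow> (\<forall>x. \<bar>r x\<bar> \<le> \<kappa>2) \<longrightarrow>
     (\<exists>E\<in>sets borel. emeasure lborel E \<le> ennreal \<eta>' \<and> (\<forall>z\<in>X.dom - E. \<bar>\<phi>2 (shear d r z) - \<phi>2 z\<bar> \<le> \<eta>'))"
    using inv_lemma[OF \<phi>m(3)] by (elim exE conjE)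
  define \<kappa> where "\<kappa> = min \<kappa>0 (min \<kappa>1 \<kappa>2)"
  have \<kappa>p: "\<kappa> > 0" "\<kappa> \<le> \<kappa>0" "\<kappa> \<le> \<kappa>1" "\<kappa> \<le> \<kappa>2" using \<kappa>0 \<kappa>1 \<kappa>2 by (auto simp: \<kappa>_def)
  obtain p q where cf: "close_fraction \<alpha> p q"
      and qN: "q \<ge> max (max Q1 Q2) (max (nat \<lceil>t0\<rceil>) (max (nat \<lceil>C\<rceil>) (nat \<lceil>1 / \<kappa>\<rceil>)))"
    using close_fraction_unbounded[OF X.irrational] by blast
  have q: "real q \<ge> 1" and ap: "\<bar>real q * \<alpha> - real_of_int p\<bar> \<le> 1 / (2 * real q)" using cf by (auto simp: close_fraction_def)
  have qs: "q \<ge> Q1" "q \<ge> Q2" "real q \<ge> t0" "real q \<ge> C" "real q \<ge> 1 / \<kappa>" using qN by linarith+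
  have q\<kappa>: "1 / real q \<le> \<kappa>" using qs(5) q \<kappa>p(1) by (simp add: field_simps)
  define d where "d = real q * \<alpha> - real_of_int p"
  have d: "\<bar>d\<bar> \<le> \<kappa>"
  proof -
    have "1 / (2 * real q) \<le> 1 / real q" using q by (simp add: field_simps)
    then show ?thesis using ap q\<kappa> unfolding d_def by linarith
  qed
  \<comment> \<open>Rounding makes \<open>\<tau>\<close> take countably many values, so the null sets in the intertwining relation,
    which depend on the time, can be united.\<close>
  define \<tau> where "\<tau> = (\<lambda>x. real_of_int \<lfloor>real q * (X.S q x - real q)\<rfloor> / real q)"
  define r where "r = (\<lambda>x. X.S q x - real q - \<tau> x)"
  have \<tau>m[measurable]: "\<tau> \<in> borel_measurable borel" unfolding \<tau>_def by measurable
  have rm[measurable]: "r \<in> borel_measurable borel" unfolding r_def by measurable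
  have r: "0 \<le> r x" "r x \<le> 1 / real q" for x
  proof -
    have "real q * r x = real q * (X.S q x - real q) - real_of_int \<lfloor>real q * (X.S q x - real q)\<rfloor>"
      using q by (simp add: r_def \<tau>_def right_diff_distrib)
    then have "0 \<le> real q * r x" "real q * r x \<le> 1" by linarith+
    then show "0 \<le> r x" "r x \<le> 1 / real q" using q by (simp_all add: zero_le_mult_iff field_simps)
  qed
  have r\<kappa>: "\<forall>x. \<bar>r x\<bar> \<le> \<kappa>" using r q\<kappa> by (auto intro: order_trans)
  have \<tau>C: "\<bar>\<tau> x\<bar> \<le> C" for x
  proof -
    have "1 / real q \<le> 1" using q by simp
    then show ?thesis using Q2[OF cf qs(2), of x] r[of x] unfolding r_def C_def by linarith
  qed
  define V where "V = shear d r"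
  have "\<bar>d\<bar> \<le> \<kappa>0" "\<bar>d\<bar> \<le> \<kappa>1" "\<bar>d\<bar> \<le> \<kappa>2" "\<forall>x. \<bar>r x\<bar> \<le> \<kappa>0" "\<forall>x. \<bar>r x\<bar> \<le> \<kappa>1" "\<forall>x. \<bar>r x\<bar> \<le> \<kappa>2"
    using d r\<kappa> \<kappa>p by (auto intro: order_trans)
  note small = this
  obtain E0 where E0[measurable]: "E0 \<in> sets borel" and E0e: "emeasure lborel E0 \<le> ennreal \<eta>'"
    and V0: "\<forall>z\<in>X.dom - E0. \<bar>\<phi>0 (V z) - \<phi>0 z\<bar> \<le> \<eta>'"
    using near0[THEN spec, THEN spec, THEN mp, OF small(1), THEN mp, OF rm, THEN mp, OF small(4)]
    unfolding V_def by (elim bexE conjE)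
  obtain E1 where E1[measurable]: "E1 \<in> sets borel" and E1e: "emeasure lborel E1 \<le> ennreal \<eta>'"
    and V1: "\<forall>z\<in>X.dom - E1. \<bar>\<phi>1 (V z) - \<phi>1 z\<bar> \<le> \<eta>'"
    using near1[THEN spec, THEN spec, THEN mp, OF small(2), THEN mp, OF rm, THEN mp, OF small(5)]
    unfolding V_def by (elim bexE conjE)
  obtain E2 where E2[measurable]: "E2 \<in> sets borel" and E2e: "emeasure lborel E2 \<le> ennreal \<eta>'"
    and V2: "\<forall>z\<in>X.dom - E2. \<bar>\<phi>2 (V z) - \<phi>2 z\<bar> \<le> \<eta>'"
    using near2[THEN spec, THEN spec, THEN mp, OF small(3), THEN mp, OF rm, THEN mp, OF small(6)]
    unfolding V_def by (elim bexE conjE)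
  define E where "E = E0 \<union> E1 \<union> E2"
  have Em[measurable]: "E \<in> sets borel" unfolding E_def by measurable
  have EE: "emeasure lborel E \<le> ennreal \<eta>"
  proof -
    have "emeasure lborel E \<le> emeasure lborel E0 + emeasure lborel E1 + emeasure lborel E2"
      unfolding E_def by (intro order_trans[OF emeasure_subadditive] add_mono order_refl emeasure_subadditive) auto
    also have "\<dots> \<le> ennreal \<eta>' + ennreal \<eta>' + ennreal \<eta>'" using E0e E1e E2e by (intro add_mono)
    also have "\<dots> = ennreal (3 * \<eta>')" using \<eta>' by (simp add: ennreal_plus[symmetric] del: ennreal_plus)
    also have "\<dots> \<le> ennreal \<eta>" using \<eta>'(2) by (intro ennreal_leI) simp
    finally show ?thesis .
  qed
  have Vdom: "V z \<in> X.dom" if "z \<in> X.dom - E" for z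
    using V0[rule_format, of z] that \<eta>'(3) by (cases "V z \<in> X.dom") (auto simp: \<phi>0_def E_def)
  have V\<Phi>: "\<bar>fst (\<Phi> (V z)) - fst (\<Phi> z)\<bar> \<le> \<eta>" "\<bar>snd (\<Phi> (V z)) - snd (\<Phi> z)\<bar> \<le> \<eta>" if z: "z \<in> X.dom - E" for z
    using V1[rule_format, of z] V2[rule_format, of z] z Vdom[OF z] \<eta>'(2) \<eta> by (simp_all add: \<phi>1_def \<phi>2_def E_def)
  have flowV: "X.flow (real q + \<tau> (fst z)) z = V z" if z: "z \<in> X.dom - E" for z
  proof -
    obtain x s where xs: "z = (x, s)" by (cases z)
    have V: "V z = (x + d, s - r x)" by (simp add: V_def shear_def xs)
    have dom: "(x, s) \<in> X.dom" "(x + d, s - r x) \<in> X.dom" using z Vdom[OF z] V xs by auto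
    have xd: "x + real q * \<alpha> = x + d + of_int p" by (simp add: d_def)
    have l: "X.lift (x + real q * \<alpha>) = X.lift (x + d)"
      unfolding xd by (metis X.lift_frac frac_add_int)
    have t: "s + (real q + \<tau> x) = X.S q x + (s - r x)" by (simp add: r_def)
    have "X.flow (real q + \<tau> x) (x, s) = (frac (x + real q * \<alpha>), s + (real q + \<tau> x) - X.S q x)"
    proof (rule X.flow_eq)
      show "x \<in> circle" using dom by (simp add: X.dom_iff)
      show "X.S q x \<le> s + (real q + \<tau> x)" "s + (real q + \<tau> x) < X.S (Suc q) x"
        unfolding t orbit_sum_Suc l using dom by (auto simp: X.dom_iff)
    qed
    also have "frac (x + real q * \<alpha>) = x + d"
      unfolding xd frac_add_int using dom by (simp add: X.dom_iff frac_eq)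
    finally show ?thesis using V unfolding xs fst_conv t by simp
  qed
  have "AE z in ?M. \<forall>l::int. real q + real_of_int l / real q \<ge> 0 \<longrightarrow>
      \<Phi> (X.flow (real q + real_of_int l / real q) z) = Y.flow (real q + real_of_int l / real q) (\<Phi> z)"
    unfolding AE_all_countable using eq by (auto intro: AE_I2 AE_mp)
  then have "AE z in ?M. \<Phi> (X.flow (real q + \<tau> (fst z)) z) = Y.flow (real q + \<tau> (fst z)) (\<Phi> z)"
  proof eventually_elim
    case (elim z)
    have "real q + \<tau> (fst z) \<ge> 0" using \<tau>C[of "fst z"] qs(4) by linarith
    then show ?case using elim unfolding \<tau>_def by blast
  qed
  then have "AE z in distr ?N ?M \<Psi>. \<Phi> (X.flow (real q + \<tau> (fst z)) z) = Y.flow (real q + \<tau> (fst z)) (\<Phi> z)"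
    by (simp only: distr)
  from AE_distrD[OF \<Psi> this] inv
  have "AE y in ?N. \<Phi> (X.flow (real q + \<tau> (fst (\<Psi> y))) (\<Psi> y)) = Y.flow (real q + \<tau> (fst (\<Psi> y))) y"
    by eventually_elim simp
  with inv have "AE y in ?N. \<Phi> (\<Psi> y) = y \<and> \<Phi> (X.flow (real q + \<tau> (fst (\<Psi> y))) (\<Psi> y)) = Y.flow (real q + \<tau> (fst (\<Psi> y))) y"
    by eventually_elim simp
  then have "AE y in lborel. y \<in> Y.dom \<longrightarrow> \<Phi> (\<Psi> y) = y \<and> \<Phi> (X.flow (real q + \<tau> (fst (\<Psi> y))) (\<Psi> y)) = Y.flow (real q + \<tau> (fst (\<Psi> y))) y"
    by (subst (asm) AE_restrict_space_iff) auto
  then obtain N0 where N0: "N0 \<in> null_sets lborel"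
    and good: "\<And>y. y \<in> Y.dom \<Longrightarrow> y \<notin> N0 \<Longrightarrow> \<Phi> (\<Psi> y) = y \<and> \<Phi> (X.flow (real q + \<tau> (fst (\<Psi> y))) (\<Psi> y)) = Y.flow (real q + \<tau> (fst (\<Psi> y))) y"
    unfolding eventually_ae_filter by (auto simp: subset_eq)
  define \<sigma> where "\<sigma> = (\<lambda>y. indicator Y.dom y * \<tau> (fst (\<Psi> y)))"
  have \<sigma>m: "\<sigma> \<in> borel_measurable borel"
  proof -
    have "(\<lambda>y. \<tau> (fst (\<Psi> y))) \<in> borel_measurable ?N"
      using measurable_compose[OF measurable_compose[OF \<Psi>b fst_m] \<tau>m] by simp
    then show ?thesis unfolding \<sigma>_def using Yd by (rule borel_measurable_extend_zero)
  qed
  define Bad where "Bad = (\<Psi> -` (E \<inter> X.dom) \<inter> Y.dom) \<union> N0"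
  have "X.dom \<inter> E \<in> sets ?M" unfolding sets_restrict_space using Em by (intro imageI) simp
  then have EM: "E \<inter> X.dom \<in> sets ?M" by (simp only: Int_commute)
  have PN: "\<Psi> -` (E \<inter> X.dom) \<inter> Y.dom \<in> sets ?N" using measurable_sets[OF \<Psi> EM] spN by simp
  then have P: "\<Psi> -` (E \<inter> X.dom) \<inter> Y.dom \<in> sets borel" by (auto simp: sets_restrict_space)
  have BadM: "Bad \<in> sets borel" unfolding Bad_def using P N0 by (auto simp: null_sets_def)
  have BadE: "emeasure lborel Bad \<le> ennreal \<eta>"
  proof -
    have "emeasure lborel Bad \<le> emeasure lborel (\<Psi> -` (E \<inter> X.dom) \<inter> Y.dom) + emeasure lborel N0"
      unfolding Bad_def using P N0 by (intro emeasure_subadditive) (auto simp: null_sets_def)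
    also have "\<dots> = emeasure ?N (\<Psi> -` (E \<inter> X.dom) \<inter> space ?N)"
      using N0 by (simp add: spN emeasure_restrict_space null_sets_def)
    also have "\<dots> = emeasure (distr ?N ?M \<Psi>) (E \<inter> X.dom)" using emeasure_distr[OF \<Psi> EM] by simp
    also have "\<dots> = emeasure ?M (E \<inter> X.dom)" by (simp only: distr)
    also have "\<dots> = emeasure lborel (E \<inter> X.dom)" by (intro emeasure_restrict_space) auto
    also have "\<dots> \<le> emeasure lborel E" by (intro emeasure_mono) auto
    finally show ?thesis using EE by (rule order_trans)
  qed
  have returns: "\<forall>y\<in>Y.dom - Bad. \<bar>fst (Y.flow (real q + \<sigma> y) y) - fst y\<bar> \<le> \<eta> \<and> \<bar>snd (Y.flow (real q + \<sigma> y) y) - snd y\<bar> \<le> \<eta>"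
  proof
    fix y assume y: "y \<in> Y.dom - Bad"
    then have z: "\<Psi> y \<in> X.dom - E" using \<Psi>in[of y] by (auto simp: Bad_def)
    have g: "\<Phi> (\<Psi> y) = y" "\<Phi> (X.flow (real q + \<tau> (fst (\<Psi> y))) (\<Psi> y)) = Y.flow (real q + \<tau> (fst (\<Psi> y))) y"
      using good[of y] y by (auto simp: Bad_def)
    have "Y.flow (real q + \<sigma> y) y = \<Phi> (V (\<Psi> y))" using y g(2) flowV[OF z] by (simp add: \<sigma>_def)
    then show "\<bar>fst (Y.flow (real q + \<sigma> y) y) - fst y\<bar> \<le> \<eta> \<and> \<bar>snd (Y.flow (real q + \<sigma> y) y) - snd y\<bar> \<le> \<eta>"
      using V\<Phi>[OF z] g(1) by simp
  qed
  have "\<bar>\<tau> x - (X.S q x - real q)\<bar> \<le> 1 / real q" for x using r[of x] by (simp add: r_def)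
  then obtain c where c: "(\<integral>z. indicator X.dom z * cos (2 * pi * (\<tau> (fst z) - c) / G) \<partial>lborel) \<ge> \<gamma>"
    using coeff[OF cf qs(1) \<tau>m] by blast
  have \<sigma>C: "\<forall>y\<in>Y.dom. \<bar>\<sigma> y\<bar> \<le> C" using \<tau>C by (simp add: \<sigma>_def)
  have small: "\<bar>\<integral>y. indicator Y.dom y * cos (2 * pi * (\<sigma> y - c) / G) \<partial>lborel\<bar> \<le> \<gamma> / 2"
    by (rule cancel[OF qs(3) \<sigma>m \<sigma>C BadM BadE returns])
  let ?F = "\<lambda>z :: real \<times> real. cos (2 * pi * (\<tau> (fst z) - c) / G)"
  have Fm: "?F \<in> borel_measurable ?M"
  proof -
    have "(\<lambda>x. cos (2 * pi * (\<tau> x - c) / G)) \<in> borel_measurable borel" by measurable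
    from measurable_compose[OF fst_m this] have "?F \<in> borel_measurable borel" .
    then show ?thesis by (intro measurable_restrict_space1) simp
  qed
  have "(\<integral>z. indicator X.dom z * ?F z \<partial>lborel) = (\<integral>z. ?F z \<partial>?M)" by (subst integral_restrict_space) auto
  also have "\<dots> = (\<integral>z. ?F z \<partial>(distr ?N ?M \<Psi>))" by (simp only: distr)
  also have "\<dots> = (\<integral>y. ?F (\<Psi> y) \<partial>?N)" by (rule integral_distr[OF \<Psi> Fm])
  also have "\<dots> = (\<integral>y. indicator Y.dom y * ?F (\<Psi> y) \<partial>lborel)" by (subst integral_restrict_space) auto
  also have "\<dots> = (\<integral>y. indicator Y.dom y * cos (2 * pi * (\<sigma> y - c) / G) \<partial>lborel)"
    by (rule Bochner_Integration.integral_cong) (auto simp: \<sigma>_def indicator_def)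
  finally show False using c small \<gamma> by linarith
qed

lemma one_jump_roofI:
  assumes irr: "\<alpha> \<notin> \<rat>" and pos: "\<And>x. x \<in> circle \<Longrightarrow> f x > 0"
    and int: "(\<integral>x. f x \<partial>circle_measure) = 1" and eq: "\<And>x. x \<in> circle \<Longrightarrow> f x = A * frac x + h x"
    and A: "A \<noteq> 0" and C1: "C1_circle h"
  shows "\<exists>m h'. one_jump_roof \<alpha> A m (\<lambda>x. h (frac x)) h' f"
proof -
  let ?h = "\<lambda>x. h (frac x)"
  obtain D where D: "\<And>x. (?h has_vector_derivative D x) (at x)" "continuous_on UNIV D"
    using C1 unfolding C1_circle_def C1_differentiable_on_def by auto
  have per: "?h (x + 1) = ?h x" for x by (simp add: frac_def)
  have cont: "continuous_on UNIV ?h"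
    using D(1) by (intro continuous_at_imp_continuous_on ballI) (auto intro: has_vector_derivative_continuous)
  define m where "m = integral {0..1} ?h"
  have m: "(?h has_integral m) {0..1}"
    unfolding m_def by (intro integrable_integral integrable_continuous_interval) (rule continuous_on_subset[OF cont], simp)
  have c: "continuous_on {0..1} (\<lambda>x. A * x + ?h x)"
    by (intro continuous_intros) (rule continuous_on_subset[OF cont], simp)
  have i: "((\<lambda>x. A * x + ?h x) has_integral A / 2 + m) {0..1}"
    by (rule has_integral_add[OF has_integral_linear_unit m])
  have "1 = (\<integral>x. indicator circle x * f x \<partial>lborel)"
    using int unfolding circle_measure_def by (subst (asm) integral_restrict_space) auto
  also have "\<dots> = (\<integral>x. indicator circle x * (A * x + ?h x) \<partial>lborel)"
    by (rule Bochner_Integration.integral_cong) (auto simp: indicator_def eq frac_eq)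
  also have "\<dots> = A / 2 + m" by (rule circle_integral_eq(2)[OF c i])
  finally have mean: "A / 2 + m = 1" by simp
  have "one_jump_roof \<alpha> A m ?h D f"
  proof
    show "f x = A * frac x + ?h x" if "x \<in> circle" for x using eq[OF that] that by (simp add: frac_eq)
    show "(?h has_real_derivative D x) (at x)" for x
      using D(1) by (simp add: has_real_derivative_iff_has_vector_derivative)
  qed (use irr pos per m mean A D(2) in auto)
  then show ?thesis by blast
qed

theorem theorem1p1:
  fixes \<alpha> \<beta> A\<^sub>f A\<^sub>g :: real and f g f\<^sub>a\<^sub>c g\<^sub>a\<^sub>c :: "real \<Rightarrow> real"
  assumes "\<alpha> \<in> circle" "\<alpha> \<notin> \<rat>" "\<beta> \<in> circle" "\<beta> \<notin> \<rat>"
    and "\<And>x. x \<in> circle \<Longrightarrow> f x > 0" "\<And>x. x \<in> circle \<Longrightarrow> g x > 0"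
    and "(\<integral>x. f x \<partial>circle_measure) = 1" "(\<integral>x. g x \<partial>circle_measure) = 1"
    and "\<And>x. x \<in> circle \<Longrightarrow> f x = A\<^sub>f * frac x + f\<^sub>a\<^sub>c x"
    and "\<And>x. x \<in> circle \<Longrightarrow> g x = A\<^sub>g * frac x + g\<^sub>a\<^sub>c x"
    and "A\<^sub>f \<noteq> 0" "A\<^sub>g \<noteq> 0"
    and "C1_circle f\<^sub>a\<^sub>c" "C1_circle g\<^sub>a\<^sub>c"
    and "\<bar>A\<^sub>f\<bar> \<noteq> \<bar>A\<^sub>g\<bar>"
  shows "\<not> flows_isomorphic
             (special_measure circle_measure f) (special_flow circle (rotation \<alpha>) f)
             (special_measure circle_measure g) (special_flow circle (rotation \<beta>) g)"
proof
  obtain m h' where X: "one_jump_roof \<alpha> A\<^sub>f m (\<lambda>x. f\<^sub>a\<^sub>c (frac x)) h' f"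
    using one_jump_roofI[of \<alpha> f A\<^sub>f f\<^sub>a\<^sub>c] assms by blast
  obtain n k' where Y: "one_jump_roof \<beta> A\<^sub>g n (\<lambda>x. g\<^sub>a\<^sub>c (frac x)) k' g"
    using one_jump_roofI[of \<beta> g A\<^sub>g g\<^sub>a\<^sub>c] assms by blast
  assume "flows_isomorphic
             (special_measure circle_measure f) (special_flow circle (rotation \<alpha>) f)
             (special_measure circle_measure g) (special_flow circle (rotation \<beta>) g)"
  then have iso: "flows_isomorphic
             (restrict_space lborel (roof_domain f)) (special_flow circle (rotation \<alpha>) f)
             (restrict_space lborel (roof_domain g)) (special_flow circle (rotation \<beta>) g)"
    by (simp add: special_measure_eq one_jump_roof.dom_borel[OF X] one_jump_roof.dom_borel[OF Y])
  consider "\<bar>A\<^sub>f\<bar> < \<bar>A\<^sub>g\<bar>" | "\<bar>A\<^sub>g\<bar> < \<bar>A\<^sub>f\<bar>" using assms(15) by linarith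
  then show False
  proof cases
    case 1
    show False using not_half_isomorphic[OF X Y 1] half_isomorphic_direct[OF iso] by blast
  next
    case 2
    have "half_isomorphic
       (restrict_space lborel (roof_domain g)) (special_flow circle (rotation \<beta>) g)
       (restrict_space lborel (roof_domain f)) (special_flow circle (rotation \<alpha>) f)"
      using half_isomorphic_inverse[OF iso] one_jump_roof.flow_nonsingular[OF X] one_jump_roof.flow_in_dom[OF X]
      by (simp add: space_restrict_space)
    then show False using not_half_isomorphic[OF Y X 2] by blast
  qed
qed

end
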